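(* Let $G$ be an i.c.c. (discrete) group and $\alpha$ an ergodic, compact, trace-preserving action of $G$ on a tracial von Neumann algebra $(N,\tau)$ with separable predual. Let $M=N\rtimes_\alpha G$. Fix an increasing sequence $(N_k)$ of finite-dimensional $G$-invariant subspaces of $N$ such that $\bigcup_kN_k$ is $\|\cdot\|_2$-dense in $N$. Then: (i) For any $w\in\mathcal N(L(G)\subseteq M)$ one can find $k\in\mathbb N$, an orthonormal basis $\{\xi_1,\dots,\xi_{n_k}\}$ of $N_k$ and elements $w_1,\dots,w_{n_k}\in L(G)$ such that $w=\sum_i\xi_iw_i$. (ii) With $w$, $k$, $\xi_i$, $w_i$ as in (i), let $\alpha^k:G\to\mathcal U(N_k)$ be the unitary representation induced by $\alpha$ and for every $g\in G$ consider the matrix $M(g)=(\langle\alpha^k_g(\xi_j),\xi_i\rangle)_{1\le i,j\le n_k}\in\mathbb M_{n_k}(\mathbb C)$. Let $X\in\mathbb M_{n_k}(M)$ be the matrix whose entries satisfy $x_{i,j}=w_i$ if $j=1$ and $x_{i,j}=0$ if $j>1$. Then $$\mathrm{diag}(u_g)\,M(g)\,X=X\,\mathrm{diag}(\mathrm{Ad}(w^* )(u_g))\quad\text{for all }g\in G.$$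
   Context: i.c.c. means every nontrivial conjugacy class of $G$ is infinite. $\tau$ is a faithful normal tracial state; $\|x\|_2=\tau(x^*x)^{1/2}$, and $N_k$ carries the inner product of $L^2(N,\tau)$ (linear in the first variable): $\langle x,y\rangle=\tau(y^*x)$; $n_k=\dim N_k$. Ergodic: the only elements of $N$ fixed by all $\alpha_g$ are scalars. Compact: for each $x\in N$ the orbit $\{\alpha_g(x):g\in G\}$ has compact $\|\cdot\|_2$-closure. $N\rtimes_\alpha G$ is the crossed product, generated by $N$ and unitaries $u_g$ with $u_gxu_g^*=\alpha_g(x)$; $L(G)=\{u_g\}''$. $\mathcal N(B\subseteq P)=\{u\in\mathcal U(P):uBu^*=B\}$. For $x\in M$, $\mathrm{diag}(x)$ is the $n_k\times n_k$ diagonal matrix in $\mathbb M_{n_k}(M)$ with all diagonal entries $x$. $\mathrm{Ad}(w^* )(u_g)=w^*u_gw$. *)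

theory Defs
  imports "HOL-Analysis.Analysis" "Jordan_Normal_Form.Matrix"
begin

section \<open>Complex Hilbert spaces\<close>

class complex_vector = real_vector +
  fixes scaleC :: "complex \<Rightarrow> 'a \<Rightarrow> 'a" (infixr "*\<^sub>C" 75)
  assumes scaleC_add_right: "a *\<^sub>C (x + y) = a *\<^sub>C x + a *\<^sub>C y"
    and scaleC_add_left: "(a + b) *\<^sub>C x = a *\<^sub>C x + b *\<^sub>C x"
    and scaleC_scaleC: "a *\<^sub>C b *\<^sub>C x = (a * b) *\<^sub>C x"
    and scaleC_of_real: "complex_of_real r *\<^sub>C x = r *\<^sub>R x"

lemma scaleC_one [simp]: "1 *\<^sub>C (x :: 'a :: complex_vector) = x"
  using scaleC_of_real [of 1 x] by simp

global_interpretation complex_vector: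
  vector_space "scaleC :: complex \<Rightarrow> 'a \<Rightarrow> 'a :: complex_vector"
  defines csubspace = complex_vector.subspace
    and cspan = complex_vector.span
    and cdim = complex_vector.dim
  by unfold_locales
    (simp_all add: scaleC_add_right scaleC_add_left scaleC_scaleC)

definition finite_cdim :: "'a::complex_vector set \<Rightarrow> bool" where
  "finite_cdim V \<longleftrightarrow> (\<exists>B. finite B \<and> V \<subseteq> cspan B)"

text \<open>The complex inner product is linear in the first variable.  Its real part is
  the real inner product that induces the norm and the topology.\<close>

class complex_hilbert = complex_vector + real_inner + complete_space +
  fixes cinner :: "'a \<Rightarrow> 'a \<Rightarrow> complex"
  assumes cinner_commute: "cinner x y = cnj (cinner y x)"
    and cinner_add_left: "cinner (x + y) z = cinner x z + cinner y z"
    and cinner_scaleC_left: "cinner (a *\<^sub>C x) y = a * cinner x y"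
    and Re_cinner: "Re (cinner x y) = inner x y"

lemma cinner_self: "cinner x x = complex_of_real ((norm (x :: 'a :: complex_hilbert))\<^sup>2)"
proof -
  have "Im (cinner x x) = 0"
    using arg_cong [OF cinner_commute [of x x], of Im] by simp
  then show ?thesis
    by (simp add: complex_eq_iff Re_cinner power2_norm_eq_inner)
qed

lemma norm_scaleC: "norm (a *\<^sub>C x) = cmod a * norm (x :: 'a :: complex_hilbert)"
proof -
  have "cinner (a *\<^sub>C x) (a *\<^sub>C x) = a * cnj a * cinner x x"
    using cinner_commute [of x "a *\<^sub>C x"] cinner_commute [of x x]
    by (simp add: cinner_scaleC_left mult.assoc)
  then have "complex_of_real ((norm (a *\<^sub>C x))\<^sup>2) = complex_of_real ((cmod a * norm x)\<^sup>2)"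
    unfolding cinner_self power_mult_distrib of_real_mult complex_norm_square .
  then have "(norm (a *\<^sub>C x))\<^sup>2 = (cmod a * norm x)\<^sup>2"
    using of_real_eq_iff by blast
  then show ?thesis
    by (simp add: power2_eq_iff_nonneg)
qed

lemma cinner_decomp:
  "cinner x y = Complex (inner x y) (inner ((- \<i>) *\<^sub>C x) (y :: 'a :: complex_hilbert))"
  unfolding Re_cinner [symmetric] cinner_scaleC_left by (simp add: complex_eq_iff)


section \<open>Bounded operators\<close>

typedef (overloaded) 'a bop =
    "{f :: 'a :: complex_hilbert \<Rightarrow> 'a. bounded_linear f \<and> (\<forall>c x. f (c *\<^sub>C x) = c *\<^sub>C f x)}"
  morphisms bop_apply Bop
  by (rule exI [of _ "\<lambda>_. 0"]) simp

setup_lifting type_definition_bop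

lemma bop_eqI: "(\<And>v. bop_apply x v = bop_apply y v) \<Longrightarrow> x = y"
  by transfer auto

instantiation bop :: (complex_hilbert) "{complex_vector, ring, monoid_mult}"
begin

lift_definition zero_bop :: "'a bop" is "\<lambda>_. 0" by simp
lift_definition plus_bop :: "'a bop \<Rightarrow> 'a bop \<Rightarrow> 'a bop" is "\<lambda>f g v. f v + g v"
  by (simp add: bounded_linear_add scaleC_add_right)
lift_definition minus_bop :: "'a bop \<Rightarrow> 'a bop \<Rightarrow> 'a bop" is "\<lambda>f g v. f v - g v"
  by (simp add: bounded_linear_sub complex_vector.scale_right_diff_distrib)
lift_definition uminus_bop :: "'a bop \<Rightarrow> 'a bop" is "\<lambda>f v. - f v"
  by (simp add: bounded_linear_minus)
lift_definition scaleR_bop :: "real \<Rightarrow> 'a bop \<Rightarrow> 'a bop" is "\<lambda>r f v. r *\<^sub>R f v"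
  proof -
  fix r :: real and f :: "'a \<Rightarrow> 'a"
  assume f: "bounded_linear f \<and> (\<forall>c x. f (c *\<^sub>C x) = c *\<^sub>C f x)"
  then have "r *\<^sub>R f (c *\<^sub>C x) = c *\<^sub>C r *\<^sub>R f x" for c x
    unfolding scaleC_of_real [symmetric] by (simp add: scaleC_scaleC mult.commute)
  then show "bounded_linear (\<lambda>v. r *\<^sub>R f v) \<and>
      (\<forall>c x. r *\<^sub>R f (c *\<^sub>C x) = c *\<^sub>C r *\<^sub>R f x)"
    using f by (simp add: bounded_linear_const_scaleR)
qed
lift_definition scaleC_bop :: "complex \<Rightarrow> 'a bop \<Rightarrow> 'a bop" is "\<lambda>c f v. c *\<^sub>C f v"
proof -
  fix c :: complex and f :: "'a \<Rightarrow> 'a"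
  assume f: "bounded_linear f \<and> (\<forall>c x. f (c *\<^sub>C x) = c *\<^sub>C f x)"
  have "bounded_linear (\<lambda>v :: 'a. c *\<^sub>C v)"
    by (rule bounded_linear_intro [of _ "cmod c"])
      (simp_all add: scaleC_add_right norm_scaleC mult.commute scaleC_scaleC
        flip: scaleC_of_real)
  then show "bounded_linear (\<lambda>v. c *\<^sub>C f v) \<and> (\<forall>d x. c *\<^sub>C f (d *\<^sub>C x) = d *\<^sub>C c *\<^sub>C f x)"
    using f by (auto intro: bounded_linear_compose simp: scaleC_scaleC mult.commute)
qed
lift_definition one_bop :: "'a bop" is "\<lambda>v. v" by simp
lift_definition times_bop :: "'a bop \<Rightarrow> 'a bop \<Rightarrow> 'a bop" is "\<lambda>f g v. f (g v)"
  by (auto intro: bounded_linear_compose)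

instance
  by standard
    (transfer; force simp: fun_eq_iff algebra_simps scaleC_add_right scaleC_add_left
      scaleC_scaleC scaleC_of_real linear_simps scaleR_add_right scaleR_add_left)+

end

instantiation bop :: (complex_hilbert) real_normed_algebra
begin

lift_definition norm_bop :: "'a bop \<Rightarrow> real" is onorm .
definition dist_bop :: "'a bop \<Rightarrow> 'a bop \<Rightarrow> real" where
  "dist_bop x y = norm (x - y)"
definition sgn_bop :: "'a bop \<Rightarrow> 'a bop" where
  "sgn_bop x = x /\<^sub>R norm x"
definition uniformity_bop :: "('a bop \<times> 'a bop) filter" where
  "uniformity_bop = (INF e\<in>{0 <..}. principal {(x, y). dist x y < e})"
definition open_bop :: "'a bop set \<Rightarrow> bool" where
  "open_bop U \<longleftrightarrow> (\<forall>x\<in>U. eventually (\<lambda>(x', y). x' = x \<longrightarrow> y \<in> U) uniformity)"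

instance
proof
  fix x y :: "'a bop" and r :: real and U :: "'a bop set"
  show "dist x y = norm (x - y)" by (rule dist_bop_def)
  show "sgn x = x /\<^sub>R norm x" by (rule sgn_bop_def)
  show "(uniformity :: ('a bop \<times> 'a bop) filter) = (INF e\<in>{0 <..}. principal {(x, y). dist x y < e})"
    by (rule uniformity_bop_def)
  show "open U \<longleftrightarrow> (\<forall>x\<in>U. \<forall>\<^sub>F (x', y) in uniformity. x' = x \<longrightarrow> y \<in> U)"
    by (rule open_bop_def)
  show "norm x = 0 \<longleftrightarrow> x = 0" by transfer (auto simp: onorm_eq_0)
  show "norm (x + y) \<le> norm x + norm y" by transfer (auto intro: onorm_triangle)
  show "norm (r *\<^sub>R x) = \<bar>r\<bar> * norm x" by transfer (auto simp: onorm_scaleR)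
  show "r *\<^sub>R x * y = r *\<^sub>R (x * y)" by transfer simp
  show "x * r *\<^sub>R y = r *\<^sub>R (x * y)" by transfer (auto simp: linear_simps)
  show "norm (x * y) \<le> norm x * norm y"
    by transfer (auto dest: onorm_compose simp: o_def)
qed

end

definition adj :: "'a::complex_hilbert bop \<Rightarrow> 'a bop" where
  "adj x = (THE y. \<forall>v w. cinner (bop_apply y v) w = cinner v (bop_apply x w))"


section \<open>Von Neumann algebras, normal functionals, traces\<close>

definition commutant :: "'a::complex_hilbert bop set \<Rightarrow> 'a bop set" where
  "commutant S = {y. \<forall>x\<in>S. x * y = y * x}"

definition von_neumann_algebra :: "'a::complex_hilbert bop set \<Rightarrow> bool" where
  "von_neumann_algebra N \<longleftrightarrow> (\<forall>x\<in>N. adj x \<in> N) \<and> commutant (commutant N) = N"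

text \<open>The elements of the predual \<open>N\<^sub>*\<close>, i.e. the ultraweakly continuous linear functionals
  on \<open>N\<close>.  Only the values on \<open>N\<close> are relevant.\<close>

definition normal_functional :: "'a::complex_hilbert bop set \<Rightarrow> ('a bop \<Rightarrow> complex) \<Rightarrow> bool" where
  "normal_functional N \<phi> \<longleftrightarrow>
    (\<exists>v w. summable (\<lambda>i::nat. (norm (v i))\<^sup>2) \<and> summable (\<lambda>i. (norm (w i))\<^sup>2) \<and>
      (\<forall>x\<in>N. (\<lambda>i. cinner (bop_apply x (v i)) (w i)) sums \<phi> x))"

text \<open>Separability of the predual in the norm of the dual space: the last condition
  says \<open>\<parallel>\<phi> - \<psi>\<parallel> \<le> e\<close>.\<close>

definition separable_predual :: "'a::complex_hilbert bop set \<Rightarrow> bool" where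
  "separable_predual N \<longleftrightarrow>
    (\<exists>D. countable D \<and> (\<forall>\<psi>\<in>D. normal_functional N \<psi>) \<and>
      (\<forall>\<phi>. normal_functional N \<phi> \<longrightarrow>
        (\<forall>e>0. \<exists>\<psi>\<in>D. \<forall>x\<in>N. cmod (\<phi> x - \<psi> x) \<le> e * norm x)))"

definition faithful_normal_tracial_state ::
    "'a::complex_hilbert bop set \<Rightarrow> ('a bop \<Rightarrow> complex) \<Rightarrow> bool" where
  "faithful_normal_tracial_state N \<tau> \<longleftrightarrow>
    (\<forall>x\<in>N. \<forall>y\<in>N. \<tau> (x + y) = \<tau> x + \<tau> y) \<and>
    (\<forall>x\<in>N. \<forall>c. \<tau> (c *\<^sub>C x) = c * \<tau> x) \<and>
    \<tau> 1 = 1 \<and>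
    (\<forall>x\<in>N. \<tau> (adj x * x) \<in> \<real> \<and> Re (\<tau> (adj x * x)) \<ge> 0) \<and>
    (\<forall>x\<in>N. \<tau> (adj x * x) = 0 \<longrightarrow> x = 0) \<and>
    normal_functional N \<tau> \<and>
    (\<forall>x\<in>N. \<forall>y\<in>N. \<tau> (x * y) = \<tau> (y * x))"

definition tracial_von_neumann_algebra ::
    "'a::complex_hilbert bop set \<Rightarrow> ('a bop \<Rightarrow> complex) \<Rightarrow> bool" where
  "tracial_von_neumann_algebra N \<tau> \<longleftrightarrow>
    von_neumann_algebra N \<and> faithful_normal_tracial_state N \<tau>"

definition trace_inner :: "('a::complex_hilbert bop \<Rightarrow> complex) \<Rightarrow> 'a bop \<Rightarrow> 'a bop \<Rightarrow> complex" where
  "trace_inner \<tau> x y = \<tau> (adj y * x)"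

definition norm2 :: "('a::complex_hilbert bop \<Rightarrow> complex) \<Rightarrow> 'a bop \<Rightarrow> real" where
  "norm2 \<tau> x = sqrt (Re (\<tau> (adj x * x)))"

text \<open>The topology of the metric space \<open>(N, \<parallel>x - y\<parallel>\<^sub>2)\<close>.  Locale \<^locale>\<open>Metric_space\<close>
  requires a symmetric nonnegative distance also outside the carrier, where \<open>\<tau>\<close> is arbitrary;
  hence the value \<open>0\<close> there.\<close>

definition norm2_topology ::
    "'a::complex_hilbert bop set \<Rightarrow> ('a bop \<Rightarrow> complex) \<Rightarrow> 'a bop topology" where
  "norm2_topology N \<tau> =
    Metric_space.mtopology N (\<lambda>x y. if x \<in> N \<and> y \<in> N then norm2 \<tau> (x - y) else 0)"

definition unitaries :: "'a::complex_hilbert bop set \<Rightarrow> 'a bop set" where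
  "unitaries P = {u\<in>P. adj u * u = 1 \<and> u * adj u = 1}"

definition normalizer :: "'a::complex_hilbert bop set \<Rightarrow> 'a bop set \<Rightarrow> 'a bop set" where
  "normalizer B P = {u \<in> unitaries P. (\<lambda>b. u * b * adj u) ` B = B}"

definition orthonormal_basis_of ::
    "('a::complex_hilbert bop \<Rightarrow> complex) \<Rightarrow> 'a bop set \<Rightarrow> nat \<Rightarrow> (nat \<Rightarrow> 'a bop) \<Rightarrow> bool" where
  "orthonormal_basis_of \<tau> V n \<xi> \<longleftrightarrow>
    (\<forall>i<n. \<forall>j<n. trace_inner \<tau> (\<xi> i) (\<xi> j) = (if i = j then 1 else 0)) \<and>
    cspan (\<xi> ` {..<n}) = V"


section \<open>Groups and trace-preserving actions\<close>

text \<open>Class \<open>group_add\<close> is the class of all, not necessarily commutative, groups; the group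
  law is written additively: \<open>g + h\<close> is \<open>gh\<close>, \<open>- g\<close> is \<open>g\<^sup>-\<^sup>1\<close> and \<open>0\<close> is \<open>e\<close>.\<close>

definition icc :: "'g::group_add itself \<Rightarrow> bool" where
  "icc _ \<longleftrightarrow> (\<forall>g::'g. g \<noteq> 0 \<longrightarrow> infinite {h + g - h | h. True})"

definition star_automorphism :: "'a::complex_hilbert bop set \<Rightarrow> ('a bop \<Rightarrow> 'a bop) \<Rightarrow> bool" where
  "star_automorphism N \<theta> \<longleftrightarrow> bij_betw \<theta> N N \<and>
    (\<forall>x\<in>N. \<forall>y\<in>N. \<theta> (x + y) = \<theta> x + \<theta> y \<and> \<theta> (x * y) = \<theta> x * \<theta> y) \<and>
    (\<forall>x\<in>N. \<forall>c. \<theta> (c *\<^sub>C x) = c *\<^sub>C \<theta> x) \<and>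
    (\<forall>x\<in>N. \<theta> (adj x) = adj (\<theta> x))"

definition trace_preserving_action ::
    "'a::complex_hilbert bop set \<Rightarrow> ('a bop \<Rightarrow> complex) \<Rightarrow> ('g::group_add \<Rightarrow> 'a bop \<Rightarrow> 'a bop) \<Rightarrow> bool"
  where
  "trace_preserving_action N \<tau> \<alpha> \<longleftrightarrow>
    (\<forall>g. star_automorphism N (\<alpha> g)) \<and>
    (\<forall>g h. \<forall>x\<in>N. \<alpha> (g + h) x = \<alpha> g (\<alpha> h x)) \<and>
    (\<forall>g. \<forall>x\<in>N. \<tau> (\<alpha> g x) = \<tau> x)"

definition ergodic_action ::
    "'a::complex_hilbert bop set \<Rightarrow> ('g::group_add \<Rightarrow> 'a bop \<Rightarrow> 'a bop) \<Rightarrow> bool" where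
  "ergodic_action N \<alpha> \<longleftrightarrow> (\<forall>x\<in>N. (\<forall>g. \<alpha> g x = x) \<longrightarrow> (\<exists>c. x = c *\<^sub>C 1))"

definition compact_action ::
    "'a::complex_hilbert bop set \<Rightarrow> ('a bop \<Rightarrow> complex) \<Rightarrow> ('g::group_add \<Rightarrow> 'a bop \<Rightarrow> 'a bop) \<Rightarrow> bool"
  where
  "compact_action N \<tau> \<alpha> \<longleftrightarrow>
    (\<forall>x\<in>N. compactin (norm2_topology N \<tau>) (norm2_topology N \<tau> closure_of range (\<lambda>g. \<alpha> g x)))"


section \<open>The Hilbert space \<open>\<ell>\<^sup>2(G, H)\<close>\<close>

typedef (overloaded) ('g, 'a) ell2 =
    "{f :: 'g \<Rightarrow> 'a :: complex_hilbert. (\<lambda>h. (norm (f h))\<^sup>2) summable_on UNIV}"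
  morphisms ell2_apply Ell2
  by (rule exI [of _ "\<lambda>_. 0"]) simp

setup_lifting type_definition_ell2

lemma ell2_eqI: "(\<And>h. ell2_apply f h = ell2_apply g h) \<Longrightarrow> f = g"
  by transfer auto

lemma ell2_summable: "(\<lambda>h. (norm (ell2_apply f h))\<^sup>2) summable_on UNIV"
  using ell2_apply by blast

lemma square_summable_add:
  fixes f g :: "'g \<Rightarrow> 'a :: real_inner"
  assumes "(\<lambda>h. (norm (f h))\<^sup>2) summable_on UNIV" "(\<lambda>h. (norm (g h))\<^sup>2) summable_on UNIV"
  shows "(\<lambda>h. (norm (f h + g h))\<^sup>2) summable_on UNIV"
proof (rule summable_on_comparison_test)
  show "(\<lambda>h. 2 * (norm (f h))\<^sup>2 + 2 * (norm (g h))\<^sup>2) summable_on UNIV"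
    by (intro summable_on_add summable_on_cmult_right assms)
  fix h
  have "(norm (f h + g h))\<^sup>2 \<le> (norm (f h) + norm (g h))\<^sup>2"
    by (intro power_mono norm_triangle_ineq norm_ge_zero)
  also have "\<dots> \<le> 2 * (norm (f h))\<^sup>2 + 2 * (norm (g h))\<^sup>2"
    using zero_le_power2 [of "norm (f h) - norm (g h)"] by (simp add: power2_eq_square algebra_simps)
  finally show "(norm (f h + g h))\<^sup>2 \<le> 2 * (norm (f h))\<^sup>2 + 2 * (norm (g h))\<^sup>2" .
qed simp_all

lemma square_summable_bound:
  assumes "(\<lambda>h. (norm (f h :: 'b :: real_normed_vector))\<^sup>2) summable_on A"
    and "\<And>h. norm (g h :: 'c :: real_normed_vector) \<le> C * norm (f h)"
  shows "(\<lambda>h. (norm (g h))\<^sup>2) summable_on A"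
proof (rule summable_on_comparison_test)
  show "(\<lambda>h. C\<^sup>2 * (norm (f h))\<^sup>2) summable_on A"
    by (intro summable_on_cmult_right assms)
  fix h
  show "(norm (g h))\<^sup>2 \<le> C\<^sup>2 * (norm (f h))\<^sup>2"
    using power_mono [OF assms(2) norm_ge_zero, of h 2] by (simp add: power_mult_distrib)
qed simp_all

lemma inner_summable:
  fixes f g :: "'g \<Rightarrow> 'a :: real_inner"
  assumes "(\<lambda>h. (norm (f h))\<^sup>2) summable_on UNIV" "(\<lambda>h. (norm (g h))\<^sup>2) summable_on UNIV"
  shows "(\<lambda>h. inner (f h) (g h)) summable_on UNIV"
proof -
  have "(\<lambda>h. norm (inner (f h) (g h))) summable_on UNIV"
  proof (rule summable_on_comparison_test)
    show "(\<lambda>h. (norm (f h))\<^sup>2 + (norm (g h))\<^sup>2) summable_on UNIV"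
      by (intro summable_on_add assms)
    fix h
    have "norm (inner (f h) (g h)) \<le> norm (f h) * norm (g h)"
      by (simp add: Cauchy_Schwarz_ineq2)
    also have "\<dots> \<le> (norm (f h))\<^sup>2 + (norm (g h))\<^sup>2"
      using zero_le_power2 [of "norm (f h) - norm (g h)"] mult_nonneg_nonneg [OF norm_ge_zero [of "f h"] norm_ge_zero [of "g h"]]
      unfolding power2_diff by linarith
    finally show "norm (inner (f h) (g h)) \<le> (norm (f h))\<^sup>2 + (norm (g h))\<^sup>2" .
  qed simp_all
  then show ?thesis by (rule abs_summable_summable)
qed

instantiation ell2 :: (type, complex_hilbert) complex_vector
begin

lift_definition zero_ell2 :: "('a, 'b) ell2" is "\<lambda>_. 0" by simp
lift_definition plus_ell2 :: "('a, 'b) ell2 \<Rightarrow> ('a, 'b) ell2 \<Rightarrow> ('a, 'b) ell2"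
  is "\<lambda>f g h. f h + g h" by (rule square_summable_add)
lift_definition uminus_ell2 :: "('a, 'b) ell2 \<Rightarrow> ('a, 'b) ell2" is "\<lambda>f h. - f h" by simp
lift_definition minus_ell2 :: "('a, 'b) ell2 \<Rightarrow> ('a, 'b) ell2 \<Rightarrow> ('a, 'b) ell2"
  is "\<lambda>f g h. f h - g h"
  subgoal for f g using square_summable_add [of f "\<lambda>h. - g h"] by simp
  done
lift_definition scaleR_ell2 :: "real \<Rightarrow> ('a, 'b) ell2 \<Rightarrow> ('a, 'b) ell2" is "\<lambda>r f h. r *\<^sub>R f h"
  subgoal for r f by (rule square_summable_bound [of f _ _ "\<bar>r\<bar>"]) simp_all
  done
lift_definition scaleC_ell2 :: "complex \<Rightarrow> ('a, 'b) ell2 \<Rightarrow> ('a, 'b) ell2" is "\<lambda>c f h. c *\<^sub>C f h"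
  subgoal for c f by (rule square_summable_bound [of f _ _ "cmod c"]) (simp_all add: norm_scaleC)
  done

instance
  by standard
    (transfer; simp add: fun_eq_iff algebra_simps scaleC_add_right scaleC_add_left
      scaleC_scaleC scaleC_of_real)+

end

instantiation ell2 :: (type, complex_hilbert) real_inner
begin

lift_definition inner_ell2 :: "('a, 'b) ell2 \<Rightarrow> ('a, 'b) ell2 \<Rightarrow> real"
  is "\<lambda>f g. \<Sum>\<^sub>\<infinity>h. inner (f h) (g h)" .
definition norm_ell2 :: "('a, 'b) ell2 \<Rightarrow> real" where
  "norm_ell2 f = sqrt (inner f f)"
definition dist_ell2 :: "('a, 'b) ell2 \<Rightarrow> ('a, 'b) ell2 \<Rightarrow> real" where
  "dist_ell2 x y = norm (x - y)"
definition sgn_ell2 :: "('a, 'b) ell2 \<Rightarrow> ('a, 'b) ell2" where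
  "sgn_ell2 x = x /\<^sub>R norm x"
definition uniformity_ell2 :: "(('a, 'b) ell2 \<times> ('a, 'b) ell2) filter" where
  "uniformity_ell2 = (INF e\<in>{0 <..}. principal {(x, y). dist x y < e})"
definition open_ell2 :: "('a, 'b) ell2 set \<Rightarrow> bool" where
  "open_ell2 U \<longleftrightarrow> (\<forall>x\<in>U. eventually (\<lambda>(x', y). x' = x \<longrightarrow> y \<in> U) uniformity)"

instance
proof
  fix x y z :: "('a, 'b) ell2" and r :: real and U :: "('a, 'b) ell2 set"
  show "dist x y = norm (x - y)" by (rule dist_ell2_def)
  show "sgn x = x /\<^sub>R norm x" by (rule sgn_ell2_def)
  show "(uniformity :: (('a, 'b) ell2 \<times> ('a, 'b) ell2) filter) =
      (INF e\<in>{0 <..}. principal {(x, y). dist x y < e})"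
    by (rule uniformity_ell2_def)
  show "open U \<longleftrightarrow> (\<forall>x\<in>U. \<forall>\<^sub>F (x', y) in uniformity. x' = x \<longrightarrow> y \<in> U)"
    by (rule open_ell2_def)
  show "norm x = sqrt (inner x x)" by (rule norm_ell2_def)
  show "inner x y = inner y x" by transfer (simp add: inner_commute)
  show "inner (x + y) z = inner x z + inner y z"
    by transfer (simp add: inner_add_left infsum_add inner_summable)
  show "inner (r *\<^sub>R x) y = r * inner x y"
    by transfer (simp add: infsum_cmult_right inner_summable)
  show "0 \<le> inner x x" by transfer (simp add: infsum_nonneg)
  show "inner x x = 0 \<longleftrightarrow> x = 0"
  proof transfer
    fix f :: "'a \<Rightarrow> 'b"
    assume f: "(\<lambda>h. (norm (f h))\<^sup>2) summable_on UNIV"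
    have "f h = 0" if "(\<Sum>\<^sub>\<infinity>h. inner (f h) (f h)) = 0" for h
      using nonneg_infsum_le_0D [of "\<lambda>h. inner (f h) (f h)" UNIV h] that inner_summable [OF f f]
      by simp
    then have "f = (\<lambda>_. 0)" if "(\<Sum>\<^sub>\<infinity>h. inner (f h) (f h)) = 0"
      using that by (intro ext)
    then show "(\<Sum>\<^sub>\<infinity>h. inner (f h) (f h)) = 0 \<longleftrightarrow> f = (\<lambda>_. 0)"
      by (intro iffI) (simp_all only: inner_zero_left infsum_0_simp)
  qed
qed

end

lemma norm_ell2_power2: "(norm f)\<^sup>2 = (\<Sum>\<^sub>\<infinity>h. (norm (ell2_apply f h))\<^sup>2)"
  by (simp add: power2_norm_eq_inner inner_ell2.rep_eq)

lemma norm_ell2_finite_sum: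
  "finite A \<Longrightarrow> (\<Sum>h\<in>A. (norm (ell2_apply f h))\<^sup>2) \<le> (norm f)\<^sup>2"
  unfolding norm_ell2_power2
  by (rule finite_sum_le_infsum) (simp_all add: ell2_summable)

lemma norm_ell2_apply_le: "norm (ell2_apply f h) \<le> norm f"
  using norm_ell2_finite_sum [of "{h}" f] by (simp add: power2_le_iff_abs_le)

instance ell2 :: (type, complex_hilbert) complete_space
proof
  fix X :: "nat \<Rightarrow> ('a, 'b) ell2"
  assume X: "Cauchy X"
  have "Cauchy (\<lambda>n. ell2_apply (X n) h)" for h
  proof (rule metric_CauchyI)
    fix e :: real assume "0 < e"
    then obtain M where M: "\<And>m n. m \<ge> M \<Longrightarrow> n \<ge> M \<Longrightarrow> dist (X m) (X n) < e"
      using metric_CauchyD [OF X] by blast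
    have "dist (ell2_apply (X m) h) (ell2_apply (X n) h) < e" if "m \<ge> M" "n \<ge> M" for m n
      using norm_ell2_apply_le [of "X m - X n" h] M [OF that]
      by (simp add: dist_norm minus_ell2.rep_eq)
    then show "\<exists>M. \<forall>m\<ge>M. \<forall>n\<ge>M. dist (ell2_apply (X m) h) (ell2_apply (X n) h) < e" by blast
  qed
  then have "\<forall>h. \<exists>l. (\<lambda>n. ell2_apply (X n) h) \<longlonglongrightarrow> l"
    by (simp add: Cauchy_convergent_iff convergent_def)
  from choice [OF this] obtain f where f: "\<And>h. (\<lambda>n. ell2_apply (X n) h) \<longlonglongrightarrow> f h"
    by blast
  have fin: "\<exists>M. \<forall>n\<ge>M. \<forall>A. finite A \<longrightarrow> (\<Sum>h\<in>A. (norm (ell2_apply (X n) h - f h))\<^sup>2) \<le> e\<^sup>2"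
    if e: "0 < e" for e
  proof -
    obtain M where M: "\<And>m n. m \<ge> M \<Longrightarrow> n \<ge> M \<Longrightarrow> dist (X m) (X n) < e"
      using metric_CauchyD [OF X e] by blast
    have "(\<Sum>h\<in>A. (norm (ell2_apply (X n) h - f h))\<^sup>2) \<le> e\<^sup>2" if n: "n \<ge> M" and A: "finite A" for n A
    proof (rule tendsto_upperbound)
      show "(\<lambda>m. \<Sum>h\<in>A. (norm (ell2_apply (X n) h - ell2_apply (X m) h))\<^sup>2)
          \<longlonglongrightarrow> (\<Sum>h\<in>A. (norm (ell2_apply (X n) h - f h))\<^sup>2)"
        by (intro tendsto_intros f)
      have "(\<Sum>h\<in>A. (norm (ell2_apply (X n) h - ell2_apply (X m) h))\<^sup>2) \<le> e\<^sup>2" if "m \<ge> M" for m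
      proof -
        have "(\<Sum>h\<in>A. (norm (ell2_apply (X n) h - ell2_apply (X m) h))\<^sup>2) \<le> (norm (X n - X m))\<^sup>2"
          using norm_ell2_finite_sum [OF A, of "X n - X m"] by (simp add: minus_ell2.rep_eq)
        also have "\<dots> \<le> e\<^sup>2"
          using M [OF n that] by (intro power_mono) (simp_all add: dist_norm)
        finally show ?thesis .
      qed
      then show "\<forall>\<^sub>F m in sequentially.
          (\<Sum>h\<in>A. (norm (ell2_apply (X n) h - ell2_apply (X m) h))\<^sup>2) \<le> e\<^sup>2"
        unfolding eventually_sequentially by (intro exI [of _ M] allI impI)
    qed simp
    then show ?thesis by blast
  qed
  have "(0 :: real) < 1" by simp
  from fin [OF this] obtain M where M: "\<And>A. finite A \<Longrightarrow> (\<Sum>h\<in>A. (norm (ell2_apply (X M) h - f h))\<^sup>2) \<le> 1\<^sup>2"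
    by blast
  have "(\<lambda>h. (norm (ell2_apply (X M) h - f h))\<^sup>2) summable_on UNIV"
  proof (rule nonneg_bdd_above_summable_on)
    show "bdd_above (sum (\<lambda>h. (norm (ell2_apply (X M) h - f h))\<^sup>2) ` {F. F \<subseteq> UNIV \<and> finite F})"
      by (rule bdd_aboveI2 [of _ _ "1\<^sup>2"]) (use M in blast)
  qed simp
  then have "(\<lambda>h. (norm (f h - ell2_apply (X M) h))\<^sup>2) summable_on UNIV"
    by (subst norm_minus_commute)
  from square_summable_add [OF ell2_summable [of "X M"] this]
  have "(\<lambda>h. (norm (f h))\<^sup>2) summable_on UNIV"
    by simp
  then have F: "ell2_apply (Ell2 f) = f"
    by (simp add: Ell2_inverse)
  have "X \<longlonglongrightarrow> Ell2 f"
  proof (rule metric_LIMSEQ_I)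
    fix r :: real assume "0 < r"
    then obtain M where
      M: "\<And>n A. n \<ge> M \<Longrightarrow> finite A \<Longrightarrow> (\<Sum>h\<in>A. (norm (ell2_apply (X n) h - f h))\<^sup>2) \<le> (r / 2)\<^sup>2"
      using fin [OF half_gt_zero [OF \<open>0 < r\<close>]] by blast
    have "dist (X n) (Ell2 f) < r" if "n \<ge> M" for n
    proof -
      have "(norm (X n - Ell2 f))\<^sup>2 \<le> (r / 2)\<^sup>2"
        unfolding norm_ell2_power2
        by (rule infsum_le_finite_sums [OF ell2_summable])
          (use M [OF that] in \<open>simp add: minus_ell2.rep_eq F\<close>)
      then have "norm (X n - Ell2 f) \<le> r / 2"
        by (rule power2_le_imp_le) (use \<open>0 < r\<close> in simp)
      then show ?thesis using \<open>0 < r\<close> by (simp add: dist_norm)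
    qed
    then show "\<exists>M. \<forall>n\<ge>M. dist (X n) (Ell2 f) < r" by blast
  qed
  then show "convergent X" by (auto simp: convergent_def)
qed

instantiation ell2 :: (type, complex_hilbert) complex_hilbert
begin

lift_definition cinner_ell2 :: "('a, 'b) ell2 \<Rightarrow> ('a, 'b) ell2 \<Rightarrow> complex"
  is "\<lambda>f g. \<Sum>\<^sub>\<infinity>h. cinner (f h) (g h)" .

lemma cinner_summable:
  fixes f g :: "'a \<Rightarrow> 'b"
  assumes f: "(\<lambda>h. (norm (f h))\<^sup>2) summable_on UNIV" and g: "(\<lambda>h. (norm (g h))\<^sup>2) summable_on UNIV"
  shows "(\<lambda>h. cinner (f h) (g h)) summable_on UNIV"
proof -
  have "(\<lambda>h. (norm ((- \<i>) *\<^sub>C f h))\<^sup>2) summable_on UNIV"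
    by (simp only: norm_scaleC) (simp add: f)
  then have "(\<lambda>h. complex_of_real (inner (f h) (g h)) +
      \<i> * complex_of_real (inner ((- \<i>) *\<^sub>C f h) (g h))) summable_on UNIV"
    by (intro summable_on_add summable_on_cmult_right summable_on_of_real inner_summable f g)
  then show ?thesis by (simp add: cinner_decomp Complex_eq)
qed

instance
proof
  fix x y z :: "('a, 'b) ell2" and a :: complex
  show "cinner x y = cnj (cinner y x)"
    by transfer (simp flip: infsum_cnj cinner_commute)
  show "cinner (x + y) z = cinner x z + cinner y z"
    by transfer (simp add: cinner_add_left infsum_add cinner_summable)
  show "cinner (a *\<^sub>C x) y = a * cinner x y"
    by transfer (simp add: cinner_scaleC_left infsum_cmult_right cinner_summable)
  show "Re (cinner x y) = inner x y"
    by transfer (simp add: cinner_summable Re_cinner flip: infsum_Re)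
qed

end


section \<open>The crossed product\<close>

text \<open>\<open>N \<rtimes>\<^sub>\<alpha> G\<close> acts on \<open>\<ell>\<^sup>2(G, H)\<close> and is generated by the copy of \<open>N\<close> given by
  \<open>(\<pi>(x) \<zeta>)(h) = \<alpha>\<^sub>h\<^sub>-\<^sub>1(x) \<zeta>(h)\<close> and by the unitaries \<open>(u\<^sub>g \<zeta>)(h) = \<zeta>(g\<^sup>-\<^sup>1 h)\<close>.\<close>

definition cp_embed ::
    "('g::group_add \<Rightarrow> 'a::complex_hilbert bop \<Rightarrow> 'a bop) \<Rightarrow> 'a bop \<Rightarrow> ('g, 'a) ell2 bop" where
  "cp_embed \<alpha> x =
    (THE T. \<forall>\<zeta> h. ell2_apply (bop_apply T \<zeta>) h = bop_apply (\<alpha> (- h) x) (ell2_apply \<zeta> h))"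


text \<open>The operator above exists as soon as the orbit of \<open>x\<close> is norm bounded, hence for every
  \<open>x \<in> N\<close>, automorphisms of \<open>N\<close> being isometric.\<close>

lemma cp_embed_apply:
  assumes "\<And>h. norm (\<alpha> h x) \<le> C"
  shows "ell2_apply (bop_apply (cp_embed \<alpha> x) \<zeta>) h = bop_apply (\<alpha> (- h) x) (ell2_apply \<zeta> h)"
proof -
  have bl: "bounded_linear (bop_apply y)" for y :: "'b bop"
    using bop_apply [of y] by simp
  have le: "norm (bop_apply (\<alpha> (- h) x) v) \<le> C * norm v" for h v
    using onorm [OF bl, of "\<alpha> (- h) x" v] mult_right_mono [OF assms norm_ge_zero, of "- h" v]
    by (simp add: norm_bop.rep_eq)
  define T where "T \<zeta> = Ell2 (\<lambda>h. bop_apply (\<alpha> (- h) x) (ell2_apply \<zeta> h))" for \<zeta>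
  have sm: "(\<lambda>h. (norm (bop_apply (\<alpha> (- h) x) (ell2_apply \<zeta> h)))\<^sup>2) summable_on UNIV" for \<zeta>
    by (rule square_summable_bound [OF ell2_summable le])
  have T: "ell2_apply (T \<zeta>) h = bop_apply (\<alpha> (- h) x) (ell2_apply \<zeta> h)" for \<zeta> h
    unfolding T_def using sm by (subst Ell2_inverse) simp_all
  have C: "0 \<le> C" using norm_ge_zero assms order_trans by blast
  have "bounded_linear T"
  proof (rule bounded_linear_intro [of _ C])
    show "T (\<zeta> + \<eta>) = T \<zeta> + T \<eta>" for \<zeta> \<eta>
      by (rule ell2_eqI) (simp add: T plus_ell2.rep_eq linear_simps [OF bl])
    show "T (r *\<^sub>R \<zeta>) = r *\<^sub>R T \<zeta>" for r \<zeta>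
      by (rule ell2_eqI) (simp add: T scaleR_ell2.rep_eq linear_simps [OF bl])
    fix \<zeta>
    have "(norm (T \<zeta>))\<^sup>2 \<le> (\<Sum>\<^sub>\<infinity>h. C\<^sup>2 * (norm (ell2_apply \<zeta> h))\<^sup>2)"
      unfolding norm_ell2_power2 T
    proof (rule infsum_mono [OF sm summable_on_cmult_right [OF ell2_summable]])
      show "(norm (bop_apply (\<alpha> (- h) x) (ell2_apply \<zeta> h)))\<^sup>2 \<le> C\<^sup>2 * (norm (ell2_apply \<zeta> h))\<^sup>2" for h
        using power_mono [OF le norm_ge_zero, of h "ell2_apply \<zeta> h" 2]
        by (simp add: power_mult_distrib)
    qed
    also have "\<dots> = (norm \<zeta> * C)\<^sup>2"
      by (simp add: infsum_cmult_right ell2_summable norm_ell2_power2 power_mult_distrib)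
    finally show "norm (T \<zeta>) \<le> norm \<zeta> * C"
      by (rule power2_le_imp_le) (simp add: C)
  qed
  moreover have "T (c *\<^sub>C \<zeta>) = c *\<^sub>C T \<zeta>" for c \<zeta>
    by (rule ell2_eqI) (use bop_apply [of "\<alpha> (- _) x"] in \<open>simp add: T scaleC_ell2.rep_eq\<close>)
  ultimately have B: "bop_apply (Bop T) = T"
    by (simp add: Bop_inverse)
  have "\<forall>\<zeta> h. ell2_apply (bop_apply (cp_embed \<alpha> x) \<zeta>) h = bop_apply (\<alpha> (- h) x) (ell2_apply \<zeta> h)"
    unfolding cp_embed_def
  proof (rule theI [of _ "Bop T"])
    show "\<forall>\<zeta> h. ell2_apply (bop_apply (Bop T) \<zeta>) h = bop_apply (\<alpha> (- h) x) (ell2_apply \<zeta> h)"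
      by (simp add: B T)
    show "S = Bop T"
      if "\<forall>\<zeta> h. ell2_apply (bop_apply S \<zeta>) h = bop_apply (\<alpha> (- h) x) (ell2_apply \<zeta> h)" for S
      by (intro bop_eqI ell2_eqI) (use that in \<open>simp add: B T\<close>)
  qed
  then show ?thesis by blast
qed

lemma bij_left_translation: "bij (\<lambda>h. - g + h :: 'g :: group_add)"
  by (rule bij_plus)

lift_definition shift_ell2 :: "'g::group_add \<Rightarrow> ('g, 'a::complex_hilbert) ell2 \<Rightarrow> ('g, 'a) ell2"
  is "\<lambda>g f h. f (- g + h)"
  by (rule iffD2 [OF summable_on_reindex_bij_betw [OF bij_left_translation]])

lemma norm_shift_ell2: "norm (shift_ell2 g f) = norm f"
proof (rule power2_eq_imp_eq [OF _ norm_ge_zero norm_ge_zero])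
  show "(norm (shift_ell2 g f))\<^sup>2 = (norm f)\<^sup>2"
    unfolding norm_ell2_power2 shift_ell2.rep_eq
    by (rule infsum_reindex_bij_betw [OF bij_left_translation])
qed

lemma bounded_linear_shift_ell2: "bounded_linear (shift_ell2 g)"
proof (rule bounded_linear_intro [of _ 1])
  show "shift_ell2 g (x + y) = shift_ell2 g x + shift_ell2 g y" for x y
    by (rule ell2_eqI) (simp add: shift_ell2.rep_eq plus_ell2.rep_eq)
  show "shift_ell2 g (r *\<^sub>R x) = r *\<^sub>R shift_ell2 g x" for r x
    by (rule ell2_eqI) (simp add: shift_ell2.rep_eq scaleR_ell2.rep_eq)
  show "norm (shift_ell2 g x) \<le> norm x * 1" for x
    by (simp add: norm_shift_ell2)
qed

lemma shift_ell2_scaleC: "shift_ell2 g (c *\<^sub>C x) = c *\<^sub>C shift_ell2 g x"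
  by (rule ell2_eqI) (simp add: shift_ell2.rep_eq scaleC_ell2.rep_eq)

lift_definition cp_unitary :: "'g::group_add \<Rightarrow> ('g, 'a::complex_hilbert) ell2 bop" is shift_ell2
  by (simp add: bounded_linear_shift_ell2 shift_ell2_scaleC)

definition crossed_product ::
    "'a::complex_hilbert bop set \<Rightarrow> ('g::group_add \<Rightarrow> 'a bop \<Rightarrow> 'a bop) \<Rightarrow> ('g, 'a) ell2 bop set"
  where
  "crossed_product N \<alpha> = commutant (commutant (cp_embed \<alpha> ` N \<union> range cp_unitary))"

definition group_vna :: "('g::group_add, 'a::complex_hilbert) ell2 bop set" where
  "group_vna = commutant (commutant (range cp_unitary))"


section \<open>Matrices over an operator algebra\<close>

definition diag :: "nat \<Rightarrow> 'b::zero \<Rightarrow> 'b mat" where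
  "diag n x = Matrix.mat n n (\<lambda>(i, j). if i = j then x else 0)"

definition rep_mat ::
    "('a::complex_hilbert bop \<Rightarrow> complex) \<Rightarrow> ('g \<Rightarrow> 'a bop \<Rightarrow> 'a bop) \<Rightarrow> nat \<Rightarrow> (nat \<Rightarrow> 'a bop) \<Rightarrow> 'g
      \<Rightarrow> complex mat" where
  "rep_mat \<tau> \<alpha> n \<xi> g = Matrix.mat n n (\<lambda>(i, j). trace_inner \<tau> (\<alpha> g (\<xi> j)) (\<xi> i))"

definition scalar_mat :: "complex mat \<Rightarrow> 'a::complex_hilbert bop mat" where
  "scalar_mat A = map_mat (\<lambda>c. c *\<^sub>C 1) A"

text \<open>Rows and columns are numbered from \<open>0\<close>, so this is the matrix whose first column is
  \<open>W 0, \<dots>, W (n - 1)\<close>.\<close>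

definition first_column_mat :: "nat \<Rightarrow> (nat \<Rightarrow> 'b::zero) \<Rightarrow> 'b mat" where
  "first_column_mat n W = Matrix.mat n n (\<lambda>(i, j). if j = 0 then W i else 0)"

end

theory Submission
  imports Defs
begin

text \<open>
  Elements of \<open>M\<close> are handled through their matrix entries on \<open>\<ell>\<^sup>2(G, H)\<close>; row \<open>0\<close> lists the
  Fourier coefficients. For a basis \<open>\<xi>\<^sub>i\<close> of \<open>N\<^sub>k\<close> the map \<open>P(x) = \<Sum>\<^sub>i \<xi>\<^sub>i E(\<xi>\<^sub>i\<^sup>*x)\<close>, with \<open>E\<close> the
  conditional expectation onto \<open>L(G)\<close>, projects the Fourier coefficients onto \<open>N\<^sub>k\<close> and is
  \<open>L(G)\<close>-bimodular. If \<open>w\<close> normalizes \<open>L(G)\<close>, then \<open>u\<^sub>g w = w v\<^sub>g\<close> with \<open>v\<^sub>g = w\<^sup>*u\<^sub>g w \<in> L(G)\<close>, hence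
  \<open>u\<^sub>g P(w) = P(w) v\<^sub>g\<close>, and \<open>P(w) w\<^sup>*\<close> commutes with \<open>L(G)\<close>. As \<open>G\<close> is i.c.c. and the action
  ergodic, \<open>P(w) = c w\<close> for a scalar \<open>c\<close>, which is nonzero for some \<open>k\<close> by density. The matrix
  identity compares the coefficients in \<open>u\<^sub>g w = w v\<^sub>g\<close> along the basis \<open>\<xi>\<^sub>i\<close>.
\<close>

section \<open>Hilbert space basics\<close>

text \<open>\<open>M\<close> is given as a double commutant, and the proof uses neither a trace on
  it nor an ultraweak topology. An identity on \<open>M\<close> is turned into an equality of two
  functionals \<open>x \<mapsto> cinner (bop_apply (amp x) V) W\<close>, which is checked on the
  monomials \<open>\<pi> a * u g\<close> and extended by an orthogonality form of the double
  commutant theorem. The vectors \<open>V\<close>, \<open>W\<close> come from the normality of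
  \<open>\<tau>\<close>. The expectation \<open>E\<close> applies \<open>\<tau>\<close> to every
  matrix entry: the resulting scalar matrix is bounded because it is a slice of an amplification,
  and it belongs to \<open>L(G)\<close> because it is a convolution matrix. The scalar
  \<open>c\<close> arises as follows. If an operator in \<open>M\<close> commutes with
  \<open>L(G)\<close>, the action carries its Fourier coefficients along conjugacy classes, so their
  2-norms are constant on each class; since the squares of these norms have bounded finite sums, an
  infinite class admits only zero, and ergodicity makes the coefficient at the neutral element a
  scalar.\<close>

lemma bop_clinear:
  "bounded_linear (bop_apply x)" "bop_apply x (c *\<^sub>C v) = c *\<^sub>C bop_apply x v"
  using bop_apply [of x] by auto

lemmas bop_linear_simps = linear_simps [OF bop_clinear(1)]

lemma bop_apply_sum: "bop_apply x (\<Sum>i\<in>I. f i) = (\<Sum>i\<in>I. bop_apply x (f i))"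
  using bop_clinear(1) [of x] by (simp add: linear_sum bounded_linear.linear)

lemma bop_bound: "norm (bop_apply x v) \<le> norm x * norm v"
  using onorm [OF bop_clinear(1)] by (simp add: norm_bop.rep_eq)

lemma bop_norm_le: "0 \<le> C \<Longrightarrow> (\<And>v. norm (bop_apply x v) \<le> C * norm v) \<Longrightarrow> norm x \<le> C"
  by (simp add: norm_bop.rep_eq onorm_bound)

lemma bop_sum_apply: "bop_apply (\<Sum>i\<in>I. f i) v = (\<Sum>i\<in>I. bop_apply (f i) v)"
  by (induction I rule: infinite_finite_induct) (simp_all add: zero_bop.rep_eq plus_bop.rep_eq)

lemma Bop_apply:
  assumes "\<And>v w. f (v + w) = f v + f w" "\<And>c v. f (c *\<^sub>C v) = c *\<^sub>C f v" "\<And>v. norm (f v) \<le> C * norm v"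
  shows "bop_apply (Bop f) = f"
proof -
  have "f (r *\<^sub>R v) = r *\<^sub>R f v" for r v
    using assms(2) [of "complex_of_real r"] by (simp add: scaleC_of_real)
  then have "bounded_linear f"
    using assms by (intro bounded_linear_intro [of _ C]) (auto simp: mult.commute)
  then show ?thesis
    using assms(2) by (simp add: Bop_inverse)
qed

lemma bop_scaleC_mult [simp]:
  fixes x y :: "'a::complex_hilbert bop"
  shows "(c *\<^sub>C x) * y = c *\<^sub>C (x * y)" "x * (c *\<^sub>C y) = c *\<^sub>C (x * y)"
  by (rule bop_eqI; simp add: times_bop.rep_eq scaleC_bop.rep_eq bop_clinear)+

lemma scaleC_minus_one: "(-1) *\<^sub>C (x::'a::complex_vector) = - x"
  by (simp add: complex_vector.scale_minus_left)

lemma scaleC_sum_right: "c *\<^sub>C (\<Sum>i\<in>I. f i) = (\<Sum>i\<in>I. c *\<^sub>C (f i :: 'a::complex_vector))"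
  by (rule complex_vector.scale_sum_right)

lemma cinner_add_right: "cinner x (y + z) = cinner x y + cinner x z"
  by (metis cinner_commute cinner_add_left complex_cnj_add)

lemma cinner_scaleC_right: "cinner x (c *\<^sub>C y) = cnj c * cinner x y"
  by (metis cinner_commute cinner_scaleC_left complex_cnj_mult)

lemma cinner_zero [simp]: "cinner 0 x = 0" "cinner x 0 = 0"
  using cinner_scaleC_left [of 0 x x] cinner_scaleC_right [of x 0 x] by simp_all

lemma cinner_minus: "cinner (- x) y = - cinner x y" "cinner x (- y) = - cinner x y"
  using cinner_scaleC_left [of "-1" x y] cinner_scaleC_right [of x "-1" y]
  by (simp_all add: scaleC_minus_one)

lemma cinner_diff:
  "cinner (x - y) z = cinner x z - cinner y z" "cinner z (x - y) = cinner z x - cinner z y"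
  using cinner_add_left [of x "- y" z] cinner_add_right [of z x "- y"] by (simp_all add: cinner_minus)

lemma cinner_sum_left: "cinner (\<Sum>i\<in>I. f i) y = (\<Sum>i\<in>I. cinner (f i) y)"
  by (induction I rule: infinite_finite_induct) (simp_all add: cinner_add_left)

lemma cinner_sum_right: "cinner x (\<Sum>i\<in>I. f i) = (\<Sum>i\<in>I. cinner x (f i))"
  by (induction I rule: infinite_finite_induct) (simp_all add: cinner_add_right)

lemma cinner_self_eq_0: "cinner x x = 0 \<longleftrightarrow> x = 0"
  by (simp add: cinner_self)

lemma cinner_eqI: "(\<And>z. cinner x z = cinner y z) \<Longrightarrow> x = y"
  using cinner_self_eq_0 [of "x - y"] by (simp add: cinner_diff)

lemma cmod_cinner_le: "cmod (cinner x y) \<le> norm x * norm y"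
proof (cases "cinner x y = 0")
  case False
  define c where "c = cnj (cinner x y) / cmod (cinner x y)"
  have c: "cmod c = 1"
    using False by (simp add: c_def norm_divide)
  have "cinner (c *\<^sub>C x) y = cmod (cinner x y)"
    using False complex_norm_square [of "cinner x y"]
    by (simp add: cinner_scaleC_left c_def divide_simps power2_eq_square mult.commute)
  then have "cmod (cinner x y) = inner (c *\<^sub>C x) y"
    by (metis Re_cinner Re_complex_of_real)
  also have "\<dots> \<le> norm (c *\<^sub>C x) * norm y"
    by (rule norm_cauchy_schwarz)
  finally show ?thesis by (simp add: norm_scaleC c)
qed simp

lemma bounded_linear_cinner_left: "bounded_linear (\<lambda>x. cinner x y)"
  by (rule bounded_linear_intro [of _ "norm y"])
    (simp_all add: cinner_add_left cmod_cinner_le scaleR_conv_of_real cinner_scaleC_left flip: scaleC_of_real)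

section \<open>Projections, functionals and adjoints\<close>

lemma parallelogram_law:
  "(norm (x + y))\<^sup>2 + (norm (x - y))\<^sup>2 = 2 * (norm x)\<^sup>2 + 2 * (norm (y :: 'a::real_inner))\<^sup>2"
  by (simp add: power2_norm_eq_inner inner_add_left inner_add_right inner_diff_left inner_diff_right)

text \<open>A minimizing sequence for the distance from \<open>x\<close> to \<open>U\<close> is
  Cauchy by the parallelogram law; the residue at its limit is orthogonal to \<open>U\<close>
  because moving the limit inside \<open>U\<close> cannot shorten the distance.\<close>

lemma projection_exists:
  fixes x :: "'a::complex_hilbert"
  assumes U: "csubspace U" "closed U"
  shows "\<exists>p\<in>U. \<forall>u\<in>U. cinner (x - p) u = 0"
proof -
  have ne: "U \<noteq> {}" using complex_vector.subspace_0 [OF U(1)] by blast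
  have sR: "r *\<^sub>R u \<in> U" if "u \<in> U" for r u
    using complex_vector.subspace_scale [OF U(1) that, of "complex_of_real r"] by (simp add: scaleC_of_real)
  define d where "d = infdist x U"
  have dle: "d \<le> norm (x - u)" if "u \<in> U" for u
    using infdist_le [OF that, of x] by (simp add: d_def dist_norm)
  have d0: "0 \<le> d" by (simp add: d_def infdist_nonneg)
  have "\<exists>u\<in>U. norm (x - u) < d + inverse (real (Suc n))" for n
  proof (rule ccontr)
    assume "\<not> ?thesis"
    then have "d + inverse (real (Suc n)) \<le> infdist x U"
      unfolding infdist_notempty [OF ne] by (intro cINF_greatest [OF ne]) (auto simp: dist_norm not_less)
    then show False unfolding d_def by (simp add: not_le [symmetric])
  qed
  then obtain X where X: "\<And>n. X n \<in> U" "\<And>n. norm (x - X n) < d + inverse (real (Suc n))"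
    by metis
  have lim: "(\<lambda>n. norm (x - X n)) \<longlonglongrightarrow> d"
  proof (rule tendsto_sandwich [of "\<lambda>_. d" _ _ "\<lambda>n. d + inverse (real (Suc n))"])
    show "(\<lambda>n. d + inverse (real (Suc n))) \<longlonglongrightarrow> d"
      using tendsto_add [OF tendsto_const LIMSEQ_inverse_real_of_nat, of d] by simp
  qed (use X dle in \<open>auto intro!: always_eventually less_imp_le\<close>)
  have par: "(norm (X m - X n))\<^sup>2 \<le> 2 * (norm (x - X m))\<^sup>2 + 2 * (norm (x - X n))\<^sup>2 - 4 * d\<^sup>2" for m n
  proof -
    \<comment> \<open>The midpoint lies in \<open>U\<close>, so its distance to \<open>x\<close> is
      at least \<open>d\<close>; this is the source of the term
      \<open>4 * d\<^sup>2\<close>.\<close>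
    have "(1/2) *\<^sub>R (X m + X n) \<in> U" by (intro sR complex_vector.subspace_add [OF U(1)] X)
    from dle [OF this] have "(2 * d)\<^sup>2 \<le> (2 * norm (x - (1/2) *\<^sub>R (X m + X n)))\<^sup>2"
      using d0 by (intro power_mono) auto
    also have "2 * norm (x - (1/2) *\<^sub>R (X m + X n)) = norm (2 *\<^sub>R (x - (1/2) *\<^sub>R (X m + X n)))" by simp
    also have "2 *\<^sub>R (x - (1/2) *\<^sub>R (X m + X n)) = (x - X m) + (x - X n)"
      by (simp add: algebra_simps scaleR_2)
    finally show ?thesis
      using parallelogram_law [of "x - X m" "x - X n"] by (simp add: norm_minus_commute)
  qed
  have "Cauchy X"
  proof (rule metric_CauchyI)
    fix e :: real assume e: "0 < e"
    have "(\<lambda>n. (norm (x - X n))\<^sup>2) \<longlonglongrightarrow> d\<^sup>2" by (intro tendsto_intros lim)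
    from order_tendstoD(2) [OF this, of "d\<^sup>2 + e\<^sup>2 / 4"] e
    obtain M where M: "\<And>n. n \<ge> M \<Longrightarrow> (norm (x - X n))\<^sup>2 < d\<^sup>2 + e\<^sup>2 / 4"
      by (auto simp: eventually_sequentially)
    have "dist (X m) (X n) < e" if "m \<ge> M" "n \<ge> M" for m n
    proof (rule power2_less_imp_less)
      show "(dist (X m) (X n))\<^sup>2 < e\<^sup>2"
        using par [of m n] M [OF that(1)] M [OF that(2)] by (simp add: dist_norm)
    qed (use e in simp)
    then show "\<exists>M. \<forall>m\<ge>M. \<forall>n\<ge>M. dist (X m) (X n) < e" by blast
  qed
  then obtain p where p: "X \<longlonglongrightarrow> p" by (auto simp: Cauchy_convergent_iff convergent_def)
  have pU: "p \<in> U" using closed_sequentially [OF U(2)] X p by blast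
  have np: "norm (x - p) = d"
    by (rule LIMSEQ_unique [OF _ lim]) (intro tendsto_intros p)
  have re: "inner (x - p) u = 0" if u: "u \<in> U" for u
  proof (cases "u = 0")
    case False
    \<comment> \<open>The minimizer of \<open>norm ((x - p) - t *\<^sub>R u)\<close> over real
      \<open>t\<close>. Since \<open>t = 0\<close> is already minimal, the inner product
      vanishes.\<close>
    define t where "t = inner (x - p) u / (norm u)\<^sup>2"
    have "p + t *\<^sub>R u \<in> U" by (intro complex_vector.subspace_add [OF U(1)] pU sR u)
    from power_mono [OF dle [OF this] d0, of 2]
    have "(norm (x - p))\<^sup>2 \<le> (norm ((x - p) - t *\<^sub>R u))\<^sup>2" by (simp add: np diff_diff_eq)
    also have "\<dots> = (norm (x - p))\<^sup>2 - 2 * t * inner (x - p) u + t\<^sup>2 * (norm u)\<^sup>2"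
      unfolding power2_norm_eq_inner inner_diff_left [of "x - p"] inner_diff_right [of _ "x - p"] inner_diff_right [of _ _ "t *\<^sub>R u"]
      by (simp add: inner_commute [of u "x - p"] power2_eq_square)
    also have "t\<^sup>2 * (norm u)\<^sup>2 = t * inner (x - p) u"
      using False by (simp add: t_def power2_eq_square)
    finally have "t * inner (x - p) u \<le> 0" by simp
    then have "(inner (x - p) u)\<^sup>2 / (norm u)\<^sup>2 \<le> 0" by (simp add: t_def power2_eq_square)
    then show ?thesis using False by (simp add: divide_le_0_iff)
  qed simp
  have "cinner (x - p) u = 0" if "u \<in> U" for u
  proof -
    \<comment> \<open>The real part vanishes on all of \<open>U\<close>; passing from
      \<open>u\<close> to \<open>\<i> *\<^sub>C u\<close> gives the imaginary part.\<close>
    have "\<i> *\<^sub>C u \<in> U" by (rule complex_vector.subspace_scale [OF U(1) that])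
    from re [OF this] re [OF that] have "Re (cinner (x - p) u) = 0" "Re (cinner (x - p) (\<i> *\<^sub>C u)) = 0"
      by (simp_all add: Re_cinner)
    then show ?thesis by (simp add: cinner_scaleC_right complex_eq_iff)
  qed
  then show ?thesis using pU by blast
qed

text \<open>The kernel is closed of codimension one, so the residue \<open>q\<close> of a projection
  onto it spans the complement, and a multiple of \<open>q\<close> represents
  \<open>f\<close>.\<close>

lemma riesz:
  fixes f :: "'a::complex_hilbert \<Rightarrow> complex"
  assumes add: "\<And>x y. f (x + y) = f x + f y" and sc: "\<And>c x. f (c *\<^sub>C x) = c * f x"
    and bd: "\<And>x. cmod (f x) \<le> C * norm x"
  shows "\<exists>z. \<forall>x. f x = cinner x z"
proof (cases "\<forall>x. f x = 0")
  case True
  then show ?thesis by (intro exI [of _ 0]) simp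
next
  case False
  then obtain x0 where x0: "f x0 \<noteq> 0" by blast
  define U where "U = {x. f x = 0}"
  have diff: "f (x - y) = f x - f y" for x y
    using add [of "x - y" y] by simp
  have f0: "f 0 = 0" using sc [of 0 0] by simp
  have U: "csubspace U"
    by (rule complex_vector.subspaceI) (simp_all add: U_def add sc f0)
  have "bounded_linear f"
    by (rule bounded_linear_intro [of _ C])
      (use bd in \<open>simp_all add: add sc mult.commute scaleR_conv_of_real flip: scaleC_of_real\<close>)
  then have "closed U"
    unfolding U_def by (intro closed_Collect_eq continuous_on_const linear_continuous_on)
  from projection_exists [OF U this, of x0] obtain p
    where p: "p \<in> U" "\<And>u. u \<in> U \<Longrightarrow> cinner (x0 - p) u = 0" by blast
  define q where "q = x0 - p"
  have fq: "f q = f x0" using p by (simp add: q_def diff U_def)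
  then have q0: "cinner q q \<noteq> 0" using x0 f0 by (auto simp: cinner_self_eq_0)
  have "f x = cinner x ((cnj (f q) / cnj (cinner q q)) *\<^sub>C q)" for x
  proof -
    have "x - (f x / f q) *\<^sub>C q \<in> U" using x0 fq by (simp add: U_def diff sc)
    from p(2) [OF this] have "cinner (x - (f x / f q) *\<^sub>C q) q = 0"
      using cinner_commute by (metis complex_cnj_zero q_def)
    then have "cinner x q = f x / f q * cinner q q" by (simp add: cinner_diff cinner_scaleC_left)
    then show ?thesis using q0 x0 fq by (simp add: cinner_scaleC_right)
  qed
  then show ?thesis by blast
qed

text \<open>\<open>adj\<close> is a definite description, so a witness has to be built.
  \<open>riesz\<close> asks for a linear functional; hence it is applied to the conjugate of
  \<open>cinner v (bop_apply x w)\<close>, which is linear in \<open>w\<close>.\<close>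

lemma cinner_adj: "cinner (bop_apply (adj x) v) w = cinner v (bop_apply x w)"
proof -
  have "\<exists>z. \<forall>w. cnj (cinner v (bop_apply x w)) = cinner w z" for v
  proof (rule riesz)
    show "cmod (cnj (cinner v (bop_apply x w))) \<le> norm v * norm x * norm w" for w
      using order_trans [OF cmod_cinner_le mult_left_mono [OF bop_bound norm_ge_zero], of v x w]
      by (simp add: mult_ac)
  qed (simp_all add: bop_linear_simps bop_clinear cinner_add_right cinner_scaleC_right)
  then obtain f where f: "\<And>v w. cnj (cinner v (bop_apply x w)) = cinner w (f v)" by metis
  have f': "cinner (f v) w = cinner v (bop_apply x w)" for v w
    using f [of v w] by (metis cinner_commute complex_cnj_cnj)
  have F: "bop_apply (Bop f) = f"
  proof (rule Bop_apply)
    show "f (v + w) = f v + f w" for v w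
      by (rule cinner_eqI) (simp add: f' cinner_add_left)
    show "f (c *\<^sub>C v) = c *\<^sub>C f v" for c v
      by (rule cinner_eqI) (simp add: f' cinner_scaleC_left)
    show "norm (f v) \<le> norm x * norm v" for v
    proof (cases "f v = 0")
      case False
      have "complex_of_real ((norm (f v))\<^sup>2) = cinner v (bop_apply x (f v))"
        using f' [of v "f v"] by (simp add: cinner_self)
      then have "(norm (f v))\<^sup>2 = cmod (cinner v (bop_apply x (f v)))"
        by (metis abs_power2 norm_of_real)
      also have "\<dots> \<le> norm v * (norm x * norm (f v))"
        by (rule order_trans [OF cmod_cinner_le mult_left_mono [OF bop_bound norm_ge_zero]])
      also have "\<dots> = (norm x * norm v) * norm (f v)" by simp
      finally show ?thesis using False by (simp add: power2_eq_square)
    qed (simp add: mult_nonneg_nonneg)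
  qed
  have "\<forall>v w. cinner (bop_apply (adj x) v) w = cinner v (bop_apply x w)"
    unfolding adj_def
  proof (rule theI [of _ "Bop f"])
    show "\<forall>v w. cinner (bop_apply (Bop f) v) w = cinner v (bop_apply x w)" by (simp add: F f')
    show "y = Bop f" if "\<forall>v w. cinner (bop_apply y v) w = cinner v (bop_apply x w)" for y
      by (intro bop_eqI cinner_eqI) (simp add: F f' that)
  qed
  then show ?thesis by blast
qed

lemma cinner_adj': "cinner v (bop_apply (adj x) w) = cinner (bop_apply x v) w"
  by (metis cinner_adj cinner_commute)

lemma adj_eqI: "(\<And>v w. cinner (bop_apply y v) w = cinner v (bop_apply x w)) \<Longrightarrow> adj x = y"
  by (intro bop_eqI cinner_eqI) (simp add: cinner_adj)

lemma adj_add: "adj (x + y) = adj x + adj y"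
  by (rule adj_eqI) (simp add: plus_bop.rep_eq cinner_adj cinner_add_left cinner_add_right)

lemma adj_scaleC: "adj (c *\<^sub>C x) = cnj c *\<^sub>C adj x"
  by (rule adj_eqI) (simp add: scaleC_bop.rep_eq cinner_adj cinner_scaleC_left cinner_scaleC_right)

lemma adj_mult: "adj (x * y) = adj y * adj x"
  by (rule adj_eqI) (simp add: times_bop.rep_eq cinner_adj)

section \<open>Algebra of commutants\<close>

lemma commutantI: "(\<And>x. x \<in> S \<Longrightarrow> x * y = y * x) \<Longrightarrow> y \<in> commutant S"
  by (simp add: commutant_def)

lemma commutantD: "y \<in> commutant S \<Longrightarrow> x \<in> S \<Longrightarrow> x * y = y * x"
  by (simp add: commutant_def)

lemma commutant_closed:
  assumes x: "x \<in> commutant S"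
  shows commutant_scaleC: "c *\<^sub>C x \<in> commutant S"
    and commutant_add: "y \<in> commutant S \<Longrightarrow> x + y \<in> commutant S"
    and commutant_diff: "y \<in> commutant S \<Longrightarrow> x - y \<in> commutant S"
    and commutant_mult: "y \<in> commutant S \<Longrightarrow> x * y \<in> commutant S"
proof -
  show "y \<in> commutant S \<Longrightarrow> x * y \<in> commutant S"
    using x by (metis (no_types, lifting) commutantD commutantI mult.assoc)
qed (use x in \<open>simp_all add: commutant_def algebra_simps\<close>)

lemma commutant_basics: "0 \<in> commutant S" "1 \<in> commutant S"
  by (simp_all add: commutant_def)

lemma commutant_sum: "(\<And>i. i \<in> I \<Longrightarrow> f i \<in> commutant S) \<Longrightarrow> (\<Sum>i\<in>I. f i) \<in> commutant S"
  by (induction I rule: infinite_finite_induct) (auto intro: commutant_closed commutant_basics)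

lemma commutant_inverse:
  assumes x: "x \<in> commutant S" and inv: "x * y = 1" "y * x = 1"
  shows "y \<in> commutant S"
proof (rule commutantI)
  fix s assume "s \<in> S"
  then have "s * x = x * s" using x by (rule commutantD [rotated])
  then have "y * (s * x) * y = y * (x * s) * y" by simp
  then have "y * s * (x * y) = (y * x) * s * y" by (simp add: mult.assoc)
  then show "s * y = y * s" using inv by simp
qed

lemma commutant_antimono: "S \<subseteq> T \<Longrightarrow> commutant T \<subseteq> commutant S"
  by (auto simp: commutant_def)

lemma subset_double_commutant: "S \<subseteq> commutant (commutant S)"
  by (auto simp: commutant_def)

section \<open>The double commutant\<close>

text \<open>The sets in question, translations and monomials, are closed under products and adjoints
  but not under sums; linear combinations enter only through the closed span of \<open>S\<close>
  applied to a vector.\<close>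

definition star_monoid :: "'a::complex_hilbert bop set \<Rightarrow> bool" where
  "star_monoid S \<longleftrightarrow> 1 \<in> S \<and> (\<forall>x\<in>S. adj x \<in> S) \<and> (\<forall>x\<in>S. \<forall>y\<in>S. x * y \<in> S)"

text \<open>The projection onto the closed span of \<open>S \<zeta>\<close> commutes with \<open>S\<close>.\<close>

lemma double_commutant_orthogonal:
  assumes S: "star_monoid S" and x: "x \<in> commutant (commutant S)"
    and orth: "\<And>s. s \<in> S \<Longrightarrow> cinner (bop_apply s \<zeta>) \<theta> = 0"
  shows "cinner (bop_apply x \<zeta>) \<theta> = 0"
proof -
  define P where "P \<theta> \<longleftrightarrow> (\<forall>s\<in>S. cinner (bop_apply s \<zeta>) \<theta> = 0)" for \<theta>
  \<comment> \<open>The double orthogonal complement of the vectors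
    \<open>bop_apply s \<zeta>\<close>, that is their closed span. In this form membership is tested
    by orthogonality, without approximation.\<close>
  define U where "U = {u. \<forall>\<theta>. P \<theta> \<longrightarrow> cinner u \<theta> = 0}"
  have U: "csubspace U"
    by (rule complex_vector.subspaceI) (auto simp: U_def cinner_add_left cinner_scaleC_left)
  have "U = (\<Inter>\<theta>\<in>Collect P. {u. cinner u \<theta> = 0})" by (auto simp: U_def)
  moreover have "closed {u. cinner u \<theta> = 0}" for \<theta> :: 'a
    by (intro closed_Collect_eq continuous_on_const linear_continuous_on bounded_linear_cinner_left)
  ultimately have "closed U" by auto
  then have "\<exists>p\<in>U. \<forall>u\<in>U. cinner (x - p) u = 0" for x
    by (rule projection_exists [OF U])
  then have "\<forall>x. \<exists>p. p \<in> U \<and> (\<forall>u\<in>U. cinner (x - p) u = 0)" by blast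
  from choice [OF this] obtain p where p: "\<And>x. p x \<in> U" "\<And>x u. u \<in> U \<Longrightarrow> cinner (x - p x) u = 0"
    by blast
  \<comment> \<open>Uniqueness of the projection; it yields the linearity of \<open>p\<close> and
    its commutation with \<open>S\<close>.\<close>
  have eq: "p x = q" if q: "q \<in> U" "\<And>u. u \<in> U \<Longrightarrow> cinner (x - q) u = 0" for x q
  proof -
    have "p x - q \<in> U" by (intro complex_vector.subspace_diff [OF U] p q)
    from p(2) [OF this, of x] q(2) [OF this] have "cinner ((x - q) - (x - p x)) (p x - q) = 0"
      unfolding cinner_diff(1) [of "x - q"] by simp
    then show ?thesis by (simp add: cinner_self_eq_0)
  qed
  have B: "bop_apply (Bop p) = p"
  proof (rule Bop_apply)
    show "p (v + w) = p v + p w" for v w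
    proof (rule eq)
      fix u assume u: "u \<in> U"
      have "cinner (v + w - (p v + p w)) u = cinner (v - p v) u + cinner (w - p w) u"
        by (simp add: cinner_diff cinner_add_left)
      then show "cinner (v + w - (p v + p w)) u = 0" by (simp add: p(2) u)
    qed (intro complex_vector.subspace_add [OF U] p)
    show "p (c *\<^sub>C v) = c *\<^sub>C p v" for c v
    proof (rule eq)
      fix u assume u: "u \<in> U"
      have "cinner (c *\<^sub>C v - c *\<^sub>C p v) u = c * cinner (v - p v) u"
        by (simp add: cinner_diff cinner_scaleC_left algebra_simps)
      then show "cinner (c *\<^sub>C v - c *\<^sub>C p v) u = 0" by (simp add: p(2) u)
    qed (intro complex_vector.subspace_scale [OF U] p)
    show "norm (p v) \<le> 1 * norm v" for v
    proof -
      have "cinner (p v) (p v) = cinner v (p v)" using p(2) [OF p(1) [of v], of v] by (simp add: cinner_diff)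
      then have "(norm (p v))\<^sup>2 = cmod (cinner v (p v))"
        by (metis abs_power2 cinner_self norm_of_real)
      also have "\<dots> \<le> norm v * norm (p v)" by (rule cmod_cinner_le)
      finally show ?thesis by (cases "p v = 0") (simp_all add: power2_eq_square)
    qed
  qed
  have inv: "bop_apply s u \<in> U" if s: "s \<in> S" and u: "u \<in> U" for s u
  proof -
    have "cinner (bop_apply s u) \<theta> = 0" if \<theta>: "P \<theta>" for \<theta>
    proof -
      \<comment> \<open>Adjoints of elements of \<open>S\<close> preserve the orthogonal complement,
        so \<open>S\<close> preserves \<open>U\<close>.\<close>
      have "P (bop_apply (adj s) \<theta>)"
        unfolding P_def
      proof
        fix r assume "r \<in> S"
        then have "s * r \<in> S" using S s by (simp add: star_monoid_def)
        then have "cinner (bop_apply (s * r) \<zeta>) \<theta> = 0" using \<theta> by (simp add: P_def)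
        then show "cinner (bop_apply r \<zeta>) (bop_apply (adj s) \<theta>) = 0"
          by (simp add: cinner_adj' times_bop.rep_eq)
      qed
      then show ?thesis using u by (simp add: U_def flip: cinner_adj')
    qed
    then show ?thesis by (simp add: U_def)
  qed
  have "Bop p \<in> commutant S"
  proof (intro commutantI bop_eqI)
    fix s v assume s: "s \<in> S"
    have "p (bop_apply s v) = bop_apply s (p v)"
    proof (rule eq)
      show "bop_apply s (p v) \<in> U" by (intro inv s p)
      fix u assume u: "u \<in> U"
      have "adj s \<in> S" using S s by (simp add: star_monoid_def)
      from p(2) [OF inv [OF this u], of v]
      show "cinner (bop_apply s v - bop_apply s (p v)) u = 0"
        by (simp add: cinner_diff cinner_adj' bop_linear_simps)
    qed
    then show "bop_apply (s * Bop p) v = bop_apply (Bop p * s) v" by (simp add: times_bop.rep_eq B)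
  qed
  from commutantD [OF x this] have "bop_apply (Bop p * x) v = bop_apply (x * Bop p) v" for v by simp
  then have c: "p (bop_apply x v) = bop_apply x (p v)" for v by (simp add: times_bop.rep_eq B)
  \<comment> \<open>Here \<open>1 \<in> S\<close> is used. As \<open>x\<close> commutes with the
    projection, \<open>bop_apply x \<zeta>\<close> then lies in \<open>U\<close> as well.\<close>
  have "\<zeta> \<in> U"
    unfolding U_def P_def mem_Collect_eq
    by (metis S one_bop.rep_eq star_monoid_def)
  then have "p \<zeta> = \<zeta>" by (intro eq) auto
  then have "bop_apply x \<zeta> \<in> U" using c [of \<zeta>] p(1) by metis
  then show ?thesis using orth by (simp add: U_def P_def)
qed

section \<open>Operators on \<open>\<ell>\<^sup>2(I, H)\<close>\<close>

lemma cinner_ell2_summable: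
  "(\<lambda>h. cinner (ell2_apply \<zeta> h) (ell2_apply \<theta> h)) summable_on UNIV"
  by (rule cinner_summable [OF ell2_summable ell2_summable])

lift_definition delta :: "'i \<Rightarrow> 'a::complex_hilbert \<Rightarrow> ('i, 'a) ell2" is "\<lambda>i v j. if j = i then v else 0"
  subgoal for i v
    by (rule finite_nonzero_values_imp_summable_on, rule finite_subset [of _ "{i}"]) auto
  done

lemma cinner_delta_left: "cinner (delta i v) \<zeta> = cinner v (ell2_apply \<zeta> i)"
proof -
  have "cinner (delta i v) \<zeta> = (\<Sum>\<^sub>\<infinity>h\<in>{i}. cinner (ell2_apply (delta i v) h) (ell2_apply \<zeta> h))"
    unfolding cinner_ell2.rep_eq by (rule infsum_cong_neutral) (auto simp: delta.rep_eq)
  then show ?thesis by (simp add: delta.rep_eq)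
qed

lemma cinner_delta_right: "cinner \<zeta> (delta i v) = cinner (ell2_apply \<zeta> i) v"
  by (metis cinner_commute cinner_delta_left)

lemma delta_add: "delta i (v + w) = delta i v + delta i w"
  by (rule ell2_eqI) (simp add: delta.rep_eq plus_ell2.rep_eq)

lemma delta_scaleC: "delta i (c *\<^sub>C v) = c *\<^sub>C delta i v"
  by (rule ell2_eqI) (simp add: delta.rep_eq scaleC_ell2.rep_eq)

lemma norm_delta [simp]: "norm (delta i v) = norm v"
proof -
  have "complex_of_real ((norm (delta i v))\<^sup>2) = complex_of_real ((norm v)\<^sup>2)"
    unfolding cinner_self [symmetric] by (simp add: cinner_delta_left delta.rep_eq)
  then have "(norm (delta i v))\<^sup>2 = (norm v)\<^sup>2" using of_real_eq_iff by blast
  then show ?thesis by (simp add: power2_eq_iff_nonneg)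
qed

lemma orthogonal_delta: "(\<And>i v. cinner \<zeta> (delta i v) = 0) \<Longrightarrow> \<zeta> = 0"
  by (rule ell2_eqI, rule cinner_eqI) (simp add: cinner_delta_right zero_ell2.rep_eq)

text \<open>The vectors \<open>delta i v\<close> are total. This is exploited through adjoints: the
  difference of \<open>bop_apply (adj x) \<theta>\<close> and
  \<open>bop_apply (adj y) \<theta>\<close> is orthogonal to all of them.\<close>

lemma bop_ell2_eqI:
  assumes "\<And>i v. bop_apply x (delta i v) = bop_apply y (delta i v)"
  shows "x = (y :: ('i, 'a::complex_hilbert) ell2 bop)"
proof (rule bop_eqI)
  fix \<zeta>
  have "bop_apply (adj x) \<theta> = bop_apply (adj y) \<theta>" for \<theta>
  proof -
    have "bop_apply (adj x) \<theta> - bop_apply (adj y) \<theta> = 0"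
      by (rule orthogonal_delta) (simp add: cinner_diff cinner_adj assms)
    then show ?thesis by simp
  qed
  then show "bop_apply x \<zeta> = bop_apply y \<zeta>"
    by (intro cinner_eqI) (simp flip: cinner_adj')
qed

text \<open>\<open>h\<close> is the row and \<open>k\<close> the column; that the operator acts by
  matrix multiplication, with a convergent sum over \<open>k\<close>, is
  \<open>has_sum_entry\<close>.\<close>

definition entry :: "('i, 'a::complex_hilbert) ell2 bop \<Rightarrow> 'i \<Rightarrow> 'i \<Rightarrow> 'a bop" where
  "entry x h k = Bop (\<lambda>v. ell2_apply (bop_apply x (delta k v)) h)"

lemma entry_apply: "bop_apply (entry x h k) v = ell2_apply (bop_apply x (delta k v)) h"
proof -
  have "bop_apply (Bop (\<lambda>v. ell2_apply (bop_apply x (delta k v)) h))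
      = (\<lambda>v. ell2_apply (bop_apply x (delta k v)) h)"
  proof (rule Bop_apply)
    show "norm (ell2_apply (bop_apply x (delta k v)) h) \<le> norm x * norm v" for v
      using order_trans [OF norm_ell2_apply_le bop_bound, of x "delta k v" h] by simp
  qed (simp_all add: delta_add delta_scaleC bop_linear_simps bop_clinear plus_ell2.rep_eq scaleC_ell2.rep_eq)
  then show ?thesis by (simp add: entry_def)
qed

lemma entry_eqI: "(\<And>h k. entry x h k = entry y h k) \<Longrightarrow> x = y"
  by (intro bop_ell2_eqI ell2_eqI) (simp flip: entry_apply)

lemma entry_linear:
  "entry 0 h k = 0" "entry (x + y) h k = entry x h k + entry y h k"
  "entry (c *\<^sub>C x) h k = c *\<^sub>C entry x h k"
  by (rule bop_eqI, simp add: entry_apply zero_bop.rep_eq plus_bop.rep_eq scaleC_bop.rep_eq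
      zero_ell2.rep_eq plus_ell2.rep_eq scaleC_ell2.rep_eq)+

lemma entry_sum: "entry (\<Sum>i\<in>I. f i) h k = (\<Sum>i\<in>I. entry (f i) h k)"
  by (induction I rule: infinite_finite_induct) (simp_all add: entry_linear)

lemma entry_one: "entry 1 h k = (if h = k then 1 else 0)"
  by (rule bop_eqI) (simp add: entry_apply one_bop.rep_eq zero_bop.rep_eq delta.rep_eq)

text \<open>In tensor notation this is \<open>1 \<otimes> x\<close>.\<close>

definition amp :: "'a::complex_hilbert bop \<Rightarrow> ('i, 'a) ell2 bop" where
  "amp x = Bop (\<lambda>\<zeta>. Ell2 (\<lambda>h. bop_apply x (ell2_apply \<zeta> h)))"

lemma amp_apply: "ell2_apply (bop_apply (amp x) \<zeta>) h = bop_apply x (ell2_apply \<zeta> h)"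
proof -
  have E: "ell2_apply (Ell2 (\<lambda>h. bop_apply x (ell2_apply \<zeta> h))) = (\<lambda>h. bop_apply x (ell2_apply \<zeta> h))" for \<zeta> :: "('b, 'a) ell2"
    by (subst Ell2_inverse) (simp_all add: square_summable_bound [OF ell2_summable bop_bound])
  have "bop_apply (Bop (\<lambda>\<zeta> :: ('b, 'a) ell2. Ell2 (\<lambda>h. bop_apply x (ell2_apply \<zeta> h))))
    = (\<lambda>\<zeta>. Ell2 (\<lambda>h. bop_apply x (ell2_apply \<zeta> h)))"
  proof (rule Bop_apply)
    show "norm (Ell2 (\<lambda>h. bop_apply x (ell2_apply \<zeta> h))) \<le> norm x * norm \<zeta>" for \<zeta> :: "('b, 'a) ell2"
    proof (rule power2_le_imp_le)
      have "(norm (Ell2 (\<lambda>h. bop_apply x (ell2_apply \<zeta> h))))\<^sup>2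
          = (\<Sum>\<^sub>\<infinity>h. (norm (bop_apply x (ell2_apply \<zeta> h)))\<^sup>2)"
        by (simp add: norm_ell2_power2 E)
      also have "\<dots> \<le> (\<Sum>\<^sub>\<infinity>h. (norm x)\<^sup>2 * (norm (ell2_apply \<zeta> h))\<^sup>2)"
        by (intro infsum_mono square_summable_bound [OF ell2_summable bop_bound] summable_on_cmult_right ell2_summable)
          (metis bop_bound norm_ge_zero power_mono power_mult_distrib)
      also have "\<dots> = (norm x * norm \<zeta>)\<^sup>2"
        by (simp add: infsum_cmult_right ell2_summable norm_ell2_power2 power_mult_distrib)
      finally show "(norm (Ell2 (\<lambda>h. bop_apply x (ell2_apply \<zeta> h))))\<^sup>2 \<le> (norm x * norm \<zeta>)\<^sup>2" .
    qed simp
  next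
    show "Ell2 (\<lambda>h. bop_apply x (ell2_apply (\<zeta> + \<eta>) h))
        = Ell2 (\<lambda>h. bop_apply x (ell2_apply \<zeta> h)) + Ell2 (\<lambda>h. bop_apply x (ell2_apply \<eta> h))"
      for \<zeta> \<eta> :: "('b, 'a) ell2"
      by (rule ell2_eqI) (simp only: E, simp only: E plus_ell2.rep_eq bop_linear_simps)
    show "Ell2 (\<lambda>h. bop_apply x (ell2_apply (c *\<^sub>C \<zeta>) h))
        = c *\<^sub>C Ell2 (\<lambda>h. bop_apply x (ell2_apply \<zeta> h))" for c and \<zeta> :: "('b, 'a) ell2"
      by (rule ell2_eqI) (simp only: E, simp only: E scaleC_ell2.rep_eq bop_clinear)
  qed
  then show ?thesis by (simp add: amp_def E)
qed

lemma amp_delta: "bop_apply (amp x) (delta k v) = delta k (bop_apply x v)"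
  by (rule ell2_eqI) (simp add: amp_apply delta.rep_eq bop_linear_simps)

lemma amp_one: "amp 1 = 1" and amp_mult: "amp (x * y) = amp x * amp y"
  by (rule bop_eqI, rule ell2_eqI, simp add: amp_apply one_bop.rep_eq times_bop.rep_eq)+

lemma adj_amp: "adj (amp x) = amp (adj x)"
  by (rule adj_eqI) (simp add: cinner_ell2.rep_eq amp_apply cinner_adj)

lemma entry_amp_mult: "entry (amp x * y) h k = x * entry y h k"
  by (rule bop_eqI) (simp add: entry_apply times_bop.rep_eq amp_apply)

lemma entry_mult_amp: "entry (y * amp x) h k = entry y h k * x"
  by (rule bop_eqI) (simp add: entry_apply times_bop.rep_eq amp_delta)

text \<open>\<open>amp x\<close> is the diagonal matrix with \<open>x\<close> at every place, so
  commutation with it is decided entry by entry.\<close>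

lemma amp_commute_iff: "amp x * y = y * amp x \<longleftrightarrow> (\<forall>h k. x * entry y h k = entry y h k * x)"
proof
  assume "\<forall>h k. x * entry y h k = entry y h k * x"
  then show "amp x * y = y * amp x"
    by (intro entry_eqI) (simp add: entry_amp_mult entry_mult_amp)
next
  assume "amp x * y = y * amp x"
  then have "entry (amp x * y) h k = entry (y * amp x) h k" for h k by simp
  then show "\<forall>h k. x * entry y h k = entry y h k * x"
    by (simp add: entry_amp_mult entry_mult_amp)
qed

lemma star_monoid_amp: "star_monoid S \<Longrightarrow> star_monoid (amp ` S)"
  unfolding star_monoid_def
  by (auto simp: adj_amp simp flip: amp_mult intro!: image_eqI [of 1 amp 1] amp_one [symmetric])

text \<open>An operator commuting with all \<open>amp s\<close> has its entries in
  \<open>commutant S\<close>; these commute with \<open>x\<close>, hence the operator commutes with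
  \<open>amp x\<close>.\<close>

lemma double_commutant_amp:
  assumes "x \<in> commutant (commutant S)"
  shows "amp x \<in> commutant (commutant (amp ` S))"
proof (rule commutantI)
  fix y assume y: "y \<in> commutant (amp ` S)"
  have "entry y h k \<in> commutant S" for h k
  proof (rule commutantI)
    fix s assume "s \<in> S"
    then have "amp s * y = y * amp s" by (intro commutantD [OF y]) simp
    then show "s * entry y h k = entry y h k * s" by (simp add: amp_commute_iff)
  qed
  then have "x * entry y h k = entry y h k * x" for h k
    using commutantD [OF assms, of "entry y h k"] by simp
  then have "amp x * y = y * amp x" by (simp add: amp_commute_iff)
  then show "y * amp x = amp x * y" by (rule sym)
qed

text \<open>Every normal functional has the form \<open>x \<mapsto> \<langle>(1 \<otimes> x) \<zeta>, \<theta>\<rangle>\<close>.  Two of them are subtracted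
  by passing to \<open>\<ell>\<^sup>2({True, False}, \<cdot>)\<close>.\<close>

lemma double_commutant_normal_eq:
  fixes x :: "'a::complex_hilbert bop" and \<zeta> \<theta> \<zeta>' \<theta>' :: "('i, 'a) ell2"
  assumes S: "star_monoid S" and x: "x \<in> commutant (commutant S)"
    and eq: "\<And>s. s \<in> S \<Longrightarrow> cinner (bop_apply (amp s) \<zeta>) \<theta> = cinner (bop_apply (amp s) \<zeta>') \<theta>'"
  shows "cinner (bop_apply (amp x) \<zeta>) \<theta> = cinner (bop_apply (amp x) \<zeta>') \<theta>'"
proof -
  define Z where "Z = delta True \<zeta> + delta False \<zeta>'"
  define \<Theta> where "\<Theta> = delta True \<theta> - delta False \<theta>'"
  have *: "cinner (bop_apply (amp (amp y)) Z) \<Theta>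
      = cinner (bop_apply (amp y) \<zeta>) \<theta> - cinner (bop_apply (amp y) \<zeta>') \<theta>'" for y
    by (simp add: Z_def \<Theta>_def bop_linear_simps amp_delta cinner_diff cinner_delta_right plus_ell2.rep_eq delta.rep_eq)
  have "cinner (bop_apply (amp (amp x)) Z) \<Theta> = 0"
  proof (rule double_commutant_orthogonal)
    show "star_monoid (amp ` amp ` S)" by (intro star_monoid_amp S)
    show "amp (amp x) \<in> commutant (commutant (amp ` amp ` S))" by (intro double_commutant_amp x)
    show "cinner (bop_apply s Z) \<Theta> = 0" if "s \<in> amp ` amp ` S" for s
      using that eq by (auto simp: *)
  qed
  then show ?thesis by (simp add: *)
qed

instance complex_hilbert \<subseteq> banach ..

section \<open>Automorphisms are contractive\<close>

lemma norm_adj_le: "norm (adj x) \<le> norm x"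
proof (rule bop_norm_le)
  fix v
  have "cinner (bop_apply (adj x) v) (bop_apply (adj x) v) = cinner v (bop_apply x (bop_apply (adj x) v))"
    by (rule cinner_adj)
  then have "(norm (bop_apply (adj x) v))\<^sup>2 = cmod (cinner v (bop_apply x (bop_apply (adj x) v)))"
    by (metis abs_power2 cinner_self norm_of_real)
  also have "\<dots> \<le> norm v * (norm x * norm (bop_apply (adj x) v))"
    by (rule order_trans [OF cmod_cinner_le mult_left_mono [OF bop_bound norm_ge_zero]])
  also have "\<dots> = (norm x * norm v) * norm (bop_apply (adj x) v)" by simp
  finally show "norm (bop_apply (adj x) v) \<le> norm x * norm v"
    by (cases "bop_apply (adj x) v = 0") (simp_all add: power2_eq_square)
qed simp

text \<open>Solving \<open>(r - a) u = v\<close> is a fixed point problem for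
  \<open>u \<mapsto> (v + a u) / r\<close>, a contraction with factor
  \<open>norm a / r\<close>.\<close>

lemma bop_inverse:
  fixes a :: "'a::complex_hilbert bop"
  assumes a: "norm a < r"
  shows "\<exists>y. y * (complex_of_real r *\<^sub>C 1 - a) = 1 \<and> (complex_of_real r *\<^sub>C 1 - a) * y = 1"
proof -
  have r: "0 < r" using norm_ge_zero [of a] a by linarith
  define T where "T = complex_of_real r *\<^sub>C 1 - a"
  have T: "bop_apply T u = r *\<^sub>R u - bop_apply a u" for u
    by (simp add: T_def minus_bop.rep_eq scaleC_bop.rep_eq one_bop.rep_eq scaleR_bop.rep_eq scaleC_of_real)
  have ex: "\<exists>!u. bop_apply T u = v" for v
  proof -
    define g where "g u = (1 / r) *\<^sub>R (v + bop_apply a u)" for u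
    have "\<exists>!u. g u = u"
    proof (rule banach_fix_type)
      show "norm a / r < 1" using a r by simp
      show "\<forall>x y. dist (g x) (g y) \<le> norm a / r * dist x y"
      proof (intro allI)
        fix x y
        have "g x - g y = (1 / r) *\<^sub>R bop_apply a (x - y)"
          by (simp add: g_def bop_linear_simps algebra_simps)
        then show "dist (g x) (g y) \<le> norm a / r * dist x y"
          using bop_bound [of a "x - y"] r by (simp add: dist_norm divide_right_mono)
      qed
    qed (use r in auto)
    moreover have "g u = u \<longleftrightarrow> bop_apply T u = v" for u
    proof -
      have "g u = u \<longleftrightarrow> r *\<^sub>R g u = r *\<^sub>R u" using r by simp
      also have "\<dots> \<longleftrightarrow> v + bop_apply a u = r *\<^sub>R u" using r by (simp add: g_def)
      finally show ?thesis by (auto simp: T algebra_simps)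
    qed
    ultimately show ?thesis by simp
  qed
  define f where "f v = (THE u. bop_apply T u = v)" for v
  have f: "bop_apply T (f v) = v" for v
    unfolding f_def by (rule theI' [OF ex])
  have f': "f v = u" if "bop_apply T u = v" for u v
    using ex [of v] f [of v] that by blast
  have B: "bop_apply (Bop f) = f"
  proof (rule Bop_apply)
    show "f (v + w) = f v + f w" for v w by (rule f') (simp add: bop_linear_simps f)
    show "f (c *\<^sub>C v) = c *\<^sub>C f v" for c v by (rule f') (simp add: bop_clinear f)
    show "norm (f v) \<le> 1 / (r - norm a) * norm v" for v
    proof -
      have "r *\<^sub>R f v = v + bop_apply a (f v)" using f [of v] by (simp add: T algebra_simps)
      then have "norm (r *\<^sub>R f v) \<le> norm v + norm a * norm (f v)"
        using norm_triangle_ineq [of v "bop_apply a (f v)"] bop_bound [of a "f v"] by simp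
      then have "(r - norm a) * norm (f v) \<le> norm v" using r by (simp add: algebra_simps)
      then show ?thesis using a by (simp add: field_simps)
    qed
  qed
  have "Bop f * T = 1" "T * Bop f = 1"
    by (auto intro!: bop_eqI simp: times_bop.rep_eq one_bop.rep_eq B f f')
  then show ?thesis unfolding T_def by blast
qed

lemma von_neumann_algebra_closed:
  assumes "von_neumann_algebra N"
  shows vna_scaleC: "x \<in> N \<Longrightarrow> c *\<^sub>C x \<in> N"
    and vna_add: "x \<in> N \<Longrightarrow> y \<in> N \<Longrightarrow> x + y \<in> N"
    and vna_diff: "x \<in> N \<Longrightarrow> y \<in> N \<Longrightarrow> x - y \<in> N"
    and vna_mult: "x \<in> N \<Longrightarrow> y \<in> N \<Longrightarrow> x * y \<in> N"
    and vna_zero: "0 \<in> N" and vna_one: "1 \<in> N"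
    and vna_adj: "x \<in> N \<Longrightarrow> adj x \<in> N"
    and vna_sum: "(\<And>i. i \<in> I \<Longrightarrow> f i \<in> N) \<Longrightarrow> (\<Sum>i\<in>I. f i) \<in> N"
  using commutant_closed [of _ "commutant N"] commutant_basics [of "commutant N"]
    commutant_sum [of I f "commutant N"] assms
  by (simp_all add: von_neumann_algebra_def)

lemma vna_inverse:
  "von_neumann_algebra N \<Longrightarrow> x \<in> N \<Longrightarrow> x * y = 1 \<Longrightarrow> y * x = 1 \<Longrightarrow> y \<in> N"
  using commutant_inverse [of x "commutant N" y] by (simp add: von_neumann_algebra_def)

lemma star_automorphism_one:
  assumes N: "von_neumann_algebra N" and \<theta>: "star_automorphism N \<theta>"
  shows "\<theta> 1 = 1"
proof -
  obtain y where y: "y \<in> N" "\<theta> y = 1"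
    using \<theta> vna_one [OF N] by (metis bij_betw_def image_iff star_automorphism_def)
  then have "\<theta> (1 * y) = \<theta> 1 * \<theta> y" using \<theta> vna_one [OF N] unfolding star_automorphism_def by blast
  then show ?thesis using y by simp
qed

text \<open>If \<open>\<parallel>\<theta>(x)\<parallel> > \<parallel>x\<parallel>\<close>, then \<open>\<parallel>\<theta>(x)\<parallel>\<^sup>2 - x\<^sup>*x\<close> is invertible, hence so is
  \<open>\<parallel>c\<parallel>\<^sup>2 - c\<^sup>*c\<close> for \<open>c = \<theta>(x)\<close>; but \<open>\<parallel>c\<parallel>\<^sup>2\<close> is an approximate eigenvalue of \<open>c\<^sup>*c\<close>.\<close>

lemma star_automorphism_norm_le:
  assumes N: "von_neumann_algebra N" and \<theta>: "star_automorphism N \<theta>" and x: "x \<in> N"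
  shows "norm (\<theta> x) \<le> norm x"
proof (rule ccontr)
  assume "\<not> ?thesis"
  then have lt: "norm x < norm (\<theta> x)" by simp
  define c where "c = \<theta> x"
  define r where "r = (norm c)\<^sup>2"
  have c0: "0 < norm c" using lt norm_ge_zero [of x] unfolding c_def by linarith
  then have r: "0 < r" by (simp add: r_def)
  define a where "a = adj x * x"
  have aN: "a \<in> N" unfolding a_def by (intro vna_mult vna_adj N x)
  have "norm a \<le> norm x * norm x"
    unfolding a_def by (rule order_trans [OF norm_mult_ineq mult_right_mono [OF norm_adj_le norm_ge_zero]])
  also have "\<dots> < r" unfolding r_def power2_eq_square
    using lt c_def by (intro mult_strict_mono') auto
  finally obtain y where y: "y * (complex_of_real r *\<^sub>C 1 - a) = 1" "(complex_of_real r *\<^sub>C 1 - a) * y = 1"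
    using bop_inverse by blast
  have rN: "complex_of_real r *\<^sub>C 1 \<in> N" by (intro vna_scaleC vna_one N)
  have rd: "complex_of_real r *\<^sub>C 1 - a \<in> N"
    by (intro vna_diff vna_scaleC vna_one N aN)
  \<comment> \<open>The inverse stays in the algebra, so \<open>\<theta>\<close> can be applied to
    it.\<close>
  have yN: "y \<in> N" by (rule vna_inverse [OF N rd y(2,1)])
  have ad: "adj x \<in> N" by (intro vna_adj N x)
  note th = \<theta> [unfolded star_automorphism_def]
  have "\<theta> ((complex_of_real r *\<^sub>C 1 - a) + a) = \<theta> (complex_of_real r *\<^sub>C 1 - a) + \<theta> a"
    using th rd aN by blast
  moreover have "\<theta> a = adj c * c" unfolding a_def c_def using th x ad by metis
  moreover have "\<theta> (complex_of_real r *\<^sub>C 1) = complex_of_real r *\<^sub>C 1"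
    using th vna_one [OF N] star_automorphism_one [OF N \<theta>] by metis
  ultimately have t: "\<theta> (complex_of_real r *\<^sub>C 1 - a) = complex_of_real r *\<^sub>C 1 - adj c * c"
    by (simp add: algebra_simps)
  have "\<theta> (y * (complex_of_real r *\<^sub>C 1 - a)) = \<theta> y * \<theta> (complex_of_real r *\<^sub>C 1 - a)"
    using th yN rd by blast
  then have z: "\<theta> y * (complex_of_real r *\<^sub>C 1 - adj c * c) = 1"
    by (simp add: t y star_automorphism_one [OF N \<theta>])
  define K where "K = norm (\<theta> y)"
  define d where "d v = r *\<^sub>R v - bop_apply (adj c) (bop_apply c v)" for v
  have "bop_apply (\<theta> y) (d v) = bop_apply (\<theta> y * (complex_of_real r *\<^sub>C 1 - adj c * c)) v" for v
    by (simp add: d_def times_bop.rep_eq minus_bop.rep_eq scaleC_bop.rep_eq one_bop.rep_eq scaleR_bop.rep_eq scaleC_of_real)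
  then have zd: "bop_apply (\<theta> y) (d v) = v" for v by (simp add: z one_bop.rep_eq)
  \<comment> \<open>\<open>\<theta> y\<close> inverts \<open>d\<close> from the left, so
    \<open>norm v \<le> K * norm (d v)\<close>; the rest is the expansion of
    \<open>norm (d v)\<close> with \<open>norm (adj c) \<le> norm c\<close>.\<close>
  have main: "(norm v)\<^sup>2 \<le> K\<^sup>2 * r * (r * (norm v)\<^sup>2 - (norm (bop_apply c v))\<^sup>2)" for v
  proof -
    have "inner v (bop_apply (adj c) (bop_apply c v)) = (norm (bop_apply c v))\<^sup>2"
      using cinner_self [of "bop_apply c v"] by (simp add: cinner_adj' flip: Re_cinner)
    then have "(norm (d v))\<^sup>2 = r\<^sup>2 * (norm v)\<^sup>2 - 2 * r * (norm (bop_apply c v))\<^sup>2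
        + (norm (bop_apply (adj c) (bop_apply c v)))\<^sup>2"
      unfolding d_def power2_norm_eq_inner inner_diff_left inner_diff_right
      by (simp add: inner_commute power2_eq_square)
    also have "(norm (bop_apply (adj c) (bop_apply c v)))\<^sup>2 \<le> (norm c * norm (bop_apply c v))\<^sup>2"
      by (intro power_mono order_trans [OF bop_bound mult_right_mono [OF norm_adj_le]]) auto
    also have "\<dots> = r * (norm (bop_apply c v))\<^sup>2" by (simp add: r_def power_mult_distrib)
    finally have dv: "(norm (d v))\<^sup>2 \<le> r * (r * (norm v)\<^sup>2 - (norm (bop_apply c v))\<^sup>2)"
      by (simp add: algebra_simps power2_eq_square)
    have "norm v \<le> K * norm (d v)" using bop_bound [of "\<theta> y" "d v"] by (simp add: zd K_def)
    then have "(norm v)\<^sup>2 \<le> (K * norm (d v))\<^sup>2" by (intro power_mono) auto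
    also have "\<dots> = K\<^sup>2 * (norm (d v))\<^sup>2" by (simp add: power_mult_distrib)
    also have "\<dots> \<le> K\<^sup>2 * (r * (r * (norm v)\<^sup>2 - (norm (bop_apply c v))\<^sup>2))"
      by (intro mult_left_mono dv) simp
    finally show ?thesis by (simp add: mult.assoc)
  qed
  have "\<exists>v. bop_apply c v \<noteq> 0"
    using c0 bop_eqI [of c 0] by (auto simp: zero_bop.rep_eq)
  then obtain v where v: "bop_apply c v \<noteq> 0" by blast
  then have v0: "v \<noteq> 0" by (auto simp: bop_linear_simps)
  have K: "0 < K"
  proof (rule ccontr)
    assume "\<not> 0 < K"
    then have "K = 0" using norm_ge_zero [of "\<theta> y"] unfolding K_def by linarith
    then show False using main [of v] v0 by simp
  qed
  \<comment> \<open>\<open>main\<close> solved for \<open>norm (bop_apply c v)\<close>. It will give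
    \<open>norm c \<le> sqrt q\<close>, although \<open>q\<close> is strictly below
    \<open>r\<close>, the square of \<open>norm c\<close>.\<close>
  define q where "q = r - 1 / (K\<^sup>2 * r)"
  have kr: "0 < K\<^sup>2 * r" using K r by simp
  have le: "(norm (bop_apply c v))\<^sup>2 \<le> q * (norm v)\<^sup>2" for v
  proof -
    have "(norm v)\<^sup>2 / (K\<^sup>2 * r) \<le> r * (norm v)\<^sup>2 - (norm (bop_apply c v))\<^sup>2"
      using main [of v] kr by (simp add: divide_le_eq mult.commute)
    then show ?thesis by (simp add: q_def algebra_simps)
  qed
  have q0: "0 \<le> q"
  proof -
    have "0 \<le> q * (norm v)\<^sup>2" by (rule order_trans [OF zero_le_power2 le])
    then show ?thesis using v0 by (simp add: zero_le_mult_iff)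
  qed
  have "norm c \<le> sqrt q"
  proof (rule bop_norm_le)
    fix v
    show "norm (bop_apply c v) \<le> sqrt q * norm v"
      by (rule power2_le_imp_le) (use le [of v] q0 in \<open>simp_all add: power_mult_distrib\<close>)
  qed (use q0 in simp)
  then have "(norm c)\<^sup>2 \<le> (sqrt q)\<^sup>2" by (intro power_mono) auto
  then have "r \<le> q" using q0 by (simp add: r_def)
  then show False using kr by (simp add: q_def)
qed

section \<open>Positive definite forms\<close>

text \<open>Serves both \<open>cinner\<close> on the whole space and
  \<open>trace_inner \<tau>\<close> on \<open>N\<close>. The carrier is a parameter because the
  latter is controlled only on \<open>N\<close>, and completeness is left out because
  \<open>N\<close> need not be complete in the 2-norm.\<close>

locale positive_definite_form =
  fixes V :: "'v::complex_vector set" and B :: "'v \<Rightarrow> 'v \<Rightarrow> complex"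
  assumes V: "csubspace V"
    and add_left: "x \<in> V \<Longrightarrow> y \<in> V \<Longrightarrow> z \<in> V \<Longrightarrow> B (x + y) z = B x z + B y z"
    and scaleC_left: "x \<in> V \<Longrightarrow> y \<in> V \<Longrightarrow> B (c *\<^sub>C x) y = c * B x y"
    and herm: "x \<in> V \<Longrightarrow> y \<in> V \<Longrightarrow> B x y = cnj (B y x)"
    and nonneg: "x \<in> V \<Longrightarrow> 0 \<le> Re (B x x)"
    and definite: "x \<in> V \<Longrightarrow> B x x = 0 \<Longrightarrow> x = 0"
begin

lemmas closed_V = complex_vector.subspace_add [OF V] complex_vector.subspace_scale [OF V]
  complex_vector.subspace_0 [OF V] complex_vector.subspace_diff [OF V] complex_vector.subspace_sum [OF V]

lemma zero_left: "y \<in> V \<Longrightarrow> B 0 y = 0"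
  using scaleC_left [of 0 y 0] closed_V by simp

lemma diff_left: "x \<in> V \<Longrightarrow> y \<in> V \<Longrightarrow> z \<in> V \<Longrightarrow> B (x - y) z = B x z - B y z"
  using add_left [of "x - y" y z] closed_V by simp

lemma add_right: "x \<in> V \<Longrightarrow> y \<in> V \<Longrightarrow> z \<in> V \<Longrightarrow> B z (x + y) = B z x + B z y"
  using herm [of z "x + y"] herm [of z x] herm [of z y] add_left [of x y z] closed_V by simp

lemma scaleC_right: "x \<in> V \<Longrightarrow> y \<in> V \<Longrightarrow> B x (c *\<^sub>C y) = cnj c * B x y"
  using herm [of x "c *\<^sub>C y"] herm [of x y] scaleC_left [of y x c] closed_V by simp

lemma diff_right: "x \<in> V \<Longrightarrow> y \<in> V \<Longrightarrow> z \<in> V \<Longrightarrow> B z (x - y) = B z x - B z y"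
  using add_right [of "x - y" y z] closed_V by simp

lemma sum_left: "(\<And>i. i \<in> I \<Longrightarrow> f i \<in> V) \<Longrightarrow> y \<in> V \<Longrightarrow> B (\<Sum>i\<in>I. f i) y = (\<Sum>i\<in>I. B (f i) y)"
  by (induction I rule: infinite_finite_induct) (simp_all add: zero_left add_left closed_V)

lemma self_real: "x \<in> V \<Longrightarrow> B x x = complex_of_real (Re (B x x))"
  using herm [of x x] by (simp add: complex_eq_iff)

definition nrm :: "'v \<Rightarrow> real" where
  "nrm x = sqrt (Re (B x x))"

lemma nrm_square: "x \<in> V \<Longrightarrow> (nrm x)\<^sup>2 = Re (B x x)"
  by (simp add: nrm_def nonneg)

lemma nrm_nonneg: "x \<in> V \<Longrightarrow> 0 \<le> nrm x"
  by (simp add: nrm_def nonneg)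

lemma nrm_eq_0: "x \<in> V \<Longrightarrow> nrm x = 0 \<longleftrightarrow> x = 0"
  using definite [of x] self_real [of x] by (auto simp: nrm_def zero_left)

lemma nrm_commute: "x \<in> V \<Longrightarrow> y \<in> V \<Longrightarrow> nrm (x - y) = nrm (y - x)"
  by (simp add: nrm_def diff_left diff_right closed_V)

lemma Cauchy_Schwarz:
  assumes x: "x \<in> V" and y: "y \<in> V"
  shows "Re (B x y) \<le> nrm x * nrm y"
proof (cases "y = 0")
  case True
  then show ?thesis using herm [OF x y] by (simp add: zero_left x nrm_def closed_V)
next
  case False
  define b where "b = Re (B x y)"
  define n where "n = Re (B y y)"
  have n: "0 < n" using nonneg [OF y] nrm_eq_0 [OF y] False by (auto simp: n_def nrm_def less_le)
  \<comment> \<open>The real multiple of \<open>y\<close> closest to \<open>x\<close>: the form at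
    \<open>x - t *\<^sub>C y\<close> has real part
    \<open>Re (B x x) - b\<^sup>2 / n\<close>.\<close>
  define t where "t = complex_of_real (b / n)"
  have ty: "t *\<^sub>C y \<in> V" by (intro closed_V y)
  have "Re (B y x) = b" using herm [OF x y] by (simp add: b_def)
  then have "Re (B (x - t *\<^sub>C y) (x - t *\<^sub>C y)) = Re (B x x) - b\<^sup>2 / n"
    using n x y ty by (simp add: diff_left diff_right closed_V scaleC_left scaleC_right t_def
        power2_eq_square flip: n_def b_def)
  then have "b\<^sup>2 / n \<le> Re (B x x)" using nonneg [of "x - t *\<^sub>C y"] x ty by (simp add: closed_V)
  then have "b\<^sup>2 \<le> (nrm x * nrm y)\<^sup>2"
    using n by (simp add: power_mult_distrib nrm_square x y divide_le_eq flip: n_def)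
  then have "b \<le> nrm x * nrm y"
    by (rule power2_le_imp_le) (simp add: nrm_nonneg x y)
  then show ?thesis by (simp add: b_def)
qed

lemma nrm_triangle:
  assumes x: "x \<in> V" and y: "y \<in> V"
  shows "nrm (x + y) \<le> nrm x + nrm y"
proof (rule power2_le_imp_le)
  have "Re (B y x) = Re (B x y)" using herm [OF x y] by simp
  then have "(nrm (x + y))\<^sup>2 = (nrm x)\<^sup>2 + 2 * Re (B x y) + (nrm y)\<^sup>2"
    using x y by (simp add: nrm_square add_left add_right closed_V)
  then show "(nrm (x + y))\<^sup>2 \<le> (nrm x + nrm y)\<^sup>2"
    using Cauchy_Schwarz [OF x y] by (simp add: power2_sum)
qed (simp add: nrm_nonneg x y)

definition orthonormal :: "nat \<Rightarrow> (nat \<Rightarrow> 'v) \<Rightarrow> bool" where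
  "orthonormal n e \<longleftrightarrow> (\<forall>i<n. e i \<in> V) \<and> (\<forall>i<n. \<forall>j<n. B (e i) (e j) = (if i = j then 1 else 0))"

lemma B_combination:
  assumes "orthonormal n e" "j < n"
  shows "B (\<Sum>i<n. c i *\<^sub>C e i) (e j) = c j"
proof -
  have "B (\<Sum>i<n. c i *\<^sub>C e i) (e j) = (\<Sum>i<n. c i * (if i = j then 1 else 0))"
    using assms by (subst sum_left) (auto simp: orthonormal_def scaleC_left closed_V intro!: sum.cong)
  then show ?thesis using assms(2) by (simp add: if_distrib [of "(*) _"] cong: if_cong)
qed

lemma orthonormal_expansion:
  assumes e: "orthonormal n e" and x: "x \<in> cspan (e ` {..<n})"
  shows "x = (\<Sum>i<n. B x (e i) *\<^sub>C e i)"
  using x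
proof (induction rule: complex_vector.span_induct_alt)
  case base
  then show ?case using e by (simp add: orthonormal_def zero_left)
next
  case (step c y z)
  then obtain j where j: "j < n" "y = e j" by auto
  have sub: "cspan (e ` {..<n}) \<subseteq> V"
    using e by (intro complex_vector.span_minimal V) (auto simp: orthonormal_def)
  have zV: "(\<Sum>i<n. B z (e i) *\<^sub>C e i) \<in> V"
    using e by (intro closed_V) (auto simp: orthonormal_def)
  have "B (c *\<^sub>C y + z) (e i) = c * (if i = j then 1 else 0) + B z (e i)" if "i < n" for i
    using e j that step(2) zV by (subst add_left) (auto simp: orthonormal_def scaleC_left closed_V)
  then have "(\<Sum>i<n. B (c *\<^sub>C y + z) (e i) *\<^sub>C e i)
      = (\<Sum>i<n. (c * (if i = j then 1 else 0)) *\<^sub>C e i) + (\<Sum>i<n. B z (e i) *\<^sub>C e i)"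
    by (simp add: scaleC_add_left sum.distrib)
  also have "(\<Sum>i<n. (c * (if i = j then 1 else 0)) *\<^sub>C e i) = (\<Sum>i<n. if i = j then c *\<^sub>C e i else 0)"
    by (intro sum.cong) auto
  also have "\<dots> = c *\<^sub>C y" using j by simp
  finally show ?case using step(2) by simp
qed

text \<open>Ties the length of an orthonormal family to \<open>cdim\<close>, the number of basis
  vectors that the theorem prescribes. Independence follows by pairing a linear relation with each
  \<open>e j\<close>.\<close>

lemma orthonormal_dim:
  assumes e: "orthonormal n e"
  shows "cdim (cspan (e ` {..<n})) = n"
proof -
  have inj: "inj_on e {..<n}"
  proof (rule inj_onI)
    fix i j assume "i \<in> {..<n}" "j \<in> {..<n}" "e i = e j"
    then have "B (e i) (e i) = B (e i) (e j)" "i < n" "j < n" by auto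
    then show "i = j" using e by (auto simp: orthonormal_def split: if_splits)
  qed
  have "\<not> complex_vector.dependent (e ` {..<n})"
  proof
    assume "complex_vector.dependent (e ` {..<n})"
    then obtain u where u: "\<exists>v\<in>e ` {..<n}. u v \<noteq> 0" "(\<Sum>v\<in>e ` {..<n}. u v *\<^sub>C v) = 0"
      using complex_vector.dependent_finite [of "e ` {..<n}"] by auto
    from u(2) have "(\<Sum>i<n. u (e i) *\<^sub>C e i) = 0" by (simp add: sum.reindex [OF inj])
    then have "u (e j) = 0" if "j < n" for j
      using B_combination [OF e that, of "\<lambda>i. u (e i)"] e that by (simp add: orthonormal_def zero_left)
    with u(1) show False by auto
  qed
  then have "cdim (cspan (e ` {..<n})) = card (e ` {..<n})"
    by (rule complex_vector.dim_span_eq_card_independent)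
  then show ?thesis by (simp add: card_image [OF inj])
qed

text \<open>Gram-Schmidt. A vector that equals its projection onto the span of the earlier ones is
  dropped, so \<open>n\<close> can be smaller than \<open>card F\<close>.\<close>

lemma orthonormal_exists:
  assumes "finite F" "F \<subseteq> V"
  shows "\<exists>n e. orthonormal n e \<and> cspan (e ` {..<n}) = cspan F"
  using assms
proof (induction F)
  case empty
  show ?case by (rule exI [of _ 0]) (simp add: orthonormal_def)
next
  case (insert a F)
  then obtain n e where e: "orthonormal n e" and sp: "cspan (e ` {..<n}) = cspan F" by auto
  have aV: "a \<in> V" using insert by simp
  define s where "s = (\<Sum>i<n. B a (e i) *\<^sub>C e i)"
  have sV: "s \<in> V" unfolding s_def using e by (intro closed_V) (auto simp: orthonormal_def)
  have ss: "s \<in> cspan F" unfolding s_def sp [symmetric]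
    by (intro complex_vector.span_sum complex_vector.span_scale complex_vector.span_base) auto
  have rV: "a - s \<in> V" by (intro closed_V aV sV)
  have ro: "B (a - s) (e j) = 0" if "j < n" for j
    using that e B_combination [OF e that, of "\<lambda>i. B a (e i)"]
    by (simp add: diff_left aV sV orthonormal_def flip: s_def)
  show ?case
  proof (cases "a = s")
    case True
    then have "cspan (insert a F) = cspan F" using ss by (simp add: complex_vector.span_redundant)
    then show ?thesis using e sp by blast
  next
    case False
    define m where "m = nrm (a - s)"
    have m: "0 < m" using nrm_nonneg [OF rV] nrm_eq_0 [OF rV] False by (simp add: m_def less_le)
    define f where "f = complex_of_real (1 / m) *\<^sub>C (a - s)"
    have fV: "f \<in> V" unfolding f_def by (intro closed_V rV)
    have ff: "B f f = 1"
    proof -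
      have "B f f = complex_of_real (1 / m) * (complex_of_real (1 / m) * B (a - s) (a - s))"
        unfolding f_def using rV by (simp add: scaleC_left scaleC_right closed_V)
      also have "B (a - s) (a - s) = complex_of_real (m\<^sup>2)"
        using self_real [OF rV] by (simp add: m_def nrm_square [OF rV])
      finally show ?thesis using m by (simp add: power2_eq_square)
    qed
    have fe: "B f (e j) = 0" "B (e j) f = 0" if "j < n" for j
    proof -
      have "e j \<in> V" using e that by (simp add: orthonormal_def)
      then show "B f (e j) = 0" using ro [OF that] rV by (simp add: f_def scaleC_left)
      then show "B (e j) f = 0" using herm [OF \<open>e j \<in> V\<close> fV] by simp
    qed
    define e' where "e' = e(n := f)"
    have "orthonormal (Suc n) e'"
      using e fV ff fe by (auto simp: orthonormal_def e'_def less_Suc_eq)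
    moreover have "cspan (e' ` {..<Suc n}) = cspan (insert a F)"
    proof -
      have "e' ` {..<Suc n} = insert f (e ` {..<n})"
        by (auto simp: e'_def lessThan_Suc)
      then have "cspan (e' ` {..<Suc n}) = cspan (insert f F)"
        by (simp add: complex_vector.span_insert sp)
      also have "\<dots> = cspan (insert a F)"
      proof (rule complex_vector.span_eq [THEN iffD2], intro conjI insert_subsetI)
        show "f \<in> cspan (insert a F)"
          unfolding f_def using ss complex_vector.span_mono [of F "insert a F"]
          by (auto intro!: complex_vector.span_scale complex_vector.span_diff intro: complex_vector.span_base)
        have "a = complex_of_real m *\<^sub>C f + s"
          using m by (simp add: f_def scaleC_scaleC)
        moreover have "\<dots> \<in> cspan (insert f F)"
          using ss complex_vector.span_mono [of F "insert f F"]
          by (auto intro!: complex_vector.span_scale complex_vector.span_add intro: complex_vector.span_base)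
        ultimately show "a \<in> cspan (insert f F)" by simp
      qed (auto intro: complex_vector.span_base)
      finally show ?thesis .
    qed
    ultimately show ?thesis by blast
  qed
qed

lemma zero_right: "y \<in> V \<Longrightarrow> B y 0 = 0"
  using scaleC_right [of y 0 0] closed_V(3) by simp

lemma sum_right: "(\<And>i. i \<in> I \<Longrightarrow> f i \<in> V) \<Longrightarrow> y \<in> V \<Longrightarrow> B y (\<Sum>i\<in>I. f i) = (\<Sum>i\<in>I. B y (f i))"
  by (induction I rule: infinite_finite_induct) (simp_all add: add_right closed_V zero_right)

definition proj :: "nat \<Rightarrow> (nat \<Rightarrow> 'v) \<Rightarrow> 'v \<Rightarrow> 'v" where
  "proj n e x = (\<Sum>i<n. B x (e i) *\<^sub>C e i)"

lemma proj_in_span: "proj n e x \<in> cspan (e ` {..<n})"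
  unfolding proj_def by (intro complex_vector.span_sum complex_vector.span_scale complex_vector.span_base) auto

lemma orthonormal_span_subset: "orthonormal n e \<Longrightarrow> cspan (e ` {..<n}) \<subseteq> V"
  by (intro complex_vector.span_minimal V) (auto simp: orthonormal_def)

lemma proj_orthogonal:
  assumes e: "orthonormal n e" and x: "x \<in> V" and y: "y \<in> cspan (e ` {..<n})"
  shows "B (x - proj n e x) y = 0"
proof -
  have pV: "proj n e x \<in> V" using proj_in_span orthonormal_span_subset [OF e] by blast
  have eV: "e i \<in> V" if "i < n" for i using e that by (simp add: orthonormal_def)
  have "B (x - proj n e x) (e i) = 0" if "i < n" for i
    using B_combination [OF e that, of "\<lambda>i. B x (e i)"] x pV eV [OF that]
    by (simp add: diff_left flip: proj_def)
  then have "B (x - proj n e x) (\<Sum>i<n. B y (e i) *\<^sub>C e i) = 0"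
    using x pV eV by (subst sum_right) (auto simp: closed_V scaleC_right)
  then show ?thesis using orthonormal_expansion [OF e y] by simp
qed

text \<open>Serves to show that the projection onto an invariant subspace commutes with the
  action.\<close>

lemma proj_eqI:
  assumes e: "orthonormal n e" and x: "x \<in> V" and q: "q \<in> cspan (e ` {..<n})"
    and orth: "\<And>i. i < n \<Longrightarrow> B (x - q) (e i) = 0"
  shows "proj n e x = q"
proof -
  have "q \<in> V" using q orthonormal_span_subset [OF e] by blast
  then have "B x (e i) = B q (e i)" if "i < n" for i
    using orth [OF that] e that x by (simp add: diff_left orthonormal_def)
  then have "proj n e x = (\<Sum>i<n. B q (e i) *\<^sub>C e i)" by (simp add: proj_def)
  then show ?thesis using orthonormal_expansion [OF e q] by simp
qed

lemma orthonormal_basis_exists: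
  assumes U: "csubspace U" "U \<subseteq> V" "finite_cdim U"
  shows "\<exists>e. orthonormal (cdim U) e \<and> cspan (e ` {..<cdim U}) = U"
proof -
  obtain F where F: "F \<subseteq> U" "\<not> complex_vector.dependent F" "U \<subseteq> cspan F"
    by (rule complex_vector.basis_exists [of U])
  obtain D where "finite D" "U \<subseteq> cspan D" using U(3) by (auto simp: finite_cdim_def)
  then have "finite F"
    using complex_vector.independent_span_bound [of D F] F(1,2) by auto
  from orthonormal_exists [OF this order_trans [OF F(1) U(2)]] obtain n e
    where e: "orthonormal n e" "cspan (e ` {..<n}) = cspan F" by blast
  have "cspan F = U"
    by (rule equalityI [OF complex_vector.span_minimal [OF F(1) U(1)] F(3)])
  then have sp: "cspan (e ` {..<n}) = U" using e(2) by simp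
  then have "cdim U = n" using orthonormal_dim [OF e(1)] by simp
  then show ?thesis using e(1) sp by blast
qed

end

global_interpretation cinner: positive_definite_form "UNIV :: 'a::complex_hilbert set" cinner
proof
  show "cinner x y = cnj (cinner y x)" for x y :: 'a by (rule cinner_commute)
qed (simp_all add: cinner_add_left cinner_scaleC_left cinner_self complex_vector.subspace_UNIV)

section \<open>Matrices of operators on \<open>\<ell>\<^sup>2(I, H)\<close>\<close>

lemma has_sum_sum:
  fixes f :: "'i \<Rightarrow> 'x \<Rightarrow> 'v::topological_comm_monoid_add"
  shows "(\<And>i. i \<in> I \<Longrightarrow> (f i has_sum s i) A) \<Longrightarrow> ((\<lambda>x. \<Sum>i\<in>I. f i x) has_sum (\<Sum>i\<in>I. s i)) A"
  by (induction I rule: infinite_finite_induct) (simp_all add: has_sum_add has_sum_0)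

lemma ell2_apply_sum: "ell2_apply (\<Sum>i\<in>I. f i) h = (\<Sum>i\<in>I. ell2_apply (f i) h)"
  by (induction I rule: infinite_finite_induct) (simp_all add: zero_ell2.rep_eq plus_ell2.rep_eq)

text \<open>By Pythagoras the squared distance from a finite partial sum to \<open>\<zeta>\<close>
  is the squared norm minus the partial sum of the squared coordinates.\<close>

lemma has_sum_delta: "((\<lambda>k. delta k (ell2_apply \<zeta> k)) has_sum \<zeta>) UNIV"
proof -
  let ?n = "\<lambda>h. (norm (ell2_apply \<zeta> h))\<^sup>2"
  have eq: "(norm ((\<Sum>k\<in>F. delta k (ell2_apply \<zeta> k)) - \<zeta>))\<^sup>2 = (norm \<zeta>)\<^sup>2 - (\<Sum>h\<in>F. ?n h)"
    if F: "finite F" for F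
  proof -
    have "ell2_apply (\<Sum>k\<in>F. delta k (ell2_apply \<zeta> k)) h = (if h \<in> F then ell2_apply \<zeta> h else 0)" for h
      using F by (simp add: ell2_apply_sum delta.rep_eq)
    then have "(norm ((\<Sum>k\<in>F. delta k (ell2_apply \<zeta> k)) - \<zeta>))\<^sup>2 = (\<Sum>\<^sub>\<infinity>h. if h \<in> F then 0 else ?n h)"
      unfolding norm_ell2_power2 by (intro infsum_cong) (simp add: minus_ell2.rep_eq)
    also have "\<dots> = (\<Sum>\<^sub>\<infinity>h\<in>UNIV - F. ?n h)"
      by (rule infsum_cong_neutral) auto
    also have "\<dots> = (norm \<zeta>)\<^sup>2 - (\<Sum>h\<in>F. ?n h)"
      unfolding norm_ell2_power2
      using infsum_Diff [OF ell2_summable [of \<zeta>], of F] F by (simp add: ell2_summable)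
    finally show ?thesis .
  qed
  have "((\<lambda>F. (norm \<zeta>)\<^sup>2 - (\<Sum>h\<in>F. ?n h)) \<longlongrightarrow> (norm \<zeta>)\<^sup>2 - (norm \<zeta>)\<^sup>2) (finite_subsets_at_top UNIV)"
    using has_sum_infsum [OF ell2_summable, of \<zeta>] unfolding norm_ell2_power2 has_sum_def
    by (intro tendsto_intros)
  then have "((\<lambda>F. (norm ((\<Sum>k\<in>F. delta k (ell2_apply \<zeta> k)) - \<zeta>))\<^sup>2) \<longlongrightarrow> 0) (finite_subsets_at_top UNIV)"
    unfolding diff_self
    by (rule Lim_transform_eventually) (rule eventually_finite_subsets_at_top_weakI, simp only: eq)
  from tendsto_real_sqrt [OF this]
  have "((\<lambda>F. norm ((\<Sum>k\<in>F. delta k (ell2_apply \<zeta> k)) - \<zeta>)) \<longlongrightarrow> 0) (finite_subsets_at_top UNIV)"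
    by simp
  then show ?thesis unfolding has_sum_def
    by (simp add: LIM_zero_iff tendsto_norm_zero_iff)
qed

lemma has_sum_entry:
  "((\<lambda>k. bop_apply (entry x h k) (ell2_apply \<zeta> k)) has_sum ell2_apply (bop_apply x \<zeta>) h) UNIV"
proof -
  have "bounded_linear (\<lambda>\<zeta>. ell2_apply (bop_apply x \<zeta>) h)"
    by (rule bounded_linear_intro [of _ "norm x"])
      (simp_all add: bop_linear_simps plus_ell2.rep_eq scaleR_ell2.rep_eq mult.commute
        order_trans [OF norm_ell2_apply_le bop_bound])
  from has_sum_bounded_linear [OF this has_sum_delta, of \<zeta>]
  show ?thesis by (simp add: entry_apply o_def)
qed

text \<open>Reduced to scalars by expanding the \<open>\<zeta> k\<close> in an orthonormal basis of their span.\<close>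

lemma scalar_matrix_vector_bound:
  fixes t :: "'i \<Rightarrow> 'j \<Rightarrow> complex" and \<zeta> :: "'j \<Rightarrow> 'a::complex_hilbert"
  assumes bd: "\<And>a. (\<Sum>h\<in>F. (cmod (\<Sum>k\<in>F'. t h k * a k))\<^sup>2) \<le> C * (\<Sum>k\<in>F'. (cmod (a k))\<^sup>2)"
    and F': "finite F'"
  shows "(\<Sum>h\<in>F. (norm (\<Sum>k\<in>F'. t h k *\<^sub>C \<zeta> k))\<^sup>2) \<le> C * (\<Sum>k\<in>F'. (norm (\<zeta> k))\<^sup>2)"
proof -
  have "finite (\<zeta> ` F')" using F' by simp
  from cinner.orthonormal_exists [OF this] obtain n e
    where e: "cinner.orthonormal n e" "cspan (e ` {..<n}) = cspan (\<zeta> ` F')" by auto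
  have parseval: "(norm v)\<^sup>2 = (\<Sum>i<n. (cmod (cinner v (e i)))\<^sup>2)" if "v \<in> cspan (e ` {..<n})" for v
  proof -
    have "cinner v v = cinner (\<Sum>i<n. cinner v (e i) *\<^sub>C e i) v"
      using cinner.orthonormal_expansion [OF e(1) that] by simp
    also have "\<dots> = (\<Sum>i<n. cinner v (e i) * cinner (e i) v)"
      by (simp only: cinner_sum_left cinner_scaleC_left)
    also have "\<dots> = (\<Sum>i<n. complex_of_real ((cmod (cinner v (e i)))\<^sup>2))"
      unfolding complex_norm_square by (simp only: cinner_commute [of v] complex_cnj_cnj)
    finally show ?thesis unfolding cinner_self of_real_sum [symmetric] of_real_eq_iff .
  qed
  have z: "\<zeta> k \<in> cspan (e ` {..<n})" if "k \<in> F'" for k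
    unfolding e(2) using that by (intro complex_vector.span_base) auto
  have "(\<Sum>h\<in>F. (norm (\<Sum>k\<in>F'. t h k *\<^sub>C \<zeta> k))\<^sup>2)
      = (\<Sum>h\<in>F. \<Sum>i<n. (cmod (\<Sum>k\<in>F'. t h k * cinner (\<zeta> k) (e i)))\<^sup>2)"
  proof (rule sum.cong [OF refl])
    fix h
    have "(\<Sum>k\<in>F'. t h k *\<^sub>C \<zeta> k) \<in> cspan (e ` {..<n})"
      by (intro complex_vector.span_sum complex_vector.span_scale z)
    from parseval [OF this]
    show "(norm (\<Sum>k\<in>F'. t h k *\<^sub>C \<zeta> k))\<^sup>2 = (\<Sum>i<n. (cmod (\<Sum>k\<in>F'. t h k * cinner (\<zeta> k) (e i)))\<^sup>2)"
      by (simp add: cinner_sum_left cinner_scaleC_left)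
  qed
  also have "\<dots> = (\<Sum>i<n. \<Sum>h\<in>F. (cmod (\<Sum>k\<in>F'. t h k * cinner (\<zeta> k) (e i)))\<^sup>2)"
    by (rule sum.swap)
  also have "\<dots> \<le> (\<Sum>i<n. C * (\<Sum>k\<in>F'. (cmod (cinner (\<zeta> k) (e i)))\<^sup>2))"
    by (intro sum_mono bd)
  also have "\<dots> = C * (\<Sum>k\<in>F'. \<Sum>i<n. (cmod (cinner (\<zeta> k) (e i)))\<^sup>2)"
    by (simp add: sum_distrib_left [symmetric] sum.swap [of _ F'])
  also have "(\<Sum>k\<in>F'. \<Sum>i<n. (cmod (cinner (\<zeta> k) (e i)))\<^sup>2) = (\<Sum>k\<in>F'. (norm (\<zeta> k))\<^sup>2)"
    by (intro sum.cong refl parseval [symmetric] z)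
  finally show ?thesis .
qed

text \<open>A uniform bound on the finite sections makes \<open>t\<close> a bounded matrix on scalar
  sequences; the operator is its tensor product with the identity of the coefficient space. This is
  how the conditional expectation of an element is produced.\<close>

lemma scalar_matrix_operator:
  fixes t :: "'i \<Rightarrow> 'i \<Rightarrow> complex"
  assumes bd: "\<And>F F' a. finite F \<Longrightarrow> finite F' \<Longrightarrow>
      (\<Sum>h\<in>F. (cmod (\<Sum>k\<in>F'. t h k * a k))\<^sup>2) \<le> C\<^sup>2 * (\<Sum>k\<in>F'. (cmod (a k))\<^sup>2)"
    and C: "0 \<le> C"
  shows "\<exists>b :: ('i, 'a::complex_hilbert) ell2 bop. \<forall>h k. entry b h k = t h k *\<^sub>C 1"
proof -
  have row: "(\<lambda>k. (norm (cmod (t h k)))\<^sup>2) summable_on UNIV" for h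
  proof (rule nonneg_bdd_above_summable_on)
    show "bdd_above (sum (\<lambda>k. (norm (cmod (t h k)))\<^sup>2) ` {F. F \<subseteq> UNIV \<and> finite F})"
    proof (rule bdd_aboveI2)
      fix F :: "'i set" assume "F \<in> {F. F \<subseteq> UNIV \<and> finite F}"
      then have F: "finite F" by simp
      define s where "s = (\<Sum>k\<in>F. (cmod (t h k))\<^sup>2)"
      have s0: "0 \<le> s" by (simp add: s_def sum_nonneg)
      \<comment> \<open>The bound is tested on the single row \<open>h\<close> with the conjugate of
        that row as vector, which gives \<open>s\<^sup>2 \<le> C\<^sup>2 * s\<close>.\<close>
      have eq: "(\<Sum>k\<in>F. t h k * cnj (t h k)) = complex_of_real s"
        by (simp add: s_def complex_norm_square [symmetric])
      then have "s\<^sup>2 \<le> C\<^sup>2 * s"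
        using bd [OF _ F, of "{h}" "\<lambda>k. cnj (t h k)"] by (simp add: eq flip: s_def)
      then have "s \<le> C\<^sup>2" using s0 by (cases "s = 0") (simp_all add: power2_eq_square)
      then show "(\<Sum>k\<in>F. (norm (cmod (t h k)))\<^sup>2) \<le> C\<^sup>2" by (simp add: s_def)
    qed
  qed simp
  have summ: "(\<lambda>k. t h k *\<^sub>C ell2_apply \<zeta> k) summable_on UNIV" for h and \<zeta> :: "('i, 'a) ell2"
  proof -
    have "(\<lambda>k. (norm (norm (ell2_apply \<zeta> k)))\<^sup>2) summable_on UNIV" using ell2_summable [of \<zeta>] by simp
    from inner_summable [OF row this, of h]
    have "(\<lambda>k. norm (t h k *\<^sub>C ell2_apply \<zeta> k)) summable_on UNIV" by (simp add: norm_scaleC)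
    then show ?thesis by (rule abs_summable_summable)
  qed
  define f where "f \<zeta> h = (\<Sum>\<^sub>\<infinity>k. t h k *\<^sub>C ell2_apply \<zeta> k)" for h and \<zeta> :: "('i, 'a) ell2"
  have hs: "((\<lambda>k. t h k *\<^sub>C ell2_apply \<zeta> k) has_sum f \<zeta> h) UNIV" for h \<zeta>
    unfolding f_def by (rule has_sum_infsum [OF summ])
  have fin: "(\<Sum>h\<in>F. (norm (f \<zeta> h))\<^sup>2) \<le> (C * norm \<zeta>)\<^sup>2" if F: "finite F" for F \<zeta>
  proof (rule tendsto_upperbound [where F = "finite_subsets_at_top UNIV"])
    show "((\<lambda>F'. \<Sum>h\<in>F. (norm (\<Sum>k\<in>F'. t h k *\<^sub>C ell2_apply \<zeta> k))\<^sup>2) \<longlongrightarrow> (\<Sum>h\<in>F. (norm (f \<zeta> h))\<^sup>2))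
        (finite_subsets_at_top UNIV)"
      using hs unfolding has_sum_def by (intro tendsto_intros)
    show "\<forall>\<^sub>F F' in finite_subsets_at_top UNIV.
        (\<Sum>h\<in>F. (norm (\<Sum>k\<in>F'. t h k *\<^sub>C ell2_apply \<zeta> k))\<^sup>2) \<le> (C * norm \<zeta>)\<^sup>2"
    proof (rule eventually_finite_subsets_at_top_weakI)
      fix F' :: "'i set" assume F': "finite F'"
      have "(\<Sum>h\<in>F. (norm (\<Sum>k\<in>F'. t h k *\<^sub>C ell2_apply \<zeta> k))\<^sup>2)
          \<le> C\<^sup>2 * (\<Sum>k\<in>F'. (norm (ell2_apply \<zeta> k))\<^sup>2)"
        by (intro scalar_matrix_vector_bound bd F F')
      also have "\<dots> \<le> C\<^sup>2 * (norm \<zeta>)\<^sup>2"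
        by (intro mult_left_mono norm_ell2_finite_sum F') simp
      finally show "(\<Sum>h\<in>F. (norm (\<Sum>k\<in>F'. t h k *\<^sub>C ell2_apply \<zeta> k))\<^sup>2) \<le> (C * norm \<zeta>)\<^sup>2"
        by (simp add: power_mult_distrib)
    qed
  qed simp
  have sq: "(\<lambda>h. (norm (f \<zeta> h))\<^sup>2) summable_on UNIV" for \<zeta>
  proof (rule nonneg_bdd_above_summable_on)
    show "bdd_above (sum (\<lambda>h. (norm (f \<zeta> h))\<^sup>2) ` {F. F \<subseteq> UNIV \<and> finite F})"
      by (rule bdd_aboveI2 [of _ _ "(C * norm \<zeta>)\<^sup>2"]) (use fin in blast)
  qed simp
  have E: "ell2_apply (Ell2 (f \<zeta>)) = f \<zeta>" for \<zeta>
    using sq by (simp add: Ell2_inverse)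
  have B: "bop_apply (Bop (\<lambda>\<zeta>. Ell2 (f \<zeta>))) = (\<lambda>\<zeta>. Ell2 (f \<zeta>))"
  proof (rule Bop_apply)
    show "Ell2 (f (\<zeta> + \<eta>)) = Ell2 (f \<zeta>) + Ell2 (f \<eta>)" for \<zeta> \<eta>
    proof (rule ell2_eqI)
      fix h
      have "((\<lambda>k. t h k *\<^sub>C ell2_apply (\<zeta> + \<eta>) k) has_sum (f \<zeta> h + f \<eta> h)) UNIV"
        using has_sum_add [OF hs hs, of h \<zeta> h \<eta>] by (simp add: plus_ell2.rep_eq scaleC_add_right)
      then have "f (\<zeta> + \<eta>) h = f \<zeta> h + f \<eta> h" using has_sum_unique [OF hs] by blast
      then show "ell2_apply (Ell2 (f (\<zeta> + \<eta>))) h = ell2_apply (Ell2 (f \<zeta>) + Ell2 (f \<eta>)) h"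
        by (simp add: E plus_ell2.rep_eq)
    qed
    show "Ell2 (f (c *\<^sub>C \<zeta>)) = c *\<^sub>C Ell2 (f \<zeta>)" for c \<zeta>
    proof (rule ell2_eqI)
      fix h
      have "bounded_linear (bop_apply (c *\<^sub>C 1 :: 'a bop))" by (rule bop_clinear)
      from has_sum_bounded_linear [OF this hs, of h \<zeta>]
      have "((\<lambda>k. t h k *\<^sub>C ell2_apply (c *\<^sub>C \<zeta>) k) has_sum (c *\<^sub>C f \<zeta> h)) UNIV"
        by (simp add: o_def scaleC_bop.rep_eq one_bop.rep_eq scaleC_ell2.rep_eq scaleC_scaleC mult.commute)
      then have "f (c *\<^sub>C \<zeta>) h = c *\<^sub>C f \<zeta> h" using has_sum_unique [OF hs] by blast
      then show "ell2_apply (Ell2 (f (c *\<^sub>C \<zeta>))) h = ell2_apply (c *\<^sub>C Ell2 (f \<zeta>)) h"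
        by (simp add: E scaleC_ell2.rep_eq)
    qed
    show "norm (Ell2 (f \<zeta>)) \<le> C * norm \<zeta>" for \<zeta>
    proof (rule power2_le_imp_le)
      show "(norm (Ell2 (f \<zeta>)))\<^sup>2 \<le> (C * norm \<zeta>)\<^sup>2"
        unfolding norm_ell2_power2 by (rule infsum_le_finite_sums) (use sq fin in \<open>simp_all add: E\<close>)
    qed (simp add: C)
  qed
  have "entry (Bop (\<lambda>\<zeta>. Ell2 (f \<zeta>))) h k = t h k *\<^sub>C 1" for h k
  proof (rule bop_eqI)
    fix v :: 'a
    have "((\<lambda>j. t h j *\<^sub>C ell2_apply (delta k v) j) has_sum t h k *\<^sub>C v) {k}"
      using has_sum_finite [of "{k}" "\<lambda>j. t h j *\<^sub>C ell2_apply (delta k v) j"] by (simp add: delta.rep_eq)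
    then have "((\<lambda>j. t h j *\<^sub>C ell2_apply (delta k v) j) has_sum t h k *\<^sub>C v) UNIV"
      by (rule has_sum_cong_neutral [THEN iffD1, rotated -1]) (auto simp: delta.rep_eq)
    then have "f (delta k v) h = t h k *\<^sub>C v" using has_sum_unique [OF hs] by blast
    then show "bop_apply (entry (Bop (\<lambda>\<zeta>. Ell2 (f \<zeta>))) h k) v = bop_apply (t h k *\<^sub>C 1) v"
      by (simp add: entry_apply B E scaleC_bop.rep_eq one_bop.rep_eq)
  qed
  then show ?thesis by blast
qed

text \<open>The tensor of the basis vector at \<open>k\<close> with \<open>V\<close>, arranged so
  that \<open>amp x\<close> acts on it. Pairing two such vectors applies the functional given by
  \<open>V\<close> and \<open>W\<close> to a single matrix entry of \<open>x\<close>.\<close>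

lift_definition delta_lift :: "'i \<Rightarrow> ('j, 'a::complex_hilbert) ell2 \<Rightarrow> ('j, ('i, 'a) ell2) ell2"
  is "\<lambda>k V i. delta k (V i)"
  by simp

lemma cinner_amp_delta_lift:
  "cinner (bop_apply (amp x) (delta_lift k V)) (delta_lift h W) = cinner (bop_apply (amp (entry x h k)) V) W"
  unfolding cinner_ell2.rep_eq [of _ "delta_lift h W"] cinner_ell2.rep_eq [of _ W]
  by (simp add: amp_apply delta_lift.rep_eq cinner_delta_right entry_apply)

lemma amp_zero: "amp 0 = 0"
  by (rule bop_eqI, rule ell2_eqI) (simp add: amp_apply zero_bop.rep_eq zero_ell2.rep_eq)

lemma norm_sum_delta_lift:
  assumes "finite F"
  shows "(norm (\<Sum>k\<in>F. a k *\<^sub>C delta_lift k V))\<^sup>2 = (\<Sum>k\<in>F. (cmod (a k))\<^sup>2) * (norm V)\<^sup>2"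
proof -
  \<comment> \<open>Orthogonality is read off from the entries of the identity operator.\<close>
  have d: "cinner (delta_lift h V) (delta_lift k V) = (if h = k then cinner V V else 0)" for h k
    using cinner_amp_delta_lift [of 1 h V k V] amp_apply [of 0 V]
    by (simp add: amp_one entry_one one_bop.rep_eq amp_zero zero_bop.rep_eq split: if_splits)
  have "cinner (\<Sum>k\<in>F. a k *\<^sub>C delta_lift k V) (\<Sum>k\<in>F. a k *\<^sub>C delta_lift k V)
      = (\<Sum>k\<in>F. \<Sum>h\<in>F. if h = k then a k * cnj (a k) * cinner V V else 0)"
    by (simp add: cinner_sum_left cinner_sum_right cinner_scaleC_left cinner_scaleC_right d if_distrib
        sum_distrib_left mult_ac cong: if_cong)
  also have "\<dots> = (\<Sum>k\<in>F. a k * cnj (a k)) * cinner V V"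
    using assms by (simp add: sum_distrib_right)
  finally have "complex_of_real ((norm (\<Sum>k\<in>F. a k *\<^sub>C delta_lift k V))\<^sup>2)
      = complex_of_real ((\<Sum>k\<in>F. (cmod (a k))\<^sup>2) * (norm V)\<^sup>2)"
    unfolding cinner_self by (simp add: flip: complex_norm_square)
  then show ?thesis using of_real_eq_iff by blast
qed

text \<open>Boundedness of a slice map: applying one normal functional to all entries of
  \<open>x\<close> amounts to compressing \<open>amp x\<close> to the vectors
  \<open>delta_lift k V\<close> and \<open>delta_lift h W\<close>, whose combinations have
  computable norms.\<close>

lemma sliced_matrix_bound:
  fixes x :: "('i, 'a::complex_hilbert) ell2 bop" and V W :: "('j, 'a) ell2"
  assumes F: "finite F" "finite F'"
    and t: "\<And>h k. t h k = cinner (bop_apply (amp (entry x h k)) V) W"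
  defines "C \<equiv> norm (amp x :: ('j, ('i, 'a) ell2) ell2 bop) * norm V * norm W"
  shows "(\<Sum>h\<in>F. (cmod (\<Sum>k\<in>F'. t h k * a k))\<^sup>2) \<le> C\<^sup>2 * (\<Sum>k\<in>F'. (cmod (a k))\<^sup>2)"
proof -
  define b where "b h = (\<Sum>k\<in>F'. t h k * a k)" for h
  define A where "A = (\<Sum>k\<in>F'. (cmod (a k))\<^sup>2)"
  define D where "D = (\<Sum>h\<in>F. (cmod (b h))\<^sup>2)"
  have A0: "0 \<le> A" and D0: "0 \<le> D" by (simp_all add: A_def D_def sum_nonneg)
  have C0: "0 \<le> C" by (simp add: C_def)
  define Z where "Z = (\<Sum>k\<in>F'. a k *\<^sub>C delta_lift k V)"
  \<comment> \<open>The coefficients \<open>b\<close> are the image of \<open>a\<close> under the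
    matrix, so that the pairing with \<open>Y\<close> returns exactly the sum of squares
    \<open>D\<close>.\<close>
  define Y where "Y = (\<Sum>h\<in>F. b h *\<^sub>C delta_lift h W)"
  have "complex_of_real D = (\<Sum>h\<in>F. b h * cnj (b h))"
    by (simp add: D_def flip: complex_norm_square)
  also have "\<dots> = cinner (bop_apply (amp x) Z) Y"
    by (simp add: Z_def Y_def bop_apply_sum bop_clinear cinner_sum_left cinner_sum_right cinner_scaleC_left
        cinner_scaleC_right cinner_amp_delta_lift t [symmetric] b_def sum_distrib_left sum_distrib_right mult_ac)
  finally have "D = cmod (cinner (bop_apply (amp x) Z) Y)"
    using D0 by (metis abs_of_nonneg norm_of_real)
  also have "\<dots> \<le> (norm (amp x :: ('j, ('i, 'a) ell2) ell2 bop) * norm Z) * norm Y"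
    by (rule order_trans [OF cmod_cinner_le mult_right_mono [OF bop_bound norm_ge_zero]])
  also have "norm Z = sqrt A * norm V"
    by (rule power2_eq_imp_eq) (simp_all add: Z_def norm_sum_delta_lift F power_mult_distrib A0 flip: A_def)
  also have "norm Y = sqrt D * norm W"
    by (rule power2_eq_imp_eq) (simp_all add: Y_def norm_sum_delta_lift F power_mult_distrib D0 flip: D_def)
  finally have le: "sqrt D * sqrt D \<le> (C * sqrt A) * sqrt D"
    using D0 by (simp add: C_def mult_ac)
  have "sqrt D \<le> C * sqrt A"
    using mult_right_le_imp_le [OF le] D0 C0 A0 by (cases "D = 0") simp_all
  then have "(sqrt D)\<^sup>2 \<le> (C * sqrt A)\<^sup>2" by (intro power_mono) (simp_all add: D0)
  then show ?thesis using D0 A0 by (simp add: power_mult_distrib A_def D_def b_def)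
qed

section \<open>Trace-preserving actions and their crossed products\<close>

lemma cp_unitary_apply: "ell2_apply (bop_apply (cp_unitary g) \<zeta>) h = ell2_apply \<zeta> (- g + h)"
  by (simp add: cp_unitary.rep_eq shift_ell2.rep_eq)

lemma cp_unitary_delta: "bop_apply (cp_unitary g) (delta k v) = delta (g + k) v"
proof (rule ell2_eqI)
  fix h
  have "- g + h = k \<longleftrightarrow> h = g + k" by (metis add_minus_cancel minus_add_cancel)
  then show "ell2_apply (bop_apply (cp_unitary g) (delta k v)) h = ell2_apply (delta (g + k) v) h"
    by (simp add: cp_unitary_apply delta.rep_eq)
qed

lemma cp_unitary_zero: "cp_unitary 0 = 1"
  by (intro bop_eqI ell2_eqI) (simp add: cp_unitary_apply one_bop.rep_eq)

lemma cp_unitary_add: "cp_unitary (g + h) = cp_unitary g * cp_unitary h"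
  by (intro bop_eqI ell2_eqI) (simp add: cp_unitary_apply times_bop.rep_eq minus_add diff_conv_add_uminus add.assoc
    del: add_uminus_conv_diff)

lemma adj_cp_unitary: "adj (cp_unitary g) = cp_unitary (- g)"
proof (rule adj_eqI)
  fix \<zeta> \<eta> :: "('a, 'b) ell2"
  show "cinner (bop_apply (cp_unitary (- g)) \<zeta>) \<eta> = cinner \<zeta> (bop_apply (cp_unitary g) \<eta>)"
    unfolding cinner_ell2.rep_eq cp_unitary_apply
    using infsum_reindex_bij_betw [OF bij_left_translation [of "- g"],
        of "\<lambda>h. cinner (ell2_apply \<zeta> h) (ell2_apply \<eta> (- g + h))"]
    by simp
qed

lemma entry_cp_unitary_mult: "entry (cp_unitary g * y) h k = entry y (- g + h) k"
  by (rule bop_eqI) (simp add: entry_apply times_bop.rep_eq cp_unitary_apply)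

lemma entry_mult_cp_unitary: "entry (y * cp_unitary g) h k = entry y h (g + k)"
  by (rule bop_eqI) (simp add: entry_apply times_bop.rep_eq cp_unitary_delta)

lemma star_monoid_range_cp_unitary: "star_monoid (range (cp_unitary :: 'g::group_add \<Rightarrow> ('g, 'a::complex_hilbert) ell2 bop))"
  unfolding star_monoid_def
proof (intro conjI ballI)
  show "1 \<in> range cp_unitary" by (rule range_eqI [of _ _ 0]) (simp add: cp_unitary_zero)
qed (auto simp: adj_cp_unitary simp flip: cp_unitary_add)

lemma entry_commutant_cp_unitary:
  assumes "y \<in> commutant (range cp_unitary)"
  shows "entry y h k = entry y 0 (- h + k)"
proof -
  have "cp_unitary (- h) * y = y * cp_unitary (- h)" by (rule commutantD [OF assms]) simp
  then have "entry (cp_unitary (- h) * y) 0 k = entry (y * cp_unitary (- h)) 0 k" by simp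
  then show ?thesis by (simp add: entry_cp_unitary_mult entry_mult_cp_unitary)
qed

section \<open>The group von Neumann algebra\<close>

lemma group_vna_closed:
  assumes "x \<in> group_vna"
  shows group_vna_scaleC: "c *\<^sub>C x \<in> group_vna"
    and group_vna_mult: "y \<in> group_vna \<Longrightarrow> x * y \<in> group_vna"
    and group_vna_diff: "y \<in> group_vna \<Longrightarrow> x - y \<in> group_vna"
  using assms by (auto simp: group_vna_def commutant_closed)

lemma cp_unitary_in_group_vna: "cp_unitary g \<in> group_vna"
  unfolding group_vna_def by (rule subsetD [OF subset_double_commutant]) simp

lemma group_vna_sum: "(\<And>i. i \<in> I \<Longrightarrow> f i \<in> group_vna) \<Longrightarrow> (\<Sum>i\<in>I. f i) \<in> group_vna"
  unfolding group_vna_def by (rule commutant_sum)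

text \<open>The half of the commutation theorem for \<open>L(G)\<close> that is needed.\<close>

lemma convolution_in_group_vna:
  fixes b :: "('g::group_add, 'a::complex_hilbert) ell2 bop"
  assumes b: "\<And>h k. entry b h k = f (k - h) *\<^sub>C 1"
  shows "b \<in> group_vna"
  unfolding group_vna_def
proof (rule commutantI)
  fix y :: "('g, 'a) ell2 bop"
  assume y: "y \<in> commutant (range cp_unitary)"
  show "y * b = b * y"
  proof (rule entry_eqI, rule bop_eqI)
    fix h m :: 'g and v :: 'a
    have 1: "((\<lambda>k. f (m - k) *\<^sub>C bop_apply (entry y 0 (- h + k)) v) has_sum
        bop_apply (entry (y * b) h m) v) UNIV"
      using has_sum_entry [of y h "bop_apply b (delta m v)"]
      by (simp add: entry_apply [symmetric] b entry_commutant_cp_unitary [OF y, of h] scaleC_bop.rep_eq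
          one_bop.rep_eq bop_clinear) (simp add: entry_apply times_bop.rep_eq)
    have 2: "((\<lambda>k. f (k - h) *\<^sub>C bop_apply (entry y 0 (- k + m)) v) has_sum
        bop_apply (entry (b * y) h m) v) UNIV"
      using has_sum_entry [of b h "bop_apply y (delta m v)"]
      by (simp add: entry_apply [symmetric] b entry_commutant_cp_unitary [OF y, of _ m] scaleC_bop.rep_eq
          one_bop.rep_eq) (simp add: entry_apply times_bop.rep_eq)
    \<comment> \<open>Entries of \<open>y\<close> depend on \<open>- h + k\<close>, those of
      \<open>b\<close> on \<open>k - h\<close>. This substitution turns \<open>m - k\<close> into
      \<open>k - h\<close> and \<open>- h + k\<close> into \<open>- k + m\<close>, so it exchanges
      the two products.\<close>
    have bij: "bij (\<lambda>k. h - k + m)"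
    proof (rule bij_betw_byWitness [where f' = "\<lambda>j. m - j + h"])
      show "\<forall>k\<in>UNIV. m - (h - k + m) + h = k" "\<forall>k\<in>UNIV. h - (m - k + h) + m = k"
        by (simp_all add: diff_conv_add_uminus minus_add add.assoc del: add_uminus_conv_diff)
    qed auto
    have "f (m - (h - k + m)) *\<^sub>C bop_apply (entry y 0 (- h + (h - k + m))) v
        = f (k - h) *\<^sub>C bop_apply (entry y 0 (- k + m)) v" for k
      by (simp add: diff_conv_add_uminus minus_add add.assoc del: add_uminus_conv_diff)
    with has_sum_reindex_bij_betw [OF bij, THEN iffD2, OF 1]
    have "((\<lambda>k. f (k - h) *\<^sub>C bop_apply (entry y 0 (- k + m)) v) has_sum
        bop_apply (entry (y * b) h m) v) UNIV"
      by simp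
    then show "bop_apply (entry (y * b) h m) v = bop_apply (entry (b * y) h m) v"
      using 2 has_sum_unique by blast
  qed
qed

section \<open>The covariant representation of the action\<close>

locale tracial_action =
  fixes N :: "'a::complex_hilbert bop set" and \<tau> :: "'a bop \<Rightarrow> complex"
    and \<alpha> :: "'g::group_add \<Rightarrow> 'a bop \<Rightarrow> 'a bop"
  assumes vna: "von_neumann_algebra N"
    and trace: "faithful_normal_tracial_state N \<tau>"
    and action: "trace_preserving_action N \<tau> \<alpha>"
begin

lemmas N_closed = von_neumann_algebra_closed [OF vna]

abbreviation "\<pi> \<equiv> cp_embed \<alpha>"
abbreviation "M \<equiv> crossed_product N \<alpha>"
abbreviation u :: "'g \<Rightarrow> ('g, 'a) ell2 bop" where "u \<equiv> cp_unitary"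

lemma \<tau>_linear:
  "x \<in> N \<Longrightarrow> y \<in> N \<Longrightarrow> \<tau> (x + y) = \<tau> x + \<tau> y" "x \<in> N \<Longrightarrow> \<tau> (c *\<^sub>C x) = c * \<tau> x" "\<tau> 1 = 1"
  using trace by (auto simp: faithful_normal_tracial_state_def)

lemma \<tau>_zero: "\<tau> 0 = 0"
  using \<tau>_linear(2) [of 0 0] N_closed by simp

lemma \<tau>_pos: "x \<in> N \<Longrightarrow> \<tau> (adj x * x) \<in> \<real>" "x \<in> N \<Longrightarrow> 0 \<le> Re (\<tau> (adj x * x))"
    "x \<in> N \<Longrightarrow> \<tau> (adj x * x) = 0 \<Longrightarrow> x = 0"
  using trace by (auto simp: faithful_normal_tracial_state_def)

text \<open>Faithfulness, applied with \<open>a = adj (x - y)\<close>.\<close>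

lemma \<tau>_nondegenerate:
  assumes "x \<in> N" "y \<in> N" "\<And>a. a \<in> N \<Longrightarrow> \<tau> (a * x) = \<tau> (a * y)"
  shows "x = y"
proof -
  have "\<tau> (adj (x - y) * (x - y)) = \<tau> (adj (x - y) * x + (- 1) *\<^sub>C (adj (x - y) * y))"
    by (simp add: scaleC_minus_one algebra_simps)
  also have "\<dots> = \<tau> (adj (x - y) * x) - \<tau> (adj (x - y) * y)"
    using assms(1,2) by (simp add: \<tau>_linear N_closed del: bop_scaleC_mult complex_vector.scale_minus_left)
  also have "\<dots> = 0" using assms by (simp add: N_closed)
  finally show ?thesis using \<tau>_pos(3) [of "x - y"] assms(1,2) by (simp add: N_closed)
qed

lemma \<alpha>_automorphism: "star_automorphism N (\<alpha> g)"
  using action by (simp add: trace_preserving_action_def)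

lemma \<alpha>_closed: "x \<in> N \<Longrightarrow> \<alpha> g x \<in> N"
  using \<alpha>_automorphism [of g] by (auto simp: star_automorphism_def bij_betw_def)

lemma \<alpha>_simps:
  "x \<in> N \<Longrightarrow> y \<in> N \<Longrightarrow> \<alpha> g (x + y) = \<alpha> g x + \<alpha> g y"
  "x \<in> N \<Longrightarrow> y \<in> N \<Longrightarrow> \<alpha> g (x * y) = \<alpha> g x * \<alpha> g y"
  "x \<in> N \<Longrightarrow> \<alpha> g (c *\<^sub>C x) = c *\<^sub>C \<alpha> g x" "x \<in> N \<Longrightarrow> \<alpha> g (adj x) = adj (\<alpha> g x)"
  "\<alpha> g 1 = 1"
  using \<alpha>_automorphism [of g] star_automorphism_one [OF vna \<alpha>_automorphism] by (auto simp: star_automorphism_def)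

lemma \<alpha>_zero: "\<alpha> g 0 = 0"
  using \<alpha>_simps(3) [of 0 g 0] N_closed by simp

lemma \<alpha>_add: "x \<in> N \<Longrightarrow> \<alpha> g (\<alpha> h x) = \<alpha> (g + h) x"
  using action by (simp add: trace_preserving_action_def)

text \<open>That the neutral element acts trivially is not an axiom of
  \<open>trace_preserving_action\<close>; it follows since \<open>\<alpha> 0\<close> is idempotent
  and injective on \<open>N\<close>.\<close>

lemma \<alpha>_0: "x \<in> N \<Longrightarrow> \<alpha> 0 x = x"
  using \<alpha>_automorphism [of 0] \<alpha>_add [of x 0 0] \<alpha>_closed [of x 0]
  by (simp add: star_automorphism_def bij_betw_def inj_on_def)

lemma \<tau>_\<alpha>: "x \<in> N \<Longrightarrow> \<tau> (\<alpha> g x) = \<tau> x"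
  using action by (simp add: trace_preserving_action_def)

lemma \<alpha>_sum: "(\<And>i. i \<in> I \<Longrightarrow> f i \<in> N) \<Longrightarrow> \<alpha> g (\<Sum>i\<in>I. f i) = (\<Sum>i\<in>I. \<alpha> g (f i))"
  by (induction I rule: infinite_finite_induct) (simp_all add: \<alpha>_zero \<alpha>_simps N_closed)

text \<open>Contractivity of automorphisms enters here: \<open>norm x\<close> is the orbit bound
  that \<open>cp_embed_apply\<close> requires.\<close>

lemma \<pi>_apply:
  assumes "x \<in> N"
  shows "ell2_apply (bop_apply (\<pi> x) \<zeta>) h = bop_apply (\<alpha> (- h) x) (ell2_apply \<zeta> h)"
  by (rule cp_embed_apply [where C = "norm x"]) (rule star_automorphism_norm_le [OF vna \<alpha>_automorphism assms])

lemma entry_\<pi>_mult: "x \<in> N \<Longrightarrow> entry (\<pi> x * y) h k = \<alpha> (- h) x * entry y h k"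
  by (rule bop_eqI) (simp add: entry_apply times_bop.rep_eq \<pi>_apply)

lemma \<pi>_one: "\<pi> 1 = 1"
  by (intro bop_eqI ell2_eqI) (simp add: \<pi>_apply N_closed \<alpha>_simps one_bop.rep_eq)

lemma \<pi>_mult: "x \<in> N \<Longrightarrow> y \<in> N \<Longrightarrow> \<pi> (x * y) = \<pi> x * \<pi> y"
  by (intro bop_eqI ell2_eqI) (simp add: \<pi>_apply N_closed \<alpha>_simps times_bop.rep_eq)

lemma \<pi>_scaleC: "x \<in> N \<Longrightarrow> \<pi> (c *\<^sub>C x) = c *\<^sub>C \<pi> x"
  by (intro bop_eqI ell2_eqI) (simp add: \<pi>_apply N_closed \<alpha>_simps scaleC_bop.rep_eq scaleC_ell2.rep_eq)

lemma \<pi>_sum: "(\<And>i. i \<in> I \<Longrightarrow> f i \<in> N) \<Longrightarrow> \<pi> (\<Sum>i\<in>I. f i) = (\<Sum>i\<in>I. \<pi> (f i))"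
  by (intro bop_eqI ell2_eqI)
    (simp add: \<pi>_apply N_closed \<alpha>_sum bop_sum_apply ell2_apply_sum)

lemma adj_\<pi>: "x \<in> N \<Longrightarrow> adj (\<pi> x) = \<pi> (adj x)"
  by (rule adj_eqI) (simp add: cinner_ell2.rep_eq \<pi>_apply N_closed \<alpha>_simps cinner_adj)

lemma u_\<pi>: "x \<in> N \<Longrightarrow> u g * \<pi> x = \<pi> (\<alpha> g x) * u g"
  by (intro bop_eqI ell2_eqI)
    (simp add: times_bop.rep_eq cp_unitary_apply \<pi>_apply \<alpha>_closed \<alpha>_add minus_add)

text \<open>The monomials spanning the algebraic crossed product. By covariance they form a star
  monoid, they generate \<open>M\<close>, and each has at most one nonzero entry in every
  row.\<close>

definition S :: "('g, 'a) ell2 bop set" where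
  "S = {\<pi> x * u g | x g. x \<in> N}"

lemma S_I: "x \<in> N \<Longrightarrow> \<pi> x * u g \<in> S"
  by (auto simp: S_def)

lemma entry_S: "x \<in> N \<Longrightarrow> entry (\<pi> x * u g) h k = (if h = g + k then \<alpha> (- h) x else 0)"
  using entry_mult_cp_unitary [of "1 :: ('g, 'a) ell2 bop" g h k] by (simp add: entry_\<pi>_mult entry_one)

lemma star_monoid_S: "star_monoid S"
  unfolding star_monoid_def
proof (intro conjI ballI)
  show "1 \<in> S" using S_I [of 1 0] by (simp add: \<pi>_one cp_unitary_zero N_closed)
  fix x assume "x \<in> S"
  then obtain a g where a: "a \<in> N" "x = \<pi> a * u g" by (auto simp: S_def)
  have "adj x = u (- g) * \<pi> (adj a)" by (simp add: a adj_mult adj_cp_unitary adj_\<pi>)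
  also have "\<dots> = \<pi> (\<alpha> (- g) (adj a)) * u (- g)" by (simp add: u_\<pi> a N_closed)
  finally show "adj x \<in> S" using a by (auto intro!: S_I \<alpha>_closed N_closed)
  fix y assume "y \<in> S"
  then obtain b h where b: "b \<in> N" "y = \<pi> b * u h" by (auto simp: S_def)
  have "x * y = \<pi> a * (u g * \<pi> b) * u h" by (simp add: a b mult.assoc)
  also have "\<dots> = \<pi> (a * \<alpha> g b) * u (g + h)"
    by (simp add: u_\<pi> a b \<pi>_mult \<alpha>_closed cp_unitary_add mult.assoc)
  finally show "x * y \<in> S" using a b by (auto intro!: S_I \<alpha>_closed N_closed)
qed

lemma M_eq: "M = commutant (commutant S)"
proof -
  have "commutant S = commutant (\<pi> ` N \<union> range u)"
  proof
    have "\<pi> ` N \<subseteq> S"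
      using S_I [of _ 0] by (auto simp: cp_unitary_zero)
    moreover have "range u \<subseteq> S"
      using S_I [of 1] by (auto simp: \<pi>_one N_closed)
    ultimately show "commutant S \<subseteq> commutant (\<pi> ` N \<union> range u)" by (intro commutant_antimono) auto
    show "commutant (\<pi> ` N \<union> range u) \<subseteq> commutant S"
    proof
      fix y assume y: "y \<in> commutant (\<pi> ` N \<union> range u)"
      show "y \<in> commutant S"
      proof (rule commutantI)
        fix s assume "s \<in> S"
        then obtain a g where a: "a \<in> N" "s = \<pi> a * u g" by (auto simp: S_def)
        have "\<pi> a * y = y * \<pi> a" "u g * y = y * u g"
          by (rule commutantD [OF y]; use a in blast)+
        then show "s * y = y * s" unfolding a by (metis mult.assoc)
      qed
    qed
  qed
  then show ?thesis by (simp add: crossed_product_def)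
qed

lemma M_closed:
  "x \<in> M \<Longrightarrow> y \<in> M \<Longrightarrow> x + y \<in> M" "x \<in> M \<Longrightarrow> y \<in> M \<Longrightarrow> x * y \<in> M" "x \<in> M \<Longrightarrow> c *\<^sub>C x \<in> M"
  "a \<in> N \<Longrightarrow> \<pi> a \<in> M" "u g \<in> M" "(\<And>i. i \<in> I \<Longrightarrow> f i \<in> M) \<Longrightarrow> (\<Sum>i\<in>I. f i) \<in> M"
  "x \<in> group_vna \<Longrightarrow> x \<in> M"
proof -
  show "a \<in> N \<Longrightarrow> \<pi> a \<in> M" "u g \<in> M"
    unfolding crossed_product_def by (rule subsetD [OF subset_double_commutant], simp)+
  show "x \<in> group_vna \<Longrightarrow> x \<in> M"
    unfolding crossed_product_def group_vna_def
    using commutant_antimono [OF commutant_antimono, of "range u" "\<pi> ` N \<union> range u"] by auto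
qed (simp_all add: M_eq commutant_closed commutant_sum)

lemma M_inverse: "x \<in> M \<Longrightarrow> x * y = 1 \<Longrightarrow> y * x = 1 \<Longrightarrow> y \<in> M"
  unfolding M_eq by (rule commutant_inverse)

text \<open>If \<open>y\<close> commutes with \<open>N\<close>, then \<open>amp y\<close> commutes
  with \<open>S\<close> and hence with \<open>x\<close>; so every entry of \<open>x\<close> lies in
  the double commutant of \<open>N\<close>.\<close>

lemma entry_in_N:
  assumes x: "x \<in> M"
  shows "entry x h k \<in> N"
proof -
  have "entry x h k \<in> commutant (commutant N)"
  proof (rule commutantI)
    fix y assume y: "y \<in> commutant N"
    have "amp y \<in> commutant S"
    proof (rule commutantI)
      fix s assume "s \<in> S"
      then obtain a g where a: "a \<in> N" "s = \<pi> a * u g" by (auto simp: S_def)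
      have "y * entry s h k = entry s h k * y" for h k
        using commutantD [OF y \<alpha>_closed [OF a(1)]] by (simp add: a entry_S)
      then have "amp y * s = s * amp y" unfolding amp_commute_iff by blast
      then show "s * amp y = amp y * s" by simp
    qed
    from commutantD [OF x [unfolded M_eq] this] show "y * entry x h k = entry x h k * y"
      unfolding amp_commute_iff by blast
  qed
  then show ?thesis using vna by (simp add: von_neumann_algebra_def)
qed

text \<open>The two square summable sequences in \<open>normal_functional\<close> are packed into
  vectors of \<open>ell2\<close> over \<open>nat\<close>, the form in which
  \<open>double_commutant_normal_eq\<close> handles functionals.\<close>

lemma \<tau>_normal: "\<exists>V W :: (nat, 'a) ell2. \<forall>x\<in>N. \<tau> x = cinner (bop_apply (amp x) V) W"
proof -
  have "normal_functional N \<tau>" using trace by (simp add: faithful_normal_tracial_state_def)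
  then obtain v w where v: "summable (\<lambda>i::nat. (norm (v i))\<^sup>2)" and w: "summable (\<lambda>i. (norm (w i))\<^sup>2)"
    and \<tau>: "\<And>x. x \<in> N \<Longrightarrow> (\<lambda>i. cinner (bop_apply x (v i)) (w i)) sums \<tau> x"
    unfolding normal_functional_def by auto
  have E: "ell2_apply (Ell2 z) = z" if "summable (\<lambda>i. (norm (z i))\<^sup>2)" for z :: "nat \<Rightarrow> 'a"
    using that by (subst Ell2_inverse) (simp_all add: summable_on_UNIV_nonneg_real_iff)
  have "\<tau> x = cinner (bop_apply (amp x) (Ell2 v)) (Ell2 w)" if x: "x \<in> N" for x
  proof -
    have "(\<lambda>i. cinner (bop_apply x (v i)) (w i)) sums cinner (bop_apply (amp x) (Ell2 v)) (Ell2 w)"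
      using has_sum_imp_sums [OF has_sum_infsum [OF cinner_ell2_summable [of "bop_apply (amp x) (Ell2 v)" "Ell2 w"]]]
      by (simp add: cinner_ell2.rep_eq amp_apply E v w)
    then show ?thesis by (rule sums_unique2 [OF \<tau> [OF x]])
  qed
  then show ?thesis by blast
qed

text \<open>Both sides are normal functionals of \<open>x\<close>, so it suffices to compare them on \<open>S\<close>.\<close>

lemma \<tau>_entry:
  assumes x: "x \<in> M"
  shows "\<tau> (entry x h k) = \<tau> (entry x 0 (k - h))"
proof -
  obtain V W :: "(nat, 'a) ell2" where VW: "\<And>x. x \<in> N \<Longrightarrow> \<tau> x = cinner (bop_apply (amp x) V) W"
    using \<tau>_normal by blast
  have "cinner (bop_apply (amp x) (delta_lift k V)) (delta_lift h W)
      = cinner (bop_apply (amp x) (delta_lift (k - h) V)) (delta_lift 0 W)"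
  proof (rule double_commutant_normal_eq [OF star_monoid_S x [unfolded M_eq]])
    fix s assume "s \<in> S"
    then obtain a g where a: "a \<in> N" "s = \<pi> a * u g" by (auto simp: S_def)
    \<comment> \<open>The two entries of a monomial vanish together; otherwise they are images of
      \<open>a\<close> under the action and have the same trace.\<close>
    have "h = g + k \<longleftrightarrow> 0 = g + (k - h)"
      by (metis add_diff_eq right_minus_eq)
    then show "cinner (bop_apply (amp s) (delta_lift k V)) (delta_lift h W)
        = cinner (bop_apply (amp s) (delta_lift (k - h) V)) (delta_lift 0 W)"
      using a by (simp add: cinner_amp_delta_lift entry_S VW [symmetric] \<alpha>_closed \<tau>_\<alpha> amp_zero zero_bop.rep_eq)
  qed
  then show ?thesis
    by (simp add: cinner_amp_delta_lift VW entry_in_N x)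
qed

text \<open>Traces of entries are already known to agree along \<open>k - h\<close>. Multiplying
  \<open>x\<close> by \<open>\<pi> (\<alpha> h a)\<close> multiplies row \<open>h\<close> by an
  arbitrary \<open>a\<close>, and nondegeneracy of \<open>\<tau>\<close> upgrades the equality of
  traces to one of entries.\<close>

lemma entry_covariant:
  assumes x: "x \<in> M"
  shows "entry x h k = \<alpha> (- h) (entry x 0 (k - h))"
proof (rule \<tau>_nondegenerate)
  fix a assume a: "a \<in> N"
  have "\<tau> (a * entry x h k) = \<tau> (entry (\<pi> (\<alpha> h a) * x) h k)"
    using a by (simp add: entry_\<pi>_mult \<alpha>_closed \<alpha>_add \<alpha>_0)
  also have "\<dots> = \<tau> (entry (\<pi> (\<alpha> h a) * x) 0 (k - h))"
    using a x by (intro \<tau>_entry M_closed(2,4) \<alpha>_closed)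
  also have "\<dots> = \<tau> (\<alpha> (- h) (\<alpha> h a * entry x 0 (k - h)))"
    using a x by (simp add: entry_\<pi>_mult \<alpha>_closed \<alpha>_add \<tau>_\<alpha> N_closed entry_in_N)
  also have "\<dots> = \<tau> (a * \<alpha> (- h) (entry x 0 (k - h)))"
    using a x by (simp add: \<alpha>_simps \<alpha>_closed \<alpha>_add \<alpha>_0 entry_in_N)
  finally show "\<tau> (a * entry x h k) = \<tau> (a * \<alpha> (- h) (entry x 0 (k - h)))" .
qed (use x in \<open>simp_all add: entry_in_N \<alpha>_closed\<close>)

lemma M_eqI:
  assumes "x \<in> M" "y \<in> M" "\<And>k. entry x 0 k = entry y 0 k"
  shows "x = y"
proof (rule entry_eqI)
  fix h k
  show "entry x h k = entry y h k"
    unfolding entry_covariant [OF assms(1), of h k] entry_covariant [OF assms(2), of h k] assms(3) ..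
qed

text \<open>Every \<open>amp y\<close> commutes with the translations, so the entry commutes with
  all bounded operators. Rank-one operators then force it to be a scalar; the zero space, which has
  no such operators, is a separate case.\<close>

lemma group_vna_entry:
  fixes x :: "('g, 'a) ell2 bop"
  assumes x: "x \<in> group_vna"
  shows "\<exists>c. entry x h k = c *\<^sub>C 1"
proof -
  have comm: "y * entry x h k = entry x h k * y" for y :: "'a bop"
  proof -
    have "amp y \<in> commutant (range u)"
      by (auto intro!: commutantI bop_eqI ell2_eqI simp: times_bop.rep_eq amp_apply cp_unitary_apply)
    from commutantD [OF x [unfolded group_vna_def] this] show ?thesis
      by (simp add: amp_commute_iff)
  qed
  show ?thesis
  proof (cases "\<exists>e :: 'a. e \<noteq> 0")
    case False
    then show ?thesis by (intro exI [of _ 0] bop_eqI) metis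
  next
    case True
    then obtain e :: 'a where e: "e \<noteq> 0" by blast
    have "bop_apply (entry x h k) w
        = bop_apply ((cinner (bop_apply (entry x h k) e) e / cinner e e) *\<^sub>C 1) w" for w
    proof -
      define y where "y = Bop (\<lambda>v. cinner v e *\<^sub>C w)"
      have y: "bop_apply y = (\<lambda>v. cinner v e *\<^sub>C w)"
        unfolding y_def
      proof (rule Bop_apply)
        show "norm (cinner v e *\<^sub>C w) \<le> (norm e * norm w) * norm v" for v
          using mult_right_mono [OF cmod_cinner_le [of v e], of "norm w"] by (simp add: norm_scaleC mult_ac)
      qed (simp_all add: cinner_add_left scaleC_add_left cinner_scaleC_left scaleC_scaleC)
      have "bop_apply (y * entry x h k) e = bop_apply (entry x h k * y) e" by (simp only: comm)
      then have "cinner (bop_apply (entry x h k) e) e *\<^sub>C w = cinner e e *\<^sub>C bop_apply (entry x h k) w"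
        by (simp add: times_bop.rep_eq y bop_clinear)
      then have "(1 / cinner e e) *\<^sub>C cinner (bop_apply (entry x h k) e) e *\<^sub>C w = bop_apply (entry x h k) w"
        using e by (simp add: scaleC_scaleC cinner_self_eq_0)
      then show ?thesis by (simp add: scaleC_scaleC scaleC_bop.rep_eq one_bop.rep_eq)
    qed
    then show ?thesis by (intro exI bop_eqI)
  qed
qed

text \<open>Hermitian symmetry is not among the trace axioms. It is obtained by polarization, from
  the reality of \<open>\<tau> (adj z * z)\<close> at \<open>z = x + y\<close> and at
  \<open>z = x + \<i> *\<^sub>C y\<close>.\<close>

lemma trace_inner_form: "positive_definite_form N (trace_inner \<tau>)"
proof
  show "csubspace N" by (rule complex_vector.subspaceI) (auto simp: N_closed)
  fix x y z c
  assume x: "x \<in> N"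
  show "trace_inner \<tau> x x = 0 \<Longrightarrow> x = 0" "0 \<le> Re (trace_inner \<tau> x x)"
    using x \<tau>_pos by (simp_all add: trace_inner_def)
  assume y: "y \<in> N"
  show scale: "trace_inner \<tau> (c *\<^sub>C x) y = c * trace_inner \<tau> x y"
    using x y by (simp add: trace_inner_def \<tau>_linear N_closed)
  show "trace_inner \<tau> (x + y) z = trace_inner \<tau> x z + trace_inner \<tau> y z" if "z \<in> N"
    using x y that by (simp add: trace_inner_def \<tau>_linear N_closed distrib_left)
  show "trace_inner \<tau> x y = cnj (trace_inner \<tau> y x)"
  proof -
    define a where "a = trace_inner \<tau> x y"
    define b where "b = trace_inner \<tau> y x"
    have im: "Im (\<tau> (adj z * z)) = 0" if "z \<in> N" for z
      using \<tau>_pos(1) [OF that] by (simp add: complex_is_Real_iff)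
    have exp: "\<tau> (adj (x + c *\<^sub>C y) * (x + c *\<^sub>C y))
        = \<tau> (adj x * x) + c * b + cnj c * a + cnj c * c * \<tau> (adj y * y)" for c
      using x y by (simp add: adj_add adj_scaleC distrib_left distrib_right \<tau>_linear N_closed a_def b_def
          trace_inner_def scaleC_scaleC add.assoc)
    have "Im (b + a) = 0"
      using exp [of 1] im [of "x + 1 *\<^sub>C y"] im [OF x] im [OF y] x y by (simp add: N_closed)
    moreover have "Im (\<i> * b - \<i> * a) = 0"
      using exp [of \<i>] im [of "x + \<i> *\<^sub>C y"] im [OF x] im [OF y] x y by (simp add: N_closed)
    ultimately have "a = cnj b" by (simp add: complex_eq_iff)
    then show ?thesis by (simp add: a_def b_def)
  qed
qed

sublocale L2: positive_definite_form N "trace_inner \<tau>"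
  by (rule trace_inner_form)

lemma norm2_eq: "norm2 \<tau> = L2.nrm"
  by (simp add: fun_eq_iff norm2_def L2.nrm_def trace_inner_def)

text \<open>By Pythagoras no point of \<open>U\<close> is closer to \<open>d\<close> than 0 is, so
  the open ball about \<open>d\<close> of radius \<open>L2.nrm d\<close> would miss
  \<open>U\<close>.\<close>

lemma dense_orthogonal:
  assumes d: "d \<in> N" and U: "norm2_topology N \<tau> closure_of U = N" "U \<subseteq> N"
    and orth: "\<And>x. x \<in> U \<Longrightarrow> trace_inner \<tau> d x = 0"
  shows "d = 0"
proof -
  let ?d = "\<lambda>x y. if x \<in> N \<and> y \<in> N then norm2 \<tau> (x - y) else 0"
  interpret Metric_space N ?d
  proof
    fix x y z
    show "0 \<le> ?d x y" by (simp add: norm2_eq L2.nrm_nonneg N_closed)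
    show "?d x y = ?d y x" by (simp add: norm2_eq L2.nrm_commute)
    assume x: "x \<in> N" and y: "y \<in> N"
    show "?d x y = 0 \<longleftrightarrow> x = y" using x y by (simp add: norm2_eq L2.nrm_eq_0 N_closed)
    assume z: "z \<in> N"
    show "?d x z \<le> ?d x y + ?d y z"
      using x y z L2.nrm_triangle [of "x - y" "y - z"] by (simp add: norm2_eq N_closed)
  qed
  have cl: "d \<in> mtopology closure_of U" using U(1) d by (simp add: norm2_topology_def)
  show ?thesis
  proof (rule ccontr)
    assume "d \<noteq> 0"
    then have pos: "0 < L2.nrm d" using L2.nrm_eq_0 [OF d] L2.nrm_nonneg [OF d] by simp
    with cl obtain y where y: "y \<in> U" "y \<in> mball d (L2.nrm d)"
      unfolding metric_closure_of by blast
    then have yN: "y \<in> N" and lt: "L2.nrm (d - y) < L2.nrm d"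
      using d U(2) by (auto simp: norm2_eq)
    have o: "trace_inner \<tau> d y = 0" "trace_inner \<tau> y d = 0"
      using orth [OF y(1)] L2.herm [OF yN d] by simp_all
    have "(L2.nrm (d - y))\<^sup>2 = (L2.nrm d)\<^sup>2 + (L2.nrm y)\<^sup>2"
      using d yN o by (simp add: L2.nrm_square L2.diff_left L2.diff_right N_closed)
    then have "(L2.nrm d)\<^sup>2 \<le> (L2.nrm (d - y))\<^sup>2" by simp
    then have "L2.nrm d \<le> L2.nrm (d - y)"
      by (rule power2_le_imp_le) (simp add: L2.nrm_nonneg d yN N_closed)
    then show False using lt by simp
  qed
qed

lemma trace_inner_\<alpha>: "x \<in> N \<Longrightarrow> y \<in> N \<Longrightarrow> trace_inner \<tau> (\<alpha> g x) (\<alpha> g y) = trace_inner \<tau> x y"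
  using \<tau>_\<alpha> [of "adj y * x" g] by (simp add: trace_inner_def \<alpha>_simps N_closed)

text \<open>The action is isometric for \<open>trace_inner \<tau>\<close> and both \<open>g\<close>
  and \<open>- g\<close> preserve the span, so the orthogonal complement is preserved as
  well.\<close>

lemma \<alpha>_proj:
  assumes e: "L2.orthonormal n e" and inv: "\<And>g. \<alpha> g ` cspan (e ` {..<n}) \<subseteq> cspan (e ` {..<n})"
    and x: "x \<in> N"
  shows "\<alpha> g (L2.proj n e x) = L2.proj n e (\<alpha> g x)"
proof (rule L2.proj_eqI [symmetric, OF e])
  have pN: "L2.proj n e x \<in> N" using L2.proj_in_span L2.orthonormal_span_subset [OF e] by blast
  show "\<alpha> g (L2.proj n e x) \<in> cspan (e ` {..<n})" using inv L2.proj_in_span by blast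
  fix i assume i: "i < n"
  have ei: "e i \<in> cspan (e ` {..<n})" using i by (intro complex_vector.span_base) auto
  then have eN: "e i \<in> N" using L2.orthonormal_span_subset [OF e] by blast
  have "\<alpha> g x - \<alpha> g (L2.proj n e x) = \<alpha> g (x - L2.proj n e x)"
    using \<alpha>_simps(1) [of "x - L2.proj n e x" "L2.proj n e x" g] x pN by (simp add: N_closed)
  then have "trace_inner \<tau> (\<alpha> g x - \<alpha> g (L2.proj n e x)) (e i)
      = trace_inner \<tau> (\<alpha> g (x - L2.proj n e x)) (\<alpha> g (\<alpha> (- g) (e i)))"
    using eN by (simp add: \<alpha>_add \<alpha>_0)
  then have "trace_inner \<tau> (\<alpha> g x - \<alpha> g (L2.proj n e x)) (e i)
      = trace_inner \<tau> (x - L2.proj n e x) (\<alpha> (- g) (e i))"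
    using trace_inner_\<alpha> [of "x - L2.proj n e x" "\<alpha> (- g) (e i)" g] x pN eN by (simp add: N_closed \<alpha>_closed)
  also have "\<dots> = 0" by (rule L2.proj_orthogonal [OF e x]) (use inv ei in blast)
  finally show "trace_inner \<tau> (\<alpha> g x - \<alpha> g (L2.proj n e x)) (e i) = 0" .
qed (simp add: \<alpha>_closed x)

section \<open>The conditional expectation onto \<open>L(G)\<close>\<close>

text \<open>The scalar matrix of the traces of the entries is bounded as a slice of
  \<open>amp x\<close>, and it depends only on \<open>k - h\<close> by \<open>\<tau>_entry\<close>;
  hence it is a convolution operator in \<open>L(G)\<close>.\<close>

lemma expectation_exists:
  assumes x: "x \<in> M"
  shows "\<exists>b \<in> group_vna. \<forall>h k. entry b h k = \<tau> (entry x h k) *\<^sub>C (1 :: 'a bop)"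
proof -
  obtain V W :: "(nat, 'a) ell2" where VW: "\<And>x. x \<in> N \<Longrightarrow> \<tau> x = cinner (bop_apply (amp x) V) W"
    using \<tau>_normal by blast
  have "\<exists>b :: ('g, 'a) ell2 bop. \<forall>h k. entry b h k = \<tau> (entry x h k) *\<^sub>C 1"
    by (rule scalar_matrix_operator, rule sliced_matrix_bound [of _ _ _ x V W])
      (simp_all add: VW entry_in_N x)
  then obtain b :: "('g, 'a) ell2 bop" where b: "\<And>h k. entry b h k = \<tau> (entry x h k) *\<^sub>C 1" by blast
  then have "b \<in> group_vna"
    using \<tau>_entry [OF x] by (intro convolution_in_group_vna [of b "\<lambda>k. \<tau> (entry x 0 k)"]) metis
  then show ?thesis by (intro bexI [of _ b]) (simp_all add: b)
qed

text \<open>For \<open>x \<in> M\<close> the choice is unique, since entries determine an operator;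
  outside \<open>M\<close> the value carries no meaning.\<close>

definition expect :: "('g, 'a) ell2 bop \<Rightarrow> ('g, 'a) ell2 bop" where
  "expect x = (SOME b. b \<in> group_vna \<and> (\<forall>h k. entry b h k = \<tau> (entry x h k) *\<^sub>C 1))"

lemma expect:
  assumes "x \<in> M"
  shows "expect x \<in> group_vna" "entry (expect x) h k = \<tau> (entry x h k) *\<^sub>C 1"
  using someI_ex [of "\<lambda>b. b \<in> group_vna \<and> (\<forall>h k. entry b h k = \<tau> (entry x h k) *\<^sub>C 1)"]
    expectation_exists [OF assms] unfolding expect_def by auto

text \<open>For \<open>v = u g\<close> both sides arise by shifting columns. Tested on vectors, both
  are normal functionals of \<open>v\<close>, so the equality extends to the double commutant of the
  translations.\<close>

lemma expect_mult:
  assumes x: "x \<in> M" and v: "v \<in> group_vna"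
  shows "expect (x * v) = expect x * v"
proof (rule entry_eqI, rule bop_eqI, rule cinner_eqI)
  fix h m :: 'g and a a' :: 'a
  obtain V W :: "(nat, 'a) ell2" where VW: "\<And>x. x \<in> N \<Longrightarrow> \<tau> x = cinner (bop_apply (amp x) V) W"
    using \<tau>_normal by blast
  define c where "c = cinner a a'"
  \<comment> \<open>Left multiplication by \<open>x\<close> is moved to the second vector as an
    adjoint, and the scalar \<open>c\<close> as its conjugate, so that only \<open>amp y\<close>
    remains between the vectors.\<close>
  have L: "cinner (bop_apply (amp y) (delta_lift m V)) (cnj c *\<^sub>C bop_apply (amp (adj x)) (delta_lift h W))
      = \<tau> (entry (x * y) h m) * c" if "y \<in> M" for y
  proof -
    have "cinner (bop_apply (amp y) (delta_lift m V)) (cnj c *\<^sub>C bop_apply (amp (adj x)) (delta_lift h W))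
        = c * cinner (bop_apply (amp (x * y)) (delta_lift m V)) (delta_lift h W)"
      by (simp add: cinner_scaleC_right adj_amp [symmetric] cinner_adj' amp_mult times_bop.rep_eq)
    then show ?thesis using x that by (simp add: cinner_amp_delta_lift VW entry_in_N M_closed)
  qed
  \<comment> \<open>A single vector functional, placed at coordinate 0 of an \<open>ell2\<close>
    over \<open>nat\<close> to match the shape of \<open>L\<close>.\<close>
  have R: "cinner (bop_apply (amp y) (delta (0::nat) (delta m a))) (delta 0 (bop_apply (adj (expect x)) (delta h a')))
      = cinner (bop_apply (entry (expect x * y) h m) a) a'" for y
    by (simp add: amp_delta cinner_delta_left delta.rep_eq cinner_adj' entry_apply times_bop.rep_eq cinner_delta_right)
  have "cinner (bop_apply (amp v) (delta_lift m V)) (cnj c *\<^sub>C bop_apply (amp (adj x)) (delta_lift h W))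
      = cinner (bop_apply (amp v) (delta (0::nat) (delta m a))) (delta 0 (bop_apply (adj (expect x)) (delta h a')))"
  proof (rule double_commutant_normal_eq [OF star_monoid_range_cp_unitary v [unfolded group_vna_def]])
    fix s :: "('g, 'a) ell2 bop" assume "s \<in> range cp_unitary"
    then obtain g where s: "s = u g" by auto
    have "\<tau> (entry (x * u g) h m) * c = cinner (bop_apply (entry (expect x * u g) h m) a) a'"
      using x by (simp add: entry_mult_cp_unitary expect c_def scaleC_bop.rep_eq one_bop.rep_eq cinner_scaleC_left)
    then show "cinner (bop_apply (amp s) (delta_lift m V)) (cnj c *\<^sub>C bop_apply (amp (adj x)) (delta_lift h W))
      = cinner (bop_apply (amp s) (delta (0::nat) (delta m a))) (delta 0 (bop_apply (adj (expect x)) (delta h a')))"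
      unfolding s R by (subst L) (simp_all add: M_closed(5))
  qed
  then have "\<tau> (entry (x * v) h m) * c = cinner (bop_apply (entry (expect x * v) h m) a) a'"
    unfolding R using L [OF M_closed(7) [OF v]] by simp
  then show "cinner (bop_apply (entry (expect (x * v)) h m) a) a' = cinner (bop_apply (entry (expect x * v) h m) a) a'"
    using x v by (simp add: expect M_closed c_def scaleC_bop.rep_eq one_bop.rep_eq cinner_scaleC_left)
qed

text \<open>The orthogonal projection of \<open>M\<close> onto the \<open>L(G)\<close>-bimodule \<open>\<Sum>\<^sub>i \<xi>\<^sub>i L(G)\<close>.\<close>

definition band :: "nat \<Rightarrow> (nat \<Rightarrow> 'a bop) \<Rightarrow> ('g, 'a) ell2 bop \<Rightarrow> ('g, 'a) ell2 bop" where
  "band n \<xi> x = (\<Sum>i<n. \<pi> (\<xi> i) * expect (\<pi> (adj (\<xi> i)) * x))"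

lemma band_in_M:
  assumes "L2.orthonormal n \<xi>" "x \<in> M"
  shows "band n \<xi> x \<in> M"
  unfolding band_def using assms
  by (intro M_closed(6)) (auto simp: L2.orthonormal_def M_closed N_closed expect)

text \<open>In row 0 the embedding \<open>\<pi>\<close> acts without a twist, and the expectation
  contributes the scalar \<open>\<tau> (adj (\<xi> i) * entry x 0 k)\<close>, the coefficient of the
  projection.\<close>

lemma entry_band:
  assumes \<xi>: "L2.orthonormal n \<xi>" and x: "x \<in> M"
  shows "entry (band n \<xi> x) 0 k = L2.proj n \<xi> (entry x 0 k)"
  unfolding band_def L2.proj_def entry_sum
proof (rule sum.cong [OF refl])
  fix i assume "i \<in> {..<n}"
  then have "\<xi> i \<in> N" using \<xi> by (simp add: L2.orthonormal_def)
  then show "entry (\<pi> (\<xi> i) * expect (\<pi> (adj (\<xi> i)) * x)) 0 k = trace_inner \<tau> (entry x 0 k) (\<xi> i) *\<^sub>C \<xi> i"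
    using x by (simp add: entry_\<pi>_mult \<alpha>_0 expect M_closed N_closed trace_inner_def)
qed

lemma band_mult_right:
  assumes "L2.orthonormal n \<xi>" "x \<in> M" "v \<in> group_vna"
  shows "band n \<xi> (x * v) = band n \<xi> x * v"
  unfolding band_def sum_distrib_right
proof (rule sum.cong [OF refl])
  fix i assume "i \<in> {..<n}"
  then have "\<pi> (adj (\<xi> i)) * x \<in> M" using assms by (simp add: L2.orthonormal_def M_closed N_closed)
  from expect_mult [OF this assms(3)]
  show "\<pi> (\<xi> i) * expect (\<pi> (adj (\<xi> i)) * (x * v)) = \<pi> (\<xi> i) * expect (\<pi> (adj (\<xi> i)) * x) * v"
    by (simp add: mult.assoc)
qed

text \<open>Left multiplication by \<open>u g\<close> applies \<open>\<alpha> g\<close> to the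
  Fourier coefficients and shifts their index; the projection onto an invariant subspace commutes
  with both.\<close>

lemma band_mult_left:
  assumes \<xi>: "L2.orthonormal n \<xi>" and inv: "\<And>g. \<alpha> g ` cspan (\<xi> ` {..<n}) \<subseteq> cspan (\<xi> ` {..<n})"
    and x: "x \<in> M"
  shows "u g * band n \<xi> x = band n \<xi> (u g * x)"
proof (rule M_eqI)
  fix k
  have "entry (u g * band n \<xi> x) 0 k = \<alpha> g (L2.proj n \<xi> (entry x 0 (k + g)))"
    using entry_covariant [OF band_in_M [OF \<xi> x], of "- g" k]
    by (simp add: entry_cp_unitary_mult entry_band \<xi> x)
  also have "\<dots> = L2.proj n \<xi> (\<alpha> g (entry x 0 (k + g)))"
    by (rule \<alpha>_proj [OF \<xi> inv]) (simp add: entry_in_N x)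
  also have "\<alpha> g (entry x 0 (k + g)) = entry (u g * x) 0 k"
    using entry_covariant [OF x, of "- g" k] by (simp add: entry_cp_unitary_mult)
  finally show "entry (u g * band n \<xi> x) 0 k = entry (band n \<xi> (u g * x)) 0 k"
    using \<xi> x by (simp add: entry_band M_closed)
qed (use \<xi> x in \<open>simp_all add: band_in_M M_closed\<close>)

section \<open>The relative commutant of \<open>L(G)\<close>\<close>

text \<open>Commutation makes the entries a function \<open>d\<close> of \<open>- h + k\<close>, and
  together with the covariance of \<open>M\<close> this gives
  \<open>d (g + m - g) = \<alpha> g (d m)\<close>. Bounded sums of \<open>q\<close> then clash with
  infinite conjugacy classes.\<close>

lemma relative_commutant_trivial:
  assumes icc: "icc TYPE('g)" and erg: "ergodic_action N \<alpha>"
    and x: "x \<in> M" and comm: "\<And>g. u g * x = x * u g"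
  shows "\<exists>c. x = c *\<^sub>C 1"
proof -
  define d where "d m = entry x 0 m" for m
  have dN: "d m \<in> N" for m using x by (simp add: d_def entry_in_N)
  have xc: "x \<in> commutant (range u)" by (rule commutantI) (auto simp: comm)
  have xd: "entry x h k = d (- h + k)" for h k
    using entry_commutant_cp_unitary [OF xc] by (simp add: d_def)
  have conj: "d (g + m - g) = \<alpha> g (d m)" for g m
    using entry_covariant [OF x, of "- g" "m - g"] xd [of "- g" "m - g"]
    by (simp add: d_def add_diff_eq)
  obtain V W :: "(nat, 'a) ell2" where VW: "\<And>x. x \<in> N \<Longrightarrow> \<tau> x = cinner (bop_apply (amp x) V) W"
    using \<tau>_normal by blast
  \<comment> \<open>The coefficients \<open>d m\<close> make up column 0 of \<open>x\<close>, in the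
    rows \<open>- m\<close>; the sum is thus a partial sum of the squared norm of \<open>x\<close>
    applied to that column.\<close>
  have bound: "(\<Sum>m\<in>F. (norm (bop_apply (amp (d m)) Z))\<^sup>2) \<le> (norm (bop_apply (amp x) (delta_lift 0 Z)))\<^sup>2"
    if F: "finite F" for F and Z :: "(nat, 'a) ell2"
  proof -
    define z where "z i = bop_apply x (delta 0 (ell2_apply Z i))" for i
    have dz: "bop_apply (d m) (ell2_apply Z i) = ell2_apply (z i) (- m)" for m i
      using xd [of "- m" 0] by (simp add: z_def flip: entry_apply)
    have zs: "(\<lambda>i. (norm (z i))\<^sup>2) summable_on UNIV"
      using ell2_summable [of "bop_apply (amp x) (delta_lift 0 Z)"]
      by (simp add: amp_apply delta_lift.rep_eq z_def)
    have hs: "((\<lambda>i. \<Sum>m\<in>F. (norm (ell2_apply (z i) (- m)))\<^sup>2) has_sum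
        (\<Sum>m\<in>F. \<Sum>\<^sub>\<infinity>i. (norm (ell2_apply (z i) (- m)))\<^sup>2)) UNIV"
    proof (intro has_sum_sum has_sum_infsum)
      show "(\<lambda>i. (norm (ell2_apply (z i) (- m)))\<^sup>2) summable_on UNIV" for m
        using ell2_summable [of "bop_apply (amp (d m)) Z"] by (simp add: amp_apply dz)
    qed
    have "(\<Sum>m\<in>F. (norm (bop_apply (amp (d m)) Z))\<^sup>2) = (\<Sum>m\<in>F. \<Sum>\<^sub>\<infinity>i. (norm (ell2_apply (z i) (- m)))\<^sup>2)"
      by (simp add: norm_ell2_power2 amp_apply dz)
    also have "\<dots> = (\<Sum>\<^sub>\<infinity>i. \<Sum>m\<in>F. (norm (ell2_apply (z i) (- m)))\<^sup>2)"
      using hs by (rule infsumI [symmetric])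
    also have "\<dots> \<le> (\<Sum>\<^sub>\<infinity>i. (norm (z i))\<^sup>2)"
    proof (rule infsum_mono [OF _ zs])
      show "(\<lambda>i. \<Sum>m\<in>F. (norm (ell2_apply (z i) (- m)))\<^sup>2) summable_on UNIV"
        using hs by (rule has_sum_imp_summable)
      show "(\<Sum>m\<in>F. (norm (ell2_apply (z i) (- m)))\<^sup>2) \<le> (norm (z i))\<^sup>2" for i
        using norm_ell2_finite_sum [of "uminus ` F" "z i"] F by (simp add: sum.reindex o_def)
    qed
    also have "\<dots> = (norm (bop_apply (amp x) (delta_lift 0 Z)))\<^sup>2"
      by (simp add: norm_ell2_power2 [of "bop_apply (amp x) (delta_lift 0 Z)"] amp_apply delta_lift.rep_eq z_def)
    finally show ?thesis .
  qed
  \<comment> \<open>\<open>\<tau>\<close> is given by two vectors, so \<open>q m\<close> is the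
    inner product of \<open>amp (d m)\<close> at \<open>V\<close> and at \<open>W\<close>, and it is
    bounded by the sum of both squared norms.\<close>
  define K where "K = (norm (bop_apply (amp x) (delta_lift 0 V)))\<^sup>2 + (norm (bop_apply (amp x) (delta_lift 0 W)))\<^sup>2"
  define q where "q m = Re (\<tau> (adj (d m) * d m))" for m
  have qle: "q m \<le> (norm (bop_apply (amp (d m)) V))\<^sup>2 + (norm (bop_apply (amp (d m)) W))\<^sup>2" for m
  proof -
    let ?v = "bop_apply (amp (d m)) V" and ?w = "bop_apply (amp (d m)) W"
    have "\<tau> (adj (d m) * d m) = cinner ?v ?w"
      by (simp add: VW dN N_closed amp_mult times_bop.rep_eq adj_amp [symmetric] cinner_adj)
    then have "q m = inner ?v ?w" by (simp add: q_def Re_cinner)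
    also have "\<dots> \<le> norm ?v * norm ?w" by (rule norm_cauchy_schwarz)
    also have "\<dots> \<le> (norm ?v)\<^sup>2 + (norm ?w)\<^sup>2"
      using zero_le_power2 [of "norm ?v - norm ?w"] mult_nonneg_nonneg [OF norm_ge_zero [of ?v] norm_ge_zero [of ?w]]
      unfolding power2_diff by linarith
    finally show ?thesis .
  qed
  have qsum: "(\<Sum>m\<in>F. q m) \<le> K" if "finite F" for F
  proof -
    have "(\<Sum>m\<in>F. q m) \<le> (\<Sum>m\<in>F. (norm (bop_apply (amp (d m)) V))\<^sup>2 + (norm (bop_apply (amp (d m)) W))\<^sup>2)"
      by (intro sum_mono qle)
    also have "\<dots> \<le> K" unfolding K_def sum.distrib by (intro add_mono bound that)
    finally show ?thesis .
  qed
  have d0: "d m = 0" if m: "m \<noteq> 0" for m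
  proof (rule ccontr)
    assume "d m \<noteq> 0"
    then have "\<tau> (adj (d m) * d m) \<noteq> 0" using \<tau>_pos(3) [OF dN] by blast
    then have qm: "0 < q m"
      using \<tau>_pos(1,2) [OF dN [of m]] by (auto simp: q_def complex_is_Real_iff complex_eq_iff less_le)
    have qc: "q k = q m" if k: "k \<in> {h + m - h | h. True}" for k
    proof -
      obtain h where "k = h + m - h" using k by blast
      then have "adj (d k) * d k = \<alpha> h (adj (d m) * d m)" by (simp add: conj \<alpha>_simps dN N_closed)
      then show ?thesis by (simp add: q_def \<tau>_\<alpha> dN N_closed)
    qed
    have "infinite {h + m - h | h. True}" using icc m by (simp add: icc_def)
    \<comment> \<open>The cardinality exceeds \<open>K / q m\<close>, which contradicts
      \<open>qsum\<close> because all terms equal \<open>q m\<close>.\<close>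
    then obtain F where F: "F \<subseteq> {h + m - h | h. True}" "finite F" "card F = nat \<lceil>K / q m\<rceil> + 1"
      using infinite_arbitrarily_large by blast
    have "(\<Sum>k\<in>F. q k) = (\<Sum>k\<in>F. q m)" by (rule sum.cong) (use F qc in auto)
    then have "real (card F) * q m \<le> K" using qsum [OF F(2)] by simp
    then have "real (card F) \<le> K / q m" using qm by (simp add: pos_le_divide_eq)
    then show False using F(3) by linarith
  qed
  have "\<forall>g. \<alpha> g (d 0) = d 0" using conj [of _ 0] by simp
  then obtain c where c: "d 0 = c *\<^sub>C 1" using erg dN [of 0] unfolding ergodic_action_def by blast
  have "x = c *\<^sub>C 1"
  proof (rule entry_eqI)
    fix h k :: 'g
    have "- h + k = 0 \<longleftrightarrow> h = k" by (metis add_minus_cancel add.right_neutral left_minus)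
    then show "entry x h k = entry (c *\<^sub>C 1) h k"
      using d0 by (auto simp: xd c entry_linear entry_one)
  qed
  then show ?thesis ..
qed

end

section \<open>The normalizer of \<open>L(G)\<close>\<close>

lemma if_zero_mult:
  "(if P then x else 0) * (y :: 'b::semiring_0) = (if P then x * y else 0)"
  "y * (if P then x else 0) = (if P then y * x else 0)"
  by simp_all

lemma diag_mult_mat:
  "A \<in> carrier_mat n m \<Longrightarrow> diag n x * A = Matrix.mat n m (\<lambda>(i, j). x * (A $$ (i, j) :: 'b::semiring_0))"
  by (rule eq_matI) (simp_all add: diag_def scalar_prod_def if_zero_mult)

lemma mult_diag_mat:
  "A \<in> carrier_mat m n \<Longrightarrow> A * diag n x = Matrix.mat m n (\<lambda>(i, j). A $$ (i, j) * (x :: 'b::semiring_0))"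
  by (rule eq_matI) (simp_all add: diag_def scalar_prod_def if_zero_mult)

context tracial_action
begin

text \<open>Conjugation by \<open>w\<close> maps \<open>L(G)\<close> onto itself; surjectivity is
  what places \<open>adj w * u g * w\<close> in \<open>L(G)\<close>.\<close>

lemma normalizerD:
  assumes "w \<in> normalizer group_vna M"
  shows "w \<in> M" "adj w * w = 1" "w * adj w = 1" "adj w * u g * w \<in> group_vna"
    "w * (adj w * u g * w) = u g * w"
proof -
  show w: "w \<in> M" "adj w * w = 1" "w * adj w = 1"
    using assms by (auto simp: normalizer_def unitaries_def)
  have "u g \<in> (\<lambda>b. w * b * adj w) ` group_vna"
    using assms cp_unitary_in_group_vna by (simp add: normalizer_def)
  then obtain b where b: "b \<in> group_vna" "u g = w * b * adj w" by blast
  have "adj w * u g * w = (adj w * w) * b * (adj w * w)" by (simp add: b(2) mult.assoc)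
  then show "adj w * u g * w \<in> group_vna" using b(1) w by simp
  have "w * (adj w * u g * w) = (w * adj w) * u g * w" by (simp add: mult.assoc)
  then show "w * (adj w * u g * w) = u g * w" using w by simp
qed

lemma normalizer_band:
  assumes icc: "icc TYPE('g)" and erg: "ergodic_action N \<alpha>"
    and w: "w \<in> normalizer group_vna M"
    and \<xi>: "L2.orthonormal n \<xi>" and inv: "\<And>g. \<alpha> g ` cspan (\<xi> ` {..<n}) \<subseteq> cspan (\<xi> ` {..<n})"
  shows "\<exists>c. band n \<xi> w = c *\<^sub>C w"
proof -
  note W = normalizerD [OF w]
  define y where "y = band n \<xi> w"
  have yM: "y \<in> M" unfolding y_def by (rule band_in_M [OF \<xi> W(1)])
  have uy: "u g * y = y * (adj w * u g * w)" for g
    unfolding y_def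
    by (simp only: band_mult_left [OF \<xi> inv W(1)] band_mult_right [OF \<xi> W(1) W(4), symmetric] W(5))
  have "adj w \<in> M" by (rule M_inverse [OF W(1,3,2)])
  then have "y * adj w \<in> M" by (rule M_closed(2) [OF yM])
  moreover have "u g * (y * adj w) = y * adj w * u g" for g
  proof -
    have "u g * (y * adj w) = y * (adj w * u g * w) * adj w" by (simp add: uy mult.assoc [symmetric])
    also have "\<dots> = y * adj w * u g * (w * adj w)" by (simp add: mult.assoc)
    finally show ?thesis by (simp add: W(3))
  qed
  ultimately obtain c where c: "y * adj w = c *\<^sub>C 1"
    using relative_commutant_trivial [OF icc erg] by blast
  have "y = y * adj w * w" by (simp add: mult.assoc W(2))
  also have "\<dots> = c *\<^sub>C w" by (simp add: c)
  finally show ?thesis unfolding y_def by blast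
qed

text \<open>Entries of elements of \<open>L(G)\<close> are scalars, so row 0 of a vanishing
  combination is a linear relation between the orthonormal vectors \<open>\<xi> i\<close>.\<close>

lemma combination_eqI:
  assumes \<xi>: "L2.orthonormal n \<xi>"
    and A: "\<And>i. i < n \<Longrightarrow> A i \<in> group_vna" and B: "\<And>i. i < n \<Longrightarrow> B i \<in> group_vna"
    and eq: "(\<Sum>i<n. \<pi> (\<xi> i) * A i) = (\<Sum>i<n. \<pi> (\<xi> i) * B i)"
    and i: "i < n"
  shows "A i = B i"
proof -
  define D where "D i = A i - B i" for i
  have D: "D i \<in> group_vna" if "i < n" for i
    unfolding D_def by (rule group_vna_diff [OF A B]) (use that in auto)
  have \<xi>N: "\<xi> i \<in> N" if "i < n" for i using \<xi> that by (simp add: L2.orthonormal_def)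
  have "entry (D i) 0 k = 0" for k
  proof -
    have "\<forall>i. \<exists>c. i < n \<longrightarrow> entry (D i) 0 k = c *\<^sub>C 1"
      using group_vna_entry [OF D] by blast
    from choice [OF this] obtain s where s: "\<And>i. i < n \<Longrightarrow> entry (D i) 0 k = s i *\<^sub>C 1"
      by blast
    have "(\<Sum>i<n. \<pi> (\<xi> i) * D i) = 0" by (simp add: D_def right_diff_distrib sum_subtractf eq)
    then have "(\<Sum>i<n. entry (\<pi> (\<xi> i) * D i) 0 k) = 0" by (simp add: entry_linear flip: entry_sum)
    then have "(\<Sum>i<n. s i *\<^sub>C \<xi> i) = 0" by (simp add: entry_\<pi>_mult \<xi>N \<alpha>_0 s)
    then have "s i = 0"
      using L2.B_combination [OF \<xi> i, of s] by (simp add: L2.zero_left \<xi>N i)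
    then show ?thesis by (simp add: s i)
  qed
  then have "D i = 0"
    using M_closed(3) [of "D i" 0] D [OF i] by (intro M_eqI) (simp_all add: M_closed(7) entry_linear)
  then show ?thesis by (simp add: D_def)
qed

text \<open>Moving \<open>u g\<close> past \<open>\<pi> (\<xi> j)\<close> produces
  \<open>\<alpha> g (\<xi> j)\<close>, whose expansion in the invariant span has the entries of the
  representation matrix as coefficients.\<close>

lemma intertwining:
  assumes w: "w \<in> normalizer group_vna M"
    and \<xi>: "L2.orthonormal n \<xi>" and inv: "\<And>g. \<alpha> g ` cspan (\<xi> ` {..<n}) \<subseteq> cspan (\<xi> ` {..<n})"
    and W: "\<And>i. i < n \<Longrightarrow> W i \<in> group_vna" and eq: "w = (\<Sum>i<n. \<pi> (\<xi> i) * W i)"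
    and i: "i < n"
  shows "(\<Sum>j<n. trace_inner \<tau> (\<alpha> g (\<xi> j)) (\<xi> i) *\<^sub>C (u g * W j)) = W i * (adj w * u g * w)"
proof (rule combination_eqI [OF \<xi> _ _ _ i])
  have \<xi>N: "\<xi> i \<in> N" if "i < n" for i using \<xi> that by (simp add: L2.orthonormal_def)
  define R where "R i j = trace_inner \<tau> (\<alpha> g (\<xi> j)) (\<xi> i)" for i j
  have \<alpha>\<xi>: "\<alpha> g (\<xi> j) = (\<Sum>i<n. R i j *\<^sub>C \<xi> i)" if "j < n" for j
  proof -
    have "\<xi> j \<in> cspan (\<xi> ` {..<n})" by (rule complex_vector.span_base) (use that in auto)
    then have "\<alpha> g (\<xi> j) \<in> cspan (\<xi> ` {..<n})" using inv by blast
    from L2.orthonormal_expansion [OF \<xi> this] show ?thesis by (simp add: R_def)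
  qed
  have \<pi>\<xi>: "\<pi> (\<alpha> g (\<xi> j)) = (\<Sum>i<n. R i j *\<^sub>C \<pi> (\<xi> i))" if "j < n" for j
    unfolding \<alpha>\<xi> [OF that] by (subst \<pi>_sum) (auto simp: \<xi>N N_closed \<pi>_scaleC)
  have "(\<Sum>i<n. \<pi> (\<xi> i) * (W i * (adj w * u g * w))) = w * (adj w * u g * w)"
    \<comment> \<open>Only the outer left factor \<open>w\<close> is expanded, not those inside the
      conjugate of \<open>u g\<close>.\<close>
    by (subst (3) eq) (simp only: sum_distrib_right mult.assoc)
  also have "\<dots> = u g * w" by (rule normalizerD(5) [OF w])
  also have "\<dots> = (\<Sum>j<n. u g * (\<pi> (\<xi> j) * W j))" by (subst eq) (rule sum_distrib_left)
  also have "\<dots> = (\<Sum>j<n. \<pi> (\<alpha> g (\<xi> j)) * (u g * W j))"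
    by (rule sum.cong [OF refl]) (simp add: u_\<pi> \<xi>N flip: mult.assoc)
  also have "\<dots> = (\<Sum>j<n. \<Sum>i<n. R i j *\<^sub>C (\<pi> (\<xi> i) * (u g * W j)))"
    by (rule sum.cong [OF refl]) (simp add: \<pi>\<xi> sum_distrib_right)
  also have "\<dots> = (\<Sum>i<n. \<Sum>j<n. R i j *\<^sub>C (\<pi> (\<xi> i) * (u g * W j)))" by (rule sum.swap)
  also have "\<dots> = (\<Sum>i<n. \<pi> (\<xi> i) * (\<Sum>j<n. R i j *\<^sub>C (u g * W j)))"
    by (simp add: sum_distrib_left)
  finally show "(\<Sum>i<n. \<pi> (\<xi> i) * (\<Sum>j<n. trace_inner \<tau> (\<alpha> g (\<xi> j)) (\<xi> i) *\<^sub>C (u g * W j)))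
      = (\<Sum>i<n. \<pi> (\<xi> i) * (W i * (adj w * u g * w)))"
    by (simp add: R_def)
  show "(\<Sum>j<n. trace_inner \<tau> (\<alpha> g (\<xi> j)) (\<xi> i) *\<^sub>C (u g * W j)) \<in> group_vna" for i
    using W by (intro group_vna_sum group_vna_scaleC group_vna_mult cp_unitary_in_group_vna) auto
  show "W i * (adj w * u g * w) \<in> group_vna" if "i < n" for i
    by (intro group_vna_mult W that normalizerD(4) [OF w])
qed

text \<open>Column 0 of the two products is \<open>intertwining\<close>, row by row; all other
  columns vanish on both sides.\<close>

lemma intertwining_matrix:
  assumes w: "w \<in> normalizer group_vna M"
    and \<xi>: "L2.orthonormal n \<xi>" and inv: "\<And>g. \<alpha> g ` cspan (\<xi> ` {..<n}) \<subseteq> cspan (\<xi> ` {..<n})"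
    and W: "\<And>i. i < n \<Longrightarrow> W i \<in> group_vna" and eq: "w = (\<Sum>i<n. \<pi> (\<xi> i) * W i)"
  shows "diag n (u g) * scalar_mat (rep_mat \<tau> \<alpha> n \<xi> g) * first_column_mat n W
    = first_column_mat n W * diag n (adj w * u g * w)"
proof -
  define R where "R i j = trace_inner \<tau> (\<alpha> g (\<xi> j)) (\<xi> i)" for i j
  have "scalar_mat (rep_mat \<tau> \<alpha> n \<xi> g) \<in> carrier_mat n n"
    by (simp add: scalar_mat_def rep_mat_def)
  then have "diag n (u g) * scalar_mat (rep_mat \<tau> \<alpha> n \<xi> g) = Matrix.mat n n (\<lambda>(i, j). R i j *\<^sub>C u g)"
    by (subst diag_mult_mat) (auto simp: scalar_mat_def rep_mat_def R_def intro!: eq_matI)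
  moreover have "Matrix.mat n n (\<lambda>(i, j). R i j *\<^sub>C u g) * first_column_mat n W
      = first_column_mat n W * diag n (adj w * u g * w)"
  proof -
    have "first_column_mat n W \<in> carrier_mat n n" by (simp add: first_column_mat_def)
    from mult_diag_mat [OF this]
    have d: "first_column_mat n W * diag n (adj w * u g * w)
        = Matrix.mat n n (\<lambda>(i, j). if j = 0 then W i * (adj w * u g * w) else 0)"
      by (auto simp: first_column_mat_def intro!: eq_matI)
    show ?thesis
      unfolding d
      using intertwining [OF w \<xi> inv W eq, of _ g]
      by (intro eq_matI) (auto simp: first_column_mat_def scalar_prod_def lessThan_atLeast0 R_def)
  qed
  ultimately show ?thesis by simp
qed

end

theorem theorem3p7:
  fixes N :: "'a::complex_hilbert bop set"
    and \<tau> :: "'a bop \<Rightarrow> complex"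
    and \<alpha> :: "'g::group_add \<Rightarrow> 'a bop \<Rightarrow> 'a bop"
    and Nk :: "nat \<Rightarrow> 'a bop set"
  assumes "icc TYPE('g)"
    and "tracial_von_neumann_algebra N \<tau>"
    and "separable_predual N"
    and "trace_preserving_action N \<tau> \<alpha>"
    and "ergodic_action N \<alpha>"
    and "compact_action N \<tau> \<alpha>"
    and "incseq Nk"
    and "\<And>k. Nk k \<subseteq> N"
    and "\<And>k. csubspace (Nk k)"
    and "\<And>k. finite_cdim (Nk k)"
    and "\<And>k g. \<alpha> g ` Nk k \<subseteq> Nk k"
    and "norm2_topology N \<tau> closure_of (\<Union>k. Nk k) = N"
  shows
    "(\<forall>w \<in> normalizer group_vna (crossed_product N \<alpha>).
       \<exists>k \<xi> W. orthonormal_basis_of \<tau> (Nk k) (cdim (Nk k)) \<xi> \<and>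
         (\<forall>i < cdim (Nk k). W i \<in> group_vna) \<and>
         w = (\<Sum>i < cdim (Nk k). cp_embed \<alpha> (\<xi> i) * W i)) \<and>
     (\<forall>w \<in> normalizer group_vna (crossed_product N \<alpha>). \<forall>k \<xi> W.
       orthonormal_basis_of \<tau> (Nk k) (cdim (Nk k)) \<xi> \<and>
       (\<forall>i < cdim (Nk k). W i \<in> group_vna) \<and>
       w = (\<Sum>i < cdim (Nk k). cp_embed \<alpha> (\<xi> i) * W i) \<longrightarrow>
       (\<forall>g. diag (cdim (Nk k)) (cp_unitary g) * scalar_mat (rep_mat \<tau> \<alpha> (cdim (Nk k)) \<xi> g)
              * first_column_mat (cdim (Nk k)) W
          = first_column_mat (cdim (Nk k)) W * diag (cdim (Nk k)) (adj w * cp_unitary g * w)))"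
proof -
  interpret tracial_action N \<tau> \<alpha>
    using assms(2,4) by unfold_locales (auto simp: tracial_von_neumann_algebra_def)
  have basis_iff: "orthonormal_basis_of \<tau> (Nk k) n \<xi> \<longleftrightarrow> L2.orthonormal n \<xi> \<and> cspan (\<xi> ` {..<n}) = Nk k"
    for k n \<xi>
  proof -
    have "\<xi> i \<in> N" if "cspan (\<xi> ` {..<n}) = Nk k" "i < n" for i
      using complex_vector.span_base [of "\<xi> i" "\<xi> ` {..<n}"] that assms(8) [of k] by auto
    then show ?thesis by (auto simp: orthonormal_basis_of_def L2.orthonormal_def)
  qed
  have "\<exists>k \<xi> W. orthonormal_basis_of \<tau> (Nk k) (cdim (Nk k)) \<xi> \<and>
      (\<forall>i < cdim (Nk k). W i \<in> group_vna) \<and> w = (\<Sum>i < cdim (Nk k). \<pi> (\<xi> i) * W i)"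
    if w: "w \<in> normalizer group_vna M" for w
  proof -
    have wM: "w \<in> M" by (rule normalizerD(1) [OF w])
    have "\<forall>k. \<exists>\<xi>. L2.orthonormal (cdim (Nk k)) \<xi> \<and> cspan (\<xi> ` {..<cdim (Nk k)}) = Nk k"
      using L2.orthonormal_basis_exists [OF assms(9,8,10)] by blast
    from choice [OF this] obtain \<xi> where \<xi>: "\<And>k. L2.orthonormal (cdim (Nk k)) (\<xi> k)"
      and sp: "\<And>k. cspan (\<xi> k ` {..<cdim (Nk k)}) = Nk k" by blast
    define y where "y k = band (cdim (Nk k)) (\<xi> k) w" for k
    \<comment> \<open>If every \<open>y k\<close> vanished, each Fourier coefficient of
      \<open>w\<close> would be orthogonal to all the subspaces, hence zero by density, and
      \<open>w\<close> would be 0.\<close>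
    have "\<exists>k. y k \<noteq> 0"
    proof (rule ccontr)
      assume "\<not> ?thesis"
      then have y0: "y k = 0" for k by blast
      have "entry w 0 m = 0" for m
      proof (rule dense_orthogonal [OF entry_in_N [OF wM] assms(12)])
        show "(\<Union>k. Nk k) \<subseteq> N" using assms(8) by blast
        fix x assume "x \<in> (\<Union>k. Nk k)"
        then obtain k where x: "x \<in> Nk k" by blast
        have "L2.proj (cdim (Nk k)) (\<xi> k) (entry w 0 m) = 0"
          using entry_band [OF \<xi> wM, of k m] y0 [of k] by (simp add: y_def entry_linear)
        then show "trace_inner \<tau> (entry w 0 m) x = 0"
          using L2.proj_orthogonal [OF \<xi> entry_in_N [OF wM], of x k 0 m] x by (simp add: sp)
      qed
      then have "w = 0"
        using M_closed(3) [OF wM, of 0] by (intro M_eqI) (simp_all add: wM entry_linear)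
      then have "(1 :: ('g, 'a) ell2 bop) = 0" using normalizerD(2) [OF w] by simp
      then have "entry (1 :: ('g, 'a) ell2 bop) 0 0 = 0" by (simp add: entry_linear)
      then have "(1 :: 'a bop) = 0" by (simp add: entry_one)
      \<comment> \<open>\<open>\<tau> 1 = 1\<close> rules out \<open>1 = 0\<close>, so a unitary
        cannot vanish.\<close>
      then show False using \<tau>_linear(3) \<tau>_zero by simp
    qed
    then obtain k where k: "y k \<noteq> 0" by blast
    have "\<exists>c. y k = c *\<^sub>C w"
      unfolding y_def by (rule normalizer_band [OF assms(1,5) w \<xi>]) (use assms(11) sp in blast)
    then obtain c where c: "y k = c *\<^sub>C w" by blast
    have c0: "c \<noteq> 0" using c k by auto
    \<comment> \<open>The coefficients of \<open>band\<close> divided by \<open>c\<close>, so that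
      the combination gives \<open>w\<close> instead of \<open>c *\<^sub>C w\<close>.\<close>
    define W where "W i = (1 / c) *\<^sub>C expect (\<pi> (adj (\<xi> k i)) * w)" for i
    have "W i \<in> group_vna" if "i < cdim (Nk k)" for i
      using \<xi> [of k] that wM
      by (simp add: W_def group_vna_scaleC expect M_closed N_closed L2.orthonormal_def)
    moreover have "w = (1 / c) *\<^sub>C y k" using c c0 by (simp add: scaleC_scaleC)
    then have "w = (\<Sum>i < cdim (Nk k). \<pi> (\<xi> k i) * W i)"
      by (simp add: y_def band_def W_def scaleC_sum_right)
    ultimately show ?thesis using \<xi> sp basis_iff by blast
  qed
  moreover have "diag (cdim (Nk k)) (u g) * scalar_mat (rep_mat \<tau> \<alpha> (cdim (Nk k)) \<xi> g)
      * first_column_mat (cdim (Nk k)) W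
      = first_column_mat (cdim (Nk k)) W * diag (cdim (Nk k)) (adj w * u g * w)"
    if "w \<in> normalizer group_vna M" "orthonormal_basis_of \<tau> (Nk k) (cdim (Nk k)) \<xi>"
      "\<forall>i < cdim (Nk k). W i \<in> group_vna" "w = (\<Sum>i < cdim (Nk k). \<pi> (\<xi> i) * W i)" for w k \<xi> W g
    using that assms(11) by (intro intertwining_matrix) (auto simp: basis_iff)
  ultimately show ?thesis by blast
qed

end
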